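(* Let $M$ and $N$ be diffeomorphic compact, connected, oriented smooth $n$-manifolds without boundary embedded in $\mathbb{R}^{n+1}$, with the Riemannian metrics $g_M$, $g_N$ inherited from the Euclidean metric of $\mathbb{R}^{n+1}$, and let $\Phi:\operatorname{Diff}(M,N)\to[0,\infty)$ be the deformation energy functional $$\Phi(h)=\int_M G\big(h^*g_N-g_M,\,h^*g_N-g_M\big)\,\omega_M .$$ Let $h\in\operatorname{Diff}(M,N)$. For every smooth vector field $Y$ on $M$ with flow $\phi_t$, $$\frac{d}{dt}\Phi(h\circ\phi_t)\Big|_{t=0}=2\int_M G\big(h^*g_N-g_M,\,L_Y h^*g_N\big)\,\omega_M ,$$ where $L_Y$ denotes the Lie derivative in the direction $Y$. Consequently $h$ is a critical point of $\Phi$ if and only if $$\int_M G\big(h^*g_N-g_M,\,L_Y h^*g_N\big)\,\omega_M=0$$ for every smooth vector field $Y$ on $M$.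
   Context: $\operatorname{Diff}(M,N)$ is the set of $C^\infty$ diffeomorphisms from $M$ to $N$; $\omega_M$ is the Riemannian volume form of $(M,g_M)$; $h^*g_N$ is the pull-back. $G=g_M^*\otimes g_M^*$ is the metric induced by $g_M$ on $T^*M\otimes T^*M$, given in local coordinates by $G(A,B)=a_{ij}b_{kl}[g_M]^{ik}[g_M]^{jl}$ (Einstein summation) for $A=a_{ij}dx^i\otimes dx^j$ and $B=b_{ij}dx^i\otimes dx^j$, where $[g_M]^{ij}$ are the entries of the inverse of the matrix $([g_M]_{ij})$. A diffeomorphism $h$ is called a critical point of $\Phi$ if $\frac{d}{dt}\Phi(h\circ\phi_t)|_{t=0}=0$ for every smooth vector field $Y$ on $M$ with flow $\phi_t$. *)

theory Defs
  imports "HOL-Analysis.Analysis"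
begin

section \<open>Smooth maps\<close>

text \<open>\<open>C\<^sup>\<infinity>\<close> maps on open subsets of normed spaces: all iterated directional derivatives exist
  and are (Frechet) differentiable.\<close>

primrec higher_differentiable_on ::
  "nat \<Rightarrow> 'a::real_normed_vector set \<Rightarrow> ('a \<Rightarrow> 'b::real_normed_vector) \<Rightarrow> bool" where
  "higher_differentiable_on 0 U f \<longleftrightarrow> continuous_on U f"
| "higher_differentiable_on (Suc k) U f \<longleftrightarrow>
     (\<forall>x\<in>U. f differentiable (at x)) \<and>
     (\<forall>v. higher_differentiable_on k U (\<lambda>x. frechet_derivative f (at x) v))"

definition smooth_on :: "'a::real_normed_vector set \<Rightarrow> ('a \<Rightarrow> 'b::real_normed_vector) \<Rightarrow> bool" where
  "smooth_on U f \<longleftrightarrow> (\<forall>k. higher_differentiable_on k U f)"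

text \<open>On a subset \<open>M\<close> that need not be open, smoothness means having smooth local extensions.
  Only the values of \<open>f\<close> on \<open>M\<close> matter.\<close>

definition smooth_map_on :: "'a::euclidean_space set \<Rightarrow> ('a \<Rightarrow> 'b::real_normed_vector) \<Rightarrow> bool" where
  "smooth_map_on M f \<longleftrightarrow>
     (\<forall>p\<in>M. \<exists>U F. open U \<and> p \<in> U \<and> smooth_on U F \<and> (\<forall>x\<in>U \<inter> M. F x = f x))"

definition diffeomorphisms :: "'a::euclidean_space set \<Rightarrow> 'b::euclidean_space set \<Rightarrow> ('a \<Rightarrow> 'b) set" where
  "diffeomorphisms M N =
     {h. bij_betw h M N \<and> smooth_map_on M h \<and> smooth_map_on N (inv_into M h)}"


section \<open>Oriented embedded manifolds\<close>

text \<open>A chart is given by its inverse, a parametrization \<open>\<psi> : V \<rightarrow> M\<close> of an open part of \<open>M\<close> by an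
  open subset \<open>V\<close> of \<open>\<real>\<^sup>n\<close>. A manifold of dimension \<open>n\<close> has no boundary, since \<open>V\<close> is open in \<open>\<real>\<^sup>n\<close>.\<close>

type_synonym ('n, 'a) chart = "(real ^ 'n) set \<times> (real ^ 'n \<Rightarrow> 'a)"

definition local_parametrization ::
  "'a::euclidean_space set \<Rightarrow> (real ^ 'n::finite) set \<Rightarrow> (real ^ 'n \<Rightarrow> 'a) \<Rightarrow> bool" where
  "local_parametrization M V \<psi> \<longleftrightarrow>
     open V \<and> smooth_on V \<psi> \<and> (\<forall>u\<in>V. inj (frechet_derivative \<psi> (at u))) \<and>
     openin (top_of_set M) (\<psi> ` V) \<and> (\<exists>\<psi>'. homeomorphism V (\<psi> ` V) \<psi> \<psi>')"

text \<open>\<open>M\<close> is an embedded submanifold of dimension \<open>n\<close>, and the atlas \<open>A\<close>, whose transition maps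
  preserve the orientation of \<open>\<real>\<^sup>n\<close>, fixes its orientation.\<close>

definition oriented_manifold ::
  "'a::euclidean_space set \<Rightarrow> ('n::finite, 'a) chart set \<Rightarrow> bool" where
  "oriented_manifold M A \<longleftrightarrow>
     (\<forall>(V, \<psi>)\<in>A. local_parametrization M V \<psi>) \<and>
     M = (\<Union>(V, \<psi>)\<in>A. \<psi> ` V) \<and>
     (\<forall>(V, \<psi>)\<in>A. \<forall>(V', \<psi>')\<in>A. \<forall>u\<in>V. \<psi> u \<in> \<psi>' ` V' \<longrightarrow>
        det (matrix (frechet_derivative (inv_into V' \<psi>' \<circ> \<psi>) (at u))) > 0)"

text \<open>Tangent vectors are velocities of smooth curves in \<open>M\<close>.\<close>

definition tangent_space :: "'a::euclidean_space set \<Rightarrow> 'a \<Rightarrow> 'a set" where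
  "tangent_space M p =
     {v. \<exists>c \<epsilon>. \<epsilon> > (0::real) \<and> smooth_on {-\<epsilon><..<\<epsilon>} c \<and> c ` {-\<epsilon><..<\<epsilon>} \<subseteq> M \<and> c 0 = p \<and>
           (c has_vector_derivative v) (at 0)}"

text \<open>The differential of \<open>F\<close> at \<open>p \<in> M\<close>. A derivative within \<open>M\<close> is determined by \<open>F\<close> on
  \<open>tangent_space M p\<close> only, and only its values there are meaningful.\<close>

definition differential ::
  "'a::euclidean_space set \<Rightarrow> ('a \<Rightarrow> 'b::euclidean_space) \<Rightarrow> 'a \<Rightarrow> 'a \<Rightarrow> 'b" where
  "differential M F p = frechet_derivative F (at p within M)"


section \<open>Covariant 2-tensor fields\<close>

text \<open>A tensor field \<open>T\<close> on \<open>M\<close> is a function of a point \<open>p\<close> and two vectors \<open>v\<close>, \<open>w\<close>; its values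
  are meaningful for \<open>p \<in> M\<close> and \<open>v, w \<in> tangent_space M p\<close>. With this convention the
  metrics induced by the Euclidean metric on all submanifolds are given by one formula.\<close>

type_synonym 'a tensor2 = "'a \<Rightarrow> 'a \<Rightarrow> 'a \<Rightarrow> real"

definition induced_metric :: "'a::euclidean_space tensor2" where
  "induced_metric p v w = v \<bullet> w"

definition pullback ::
  "'a::euclidean_space set \<Rightarrow> ('a \<Rightarrow> 'b::euclidean_space) \<Rightarrow> 'b tensor2 \<Rightarrow> 'a tensor2" where
  "pullback M F T p v w = T (F p) (differential M F p v) (differential M F p w)"

definition coord_vector :: "(real ^ 'n::finite \<Rightarrow> 'a::euclidean_space) \<Rightarrow> real ^ 'n \<Rightarrow> 'n \<Rightarrow> 'a" where
  "coord_vector \<psi> u i = frechet_derivative \<psi> (at u) (axis i 1)"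

definition tensor_coeffs ::
  "'a::euclidean_space tensor2 \<Rightarrow> (real ^ 'n::finite \<Rightarrow> 'a) \<Rightarrow> real ^ 'n \<Rightarrow> real ^ 'n ^ 'n" where
  "tensor_coeffs T \<psi> u = (\<chi> i j. T (\<psi> u) (coord_vector \<psi> u i) (coord_vector \<psi> u j))"

text \<open>The metric \<open>G\<close> on covariant 2-tensors, in local coordinates and as a function on \<open>M\<close>;
  for tensor fields the value does not depend on the chart.\<close>

definition tensor_metric_coords ::
  "'a::euclidean_space tensor2 \<Rightarrow> 'a tensor2 \<Rightarrow> (real ^ 'n::finite \<Rightarrow> 'a) \<Rightarrow> real ^ 'n \<Rightarrow> real" where
  "tensor_metric_coords S T \<psi> u =
     (let a = tensor_coeffs S \<psi> u; b = tensor_coeffs T \<psi> u;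
          ginv = matrix_inv (tensor_coeffs induced_metric \<psi> u)
      in \<Sum>i\<in>UNIV. \<Sum>j\<in>UNIV. \<Sum>k\<in>UNIV. \<Sum>l\<in>UNIV.
           a $ i $ j * b $ k $ l * ginv $ i $ k * ginv $ j $ l)"

definition tensor_metric ::
  "('n::finite, 'a::euclidean_space) chart set \<Rightarrow> 'a tensor2 \<Rightarrow> 'a tensor2 \<Rightarrow> 'a \<Rightarrow> real" where
  "tensor_metric A S T p =
     (THE r. \<exists>(V, \<psi>)\<in>A. \<exists>u\<in>V. \<psi> u = p \<and> r = tensor_metric_coords S T \<psi> u)"


section \<open>Volume form and integration\<close>

text \<open>An \<open>n\<close>-form is a function of a point and of \<open>n\<close> tangent vectors indexed by \<open>'n\<close>.\<close>

type_synonym ('n, 'a) top_form = "'a \<Rightarrow> ('n \<Rightarrow> 'a) \<Rightarrow> real"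

text \<open>The vector \<open>(dx\<^sup>1(v), \<dots>, dx\<^sup>n(v))\<close> of components of a tangent vector \<open>v\<close> at \<open>\<psi> u\<close>.\<close>

definition components :: "(real ^ 'n::finite \<Rightarrow> 'a::euclidean_space) \<Rightarrow> real ^ 'n \<Rightarrow> 'a \<Rightarrow> real ^ 'n" where
  "components \<psi> u v = (THE c. frechet_derivative \<psi> (at u) c = v)"

text \<open>The Riemannian volume form \<open>sqrt (det g) dx\<^sup>1 \<and> \<dots> \<and> dx\<^sup>n\<close> in the charts of the oriented atlas.\<close>

definition volume_form ::
  "('n::finite, 'a::euclidean_space) chart set \<Rightarrow> ('n, 'a) top_form" where
  "volume_form A p vs =
     (THE r. \<exists>(V, \<psi>)\<in>A. \<exists>u\<in>V. \<psi> u = p \<and>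
        r = sqrt (det (tensor_coeffs induced_metric \<psi> u)) *
            det (\<chi> i j. components \<psi> u (vs j) $ i))"

definition partition_of_unity ::
  "'a::euclidean_space set \<Rightarrow> ('n::finite, 'a) chart set \<Rightarrow> nat \<Rightarrow>
   (nat \<Rightarrow> ('n, 'a) chart) \<Rightarrow> (nat \<Rightarrow> 'a \<Rightarrow> real) \<Rightarrow> bool" where
  "partition_of_unity M A m c \<rho> \<longleftrightarrow>
     (\<forall>i<m. c i \<in> A \<and> smooth_map_on M (\<rho> i) \<and> (\<forall>p\<in>M. \<rho> i p \<ge> 0) \<and>
        closure {p\<in>M. \<rho> i p \<noteq> 0} \<subseteq> snd (c i) ` fst (c i)) \<and>
     (\<forall>p\<in>M. (\<Sum>i<m. \<rho> i p) = 1)"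

text \<open>The integral of a continuous \<open>n\<close>-form over a compact oriented manifold, by means of any
  partition of unity subordinate to the atlas.\<close>

definition form_integral ::
  "'a::euclidean_space set \<Rightarrow> ('n::finite, 'a) chart set \<Rightarrow> ('n, 'a) top_form \<Rightarrow> real" where
  "form_integral M A \<omega> =
     (THE r. \<exists>m c \<rho>. partition_of_unity M A m c \<rho> \<and>
        r = (\<Sum>i<m. integral (fst (c i))
               (\<lambda>u. let \<psi> = snd (c i) in \<rho> i (\<psi> u) * \<omega> (\<psi> u) (coord_vector \<psi> u))))"


section \<open>Vector fields, flows and Lie derivatives\<close>

definition smooth_vector_field :: "'a::euclidean_space set \<Rightarrow> ('a \<Rightarrow> 'a) \<Rightarrow> bool" where
  "smooth_vector_field M Y \<longleftrightarrow> smooth_map_on M Y \<and> (\<forall>p\<in>M. Y p \<in> tangent_space M p)"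

definition integral_curve :: "'a::euclidean_space set \<Rightarrow> ('a \<Rightarrow> 'a) \<Rightarrow> (real \<Rightarrow> 'a) \<Rightarrow> bool" where
  "integral_curve M Y c \<longleftrightarrow> (\<forall>t. c t \<in> M \<and> (c has_vector_derivative Y (c t)) (at t))"

text \<open>The flow of a complete vector field; every smooth vector field on a compact manifold without
  boundary is complete.\<close>

definition flow :: "'a::euclidean_space set \<Rightarrow> ('a \<Rightarrow> 'a) \<Rightarrow> real \<Rightarrow> 'a \<Rightarrow> 'a" where
  "flow M Y t p = (THE q. \<exists>c. integral_curve M Y c \<and> c 0 = p \<and> c t = q)"

definition lie_derivative ::
  "'a::euclidean_space set \<Rightarrow> ('a \<Rightarrow> 'a) \<Rightarrow> 'a tensor2 \<Rightarrow> 'a tensor2" where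
  "lie_derivative M Y T p v w = deriv (\<lambda>t. pullback M (flow M Y t) T p v w) 0"


section \<open>The deformation energy\<close>

text \<open>The strain tensor \<open>h\<^sup>* g\<^sub>N - g\<^sub>M\<close>.\<close>

definition strain :: "'a::euclidean_space set \<Rightarrow> ('a \<Rightarrow> 'a) \<Rightarrow> 'a tensor2" where
  "strain M h p v w = pullback M h induced_metric p v w - induced_metric p v w"

definition deformation_energy ::
  "'a::euclidean_space set \<Rightarrow> ('n::finite, 'a) chart set \<Rightarrow> ('a \<Rightarrow> 'a) \<Rightarrow> real" where
  "deformation_energy M A h =
     form_integral M A
       (\<lambda>p vs. tensor_metric A (strain M h) (strain M h) p * volume_form A p vs)"

definition critical_point ::
  "'a::euclidean_space set \<Rightarrow> ('n::finite, 'a) chart set \<Rightarrow> ('a \<Rightarrow> 'a) \<Rightarrow> bool" where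
  "critical_point M A h \<longleftrightarrow>
     (\<forall>Y. smooth_vector_field M Y \<longrightarrow>
        ((\<lambda>t. deformation_energy M A (h \<circ> flow M Y t)) has_real_derivative 0) (at 0))"

end

(* The flow of the vector field Y is realized in the ambient space: Y extends to a smooth, compactly
   supported vector field F, whose flow (Picard iteration) is differentiable by the variational
   equation and preserves M by Nagumo's distance argument. With an extension H of h, the differential
   of h o phi_t on tangent vectors is then a linear map B_t(p), jointly continuous and continuously
   differentiable in t, and the strain and the Lie derivative become the bilinear forms
   <B_t v, B_t w> - <v, w> and <B_0' v, B_0 w> + <B_0 v, B_0' w>.
   If P is the orthogonal projection to the tangent space, then
   G(S, T) = sum_{a,b} S(Pa, Pb) T(Pa, Pb) over an orthonormal basis of the ambient space, so that
   the energy density is a smooth expression in t, uniformly on the compact M, and one may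
   differentiate under the integral sign. Integrals do not depend on the partition of unity by the
   change of variables formula. *)

theory Submission
  imports Defs
begin

text \<open>The definitions set the main obstacle. \<open>differential\<close> picks one derivative
  within M, whose value is determined on tangent vectors only; \<open>tensor_metric\<close>,
  \<open>volume_form\<close>, \<open>form_integral\<close> and \<open>flow\<close> are descriptions
  that denote something only once independence of the chart, of the partition or of the curve is
  known. Hence tensors are compared with ambient bilinear forms on coordinate vectors alone, and the
  projection P makes the resulting formula free of charts, so that one continuous density on all of
  M takes the place of G. The heart of the computation is that (h o phi_t)^* g_N and phi_t^* (h^*
  g_N) coincide: the same B_t describes the strain of h o phi_t and the pullback whose derivative at
  0 is the Lie derivative. The compact support of the extended field makes F and its derivative
  bounded and Lipschitz on the whole space, so that Picard iteration yields solutions for all times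
  at once, without charts or continuation arguments.\<close>

section \<open>Change of variables over an arbitrary finite index type\<close>

text \<open>The change of variables theorems of the library require the index type to be a well-order;
  every finite type has a copy with this property.\<close>

typedef 'a ordered_copy = "UNIV :: 'a set" by auto

instance ordered_copy :: (finite) finite
proof
  have "inj (Rep_ordered_copy :: 'a ordered_copy \<Rightarrow> 'a)"
    by (meson Rep_ordered_copy_inject injI)
  then show "finite (UNIV :: 'a ordered_copy set)"
    by (rule finite_imageD[rotated]) simp
qed

instantiation ordered_copy :: (finite) wellorder
begin

text \<open>Any injection into the naturals will do: the order only has to be a well-order, and
  integrals and determinants do not see it.\<close>

definition rank_ordered_copy :: "'a ordered_copy \<Rightarrow> nat" where
  "rank_ordered_copy = (SOME f. inj f)"

definition less_eq_ordered_copy :: "'a ordered_copy \<Rightarrow> 'a ordered_copy \<Rightarrow> bool" where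
  "less_eq_ordered_copy x y \<longleftrightarrow> rank_ordered_copy x \<le> rank_ordered_copy y"

definition less_ordered_copy :: "'a ordered_copy \<Rightarrow> 'a ordered_copy \<Rightarrow> bool" where
  "less_ordered_copy x y \<longleftrightarrow> rank_ordered_copy x < rank_ordered_copy y"

lemma inj_rank_ordered_copy: "inj (rank_ordered_copy :: 'a ordered_copy \<Rightarrow> nat)"
  unfolding rank_ordered_copy_def
  using finite_imp_inj_to_nat_seg[OF finite_class.finite_UNIV] by (metis someI_ex)

instance
proof
  fix x y :: "'a ordered_copy"
  assume "x \<le> y" "y \<le> x"
  then show "x = y"
    using inj_rank_ordered_copy by (auto simp: less_eq_ordered_copy_def dest: injD)
next
  fix P :: "'a ordered_copy \<Rightarrow> bool" and a
  assume *: "\<And>x. (\<And>y. y < x \<Longrightarrow> P y) \<Longrightarrow> P x"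
  show "P a"
    by (induction a rule: measure_induct_rule[of rank_ordered_copy]) (auto intro: * simp: less_ordered_copy_def)
qed (auto simp: less_eq_ordered_copy_def less_ordered_copy_def)

end

section \<open>Renaming of coordinates: boxes, integrals and determinants\<close>

definition reindex :: "('a \<Rightarrow> 'b) \<Rightarrow> real ^ 'b \<Rightarrow> real ^ 'a::finite" where
  "reindex \<sigma> x = (\<chi> i. x $ \<sigma> i)"

lemma reindex_inverse:
  assumes "bij (\<sigma> :: 'a::finite \<Rightarrow> 'b::finite)"
  shows "reindex (inv \<sigma>) (reindex \<sigma> x) = x" "reindex \<sigma> (reindex (inv \<sigma>) y) = y"
  using assms by (auto simp: reindex_def vec_eq_iff bij_is_inj bij_is_surj surj_f_inv_f)

lemma linear_reindex: "linear (reindex \<sigma> :: real ^ 'b::finite \<Rightarrow> real ^ 'a::finite)"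
  by (rule linearI) (auto simp: reindex_def vec_eq_iff)

lemma reindex_cbox:
  assumes "bij (\<sigma> :: 'a::finite \<Rightarrow> 'b::finite)"
  shows "reindex \<sigma> ` cbox u v = cbox (reindex \<sigma> u) (reindex \<sigma> v)"
proof
  show "reindex \<sigma> ` cbox u v \<subseteq> cbox (reindex \<sigma> u) (reindex \<sigma> v)"
    by (auto simp: mem_box_cart reindex_def)
  show "cbox (reindex \<sigma> u) (reindex \<sigma> v) \<subseteq> reindex \<sigma> ` cbox u v"
  proof
    fix x assume x: "x \<in> cbox (reindex \<sigma> u) (reindex \<sigma> v)"
    then have "reindex (inv \<sigma>) x \<in> cbox u v"
      using assms unfolding mem_box_cart reindex_def
      by simp (metis bij_inv_eq_iff)
    then show "x \<in> reindex \<sigma> ` cbox u v"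
      using reindex_inverse(2)[OF assms, of x] by (metis image_eqI)
  qed
qed

lemma content_reindex_cbox:
  assumes "bij (\<sigma> :: 'a::finite \<Rightarrow> 'b::finite)"
  shows "measure lborel (reindex \<sigma> ` cbox u v) = measure lborel (cbox u v)"
proof (cases "cbox u v = {}")
  case False
  then have "cbox (reindex \<sigma> u) (reindex \<sigma> v) \<noteq> {}"
    using reindex_cbox[OF assms, of u v] by auto
  then show ?thesis
    unfolding reindex_cbox[OF assms] using False
    by (simp add: content_cbox_cart reindex_def prod.reindex_bij_betw[OF assms, where g="\<lambda>i. v $ i - u $ i"])
qed auto

text \<open>Renaming the coordinates is a homeomorphism that sends boxes to boxes of the same
  content, so gauge integrals are transported with the factor 1.\<close>

lemma has_integral_reindex_cbox:
  fixes f :: "real ^ 'a::finite \<Rightarrow> real"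
  assumes \<sigma>: "bij (\<sigma> :: 'a::finite \<Rightarrow> 'b::finite)" and "(f has_integral i) (cbox a b)"
  shows "((\<lambda>x. f (reindex \<sigma> x)) has_integral i) (reindex (inv \<sigma>) ` cbox a b)"
proof -
  have "((\<lambda>x. f (reindex \<sigma> x)) has_integral (1 / 1) *\<^sub>R i) (reindex (inv \<sigma>) ` cbox a b)"
    using assms(2)
  proof (rule has_integral_twiddle[rotated -1])
    show "\<exists>w z. reindex \<sigma> ` cbox u v = cbox w z" for u v
      using reindex_cbox[OF \<sigma>] by blast
    show "\<exists>w z. reindex (inv \<sigma>) ` cbox u v = cbox w z" for u v
      using reindex_cbox[OF bij_imp_bij_inv[OF \<sigma>]] by blast
    show "continuous (at x) (reindex \<sigma>)" for x :: "real ^ 'b"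
      using linear_reindex[of \<sigma>] by (simp add: linear_continuous_at linear_conv_bounded_linear)
  qed (use reindex_inverse[OF \<sigma>] content_reindex_cbox[OF \<sigma>] in auto)
  then show ?thesis by simp
qed

text \<open>Boundedness puts K into a box, where extension by zero reduces the claim to
  boxes.\<close>

lemma has_integral_reindex:
  fixes f :: "real ^ 'a::finite \<Rightarrow> real"
  assumes \<sigma>: "bij (\<sigma> :: 'a::finite \<Rightarrow> 'b::finite)" and "bounded K" and i: "(f has_integral i) K"
  shows "((\<lambda>x. f (reindex \<sigma> x)) has_integral i) (reindex (inv \<sigma>) ` K)"
proof -
  obtain a b where ab: "K \<subseteq> cbox a b"
    using \<open>bounded K\<close> bounded_subset_cbox_symmetric by blast
  then have "((\<lambda>x. if x \<in> K then f x else 0) has_integral i) (cbox a b)"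
    using i has_integral_restrict[OF ab, of f i] by blast
  from has_integral_reindex_cbox[OF \<sigma> this]
  have "((\<lambda>x. if reindex \<sigma> x \<in> K then f (reindex \<sigma> x) else 0) has_integral i)
           (reindex (inv \<sigma>) ` cbox a b)" .
  moreover have "reindex \<sigma> x \<in> K \<longleftrightarrow> x \<in> reindex (inv \<sigma>) ` K" for x :: "real ^ 'b"
  proof
    assume "reindex \<sigma> x \<in> K"
    then have "reindex (inv \<sigma>) (reindex \<sigma> x) \<in> reindex (inv \<sigma>) ` K" by blast
    then show "x \<in> reindex (inv \<sigma>) ` K" by (simp add: reindex_inverse[OF \<sigma>])
  qed (auto simp: reindex_inverse[OF \<sigma>])
  ultimately show ?thesis
    using has_integral_restrict[of "reindex (inv \<sigma>) ` K" "reindex (inv \<sigma>) ` cbox a b" "\<lambda>x. f (reindex \<sigma> x)" i] ab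
    by (simp add: image_mono)
qed

text \<open>Conjugation by \<sigma> permutes the terms of the Leibniz formula: it is a bijection
  between the permutations of the two index types and preserves the sign.\<close>

lemma det_reindex:
  fixes A :: "real ^ 'a::finite ^ 'a"
  assumes \<sigma>: "bij (\<sigma> :: 'b::finite \<Rightarrow> 'a)"
  shows "det (\<chi> i j. A $ \<sigma> i $ \<sigma> j) = det A"
proof -
  let ?m = "map_permutation UNIV \<sigma>"
  have inj: "inj \<sigma>" using \<sigma> by (rule bij_is_inj)
  have m: "?m p (\<sigma> i) = \<sigma> (p i)" for p i
    by (simp add: map_permutation_apply inj)
  have prod: "(\<Prod>i\<in>UNIV. A $ i $ ?m p i) = (\<Prod>i\<in>UNIV. A $ \<sigma> i $ \<sigma> (p i))" for p
    using prod.reindex_bij_betw[OF \<sigma>, of "\<lambda>i. A $ i $ ?m p i"] by (simp add: m)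
  have "?m = (\<lambda>p x. if x \<in> UNIV then \<sigma> (p (inv_into UNIV \<sigma> x)) else x)"
    using \<sigma> by (auto simp: map_permutation_def restrict_id_def bij_is_surj fun_eq_iff)
  then have bij: "bij_betw ?m {p. p permutes UNIV} {p. p permutes UNIV}"
    using bij_betw_permutations[OF \<sigma>] by simp
  have "det A = (\<Sum>p | p permutes UNIV. of_int (sign (?m p)) * (\<Prod>i\<in>UNIV. A $ i $ ?m p i))"
    unfolding det_def by (rule sum.reindex_bij_betw[OF bij, symmetric])
  also have "\<dots> = (\<Sum>p | p permutes UNIV. of_int (sign p) * (\<Prod>i\<in>UNIV. A $ \<sigma> i $ \<sigma> (p i)))"
    by (rule sum.cong) (auto simp: prod sign_map_permutation inj)
  also have "\<dots> = det (\<chi> i j. A $ \<sigma> i $ \<sigma> j)"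
    by (simp add: det_def)
  finally show ?thesis by simp
qed

lemma matrix_reindex_conjugate:
  fixes D :: "real ^ 'a::finite \<Rightarrow> real ^ 'a"
  assumes \<sigma>: "bij (\<sigma> :: 'b::finite \<Rightarrow> 'a)"
  shows "matrix (\<lambda>x. reindex \<sigma> (D (reindex (inv \<sigma>) x))) = (\<chi> i j. matrix D $ \<sigma> i $ \<sigma> j)"
proof -
  have "reindex (inv \<sigma>) (axis j 1) = (axis (\<sigma> j) 1 :: real ^ 'a)" for j
    using \<sigma> by (auto simp: reindex_def axis_def vec_eq_iff bij_inv_eq_iff bij_is_inj inv_f_f)
  then show ?thesis
    by (simp add: matrix_def reindex_def vec_eq_iff)
qed

lemma absolutely_integrable_continuous_compact:
  fixes f :: "'a::euclidean_space \<Rightarrow> 'b::euclidean_space"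
  assumes "compact S" "continuous_on S f"
  shows "f absolutely_integrable_on S"
  using borel_integrable_compact[OF assms] integrable_completion borel_measurable_integrable
  unfolding set_integrable_def by blast

text \<open>The library theorem is applied to the conjugate of g by the renaming of coordinates,
  whose Jacobian matrix is that of g with rows and columns renamed and so has the same determinant.
  A continuous function on the compact image is absolutely integrable, which turns the equivalence
  of that theorem into an equation.\<close>

theorem change_of_variables_compact:
  fixes g :: "real ^ 'n::finite \<Rightarrow> real ^ 'n" and f :: "real ^ 'n \<Rightarrow> real"
  assumes K: "compact K"
    and der: "\<And>x. x \<in> K \<Longrightarrow> (g has_derivative g' x) (at x within K)"
    and inj: "inj_on g K" and cont: "continuous_on (g ` K) f"
  shows "integral K (\<lambda>x. \<bar>det (matrix (g' x))\<bar> * f (g x)) = integral (g ` K) f"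
proof -
  let ?\<sigma> = "Rep_ordered_copy :: 'n ordered_copy \<Rightarrow> 'n"
  let ?R = "reindex ?\<sigma>" and ?L = "reindex (inv ?\<sigma>)"
  have \<sigma>: "bij ?\<sigma>"
    by (metis Abs_ordered_copy_inverse Rep_ordered_copy_inverse UNIV_I bijI')
  note \<sigma>' = bij_imp_bij_inv[OF \<sigma>]
  have RL[simp]: "?R (?L y) = y" "?L (?R x) = x" for x y
    using reindex_inverse[OF \<sigma>] by auto
  have blR: "bounded_linear ?R" and blL: "bounded_linear ?L"
    using linear_reindex by (auto simp: linear_conv_bounded_linear)
  define K' where "K' = ?R ` K"
  define G where "G = (\<lambda>x. ?R (g (?L x)))"
  define G' where "G' = (\<lambda>x v. ?R (g' (?L x) (?L v)))"
  have LK: "?L ` K' = K" by (simp add: K'_def image_image)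
  have "compact K'"
    unfolding K'_def by (intro compact_continuous_image K linear_continuous_on blR)
  have "(G has_derivative G' x) (at x within K')" if "x \<in> K'" for x
  proof -
    have "(g has_derivative g' (?L x)) (at (?L x) within ?L ` K')"
      using that LK by (metis der imageI)
    from diff_chain_within[OF bounded_linear.has_derivative[OF blL has_derivative_ident] this]
    have "((\<lambda>x. g (?L x)) has_derivative (\<lambda>v. g' (?L x) (?L v))) (at x within K')"
      by (simp add: o_def)
    from bounded_linear.has_derivative[OF blR this] show ?thesis
      by (simp add: G_def G'_def)
  qed
  moreover have "inj_on G K'"
    unfolding G_def K'_def using inj
    by (auto simp: inj_on_def) (metis RL(2))
  ultimately have cov: "(\<lambda>x. \<bar>det (matrix (G' x))\<bar> *\<^sub>R F (G x)) absolutely_integrable_on K' \<and>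
      integral K' (\<lambda>x. \<bar>det (matrix (G' x))\<bar> *\<^sub>R F (G x)) = b \<longleftrightarrow>
      F absolutely_integrable_on (G ` K') \<and> integral (G ` K') F = b"
    for F :: "real ^ 'n ordered_copy \<Rightarrow> real ^ 1" and b
    using has_absolute_integral_change_of_variables_compact[OF \<open>compact K'\<close>] by blast
  \<comment> \<open>Scalars are wrapped as vectors of length one because \<open>cov\<close> speaks
    of vector-valued integrands; taking the component 1 unwraps them.\<close>
  let ?F = "\<lambda>x. vec (f (?L x)) :: real ^ 1"
  have GK: "G ` K' = ?R ` g ` K"
    by (simp add: G_def K'_def image_image)
  have contg: "continuous_on K g"
    using der by (rule has_derivative_continuous_on)
  have cgK: "compact (g ` K)" using contg K compact_continuous_image by blast
  have cGK: "compact (G ` K')"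
    unfolding GK by (intro compact_continuous_image cgK linear_continuous_on blR)
  have cF: "continuous_on (G ` K') (\<lambda>x. f (?L x))"
    by (rule continuous_on_compose2[OF cont linear_continuous_on[OF blL]]) (auto simp: GK)
  then have cF': "continuous_on (G ` K') ?F"
    by (simp add: vec_def continuous_on_vec_lambda)
  have "?F absolutely_integrable_on (G ` K')"
    using cGK cF' by (rule absolutely_integrable_continuous_compact)
  then have A: "(\<lambda>x. \<bar>det (matrix (G' x))\<bar> *\<^sub>R ?F (G x)) absolutely_integrable_on K'"
      "integral K' (\<lambda>x. \<bar>det (matrix (G' x))\<bar> *\<^sub>R ?F (G x)) = integral (G ` K') ?F"
    using cov[of ?F "integral (G ` K') ?F"] by auto
  have i1: "(?F has_integral integral (G ` K') ?F) (G ` K')"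
    by (intro integrable_integral set_lebesgue_integral_eq_integral(1)) fact
  have i2: "((\<lambda>x. \<bar>det (matrix (G' x))\<bar> *\<^sub>R ?F (G x)) has_integral integral (G ` K') ?F) K'"
    using integrable_integral[OF set_lebesgue_integral_eq_integral(1)[OF A(1)]] unfolding A(2) .
  let ?I = "integral (G ` K') ?F $ 1"
  have j1: "((\<lambda>x. f (?L x)) has_integral ?I) (G ` K')"
    using has_integral_linear[OF i1 bounded_linear_vec_nth[of 1]] by (simp add: o_def)
  have j2: "((\<lambda>x. \<bar>det (matrix (G' x))\<bar> * f (?L (G x))) has_integral ?I) K'"
    using has_integral_linear[OF i2 bounded_linear_vec_nth[of 1]] by (simp add: o_def)
  have "((\<lambda>x. f (?L (?R x))) has_integral ?I) (?L ` G ` K')"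
    by (rule has_integral_reindex[OF \<sigma> _ j1, unfolded]) (simp add: cGK compact_imp_bounded)
  then have k1: "(f has_integral ?I) (g ` K)"
    by (simp add: GK image_image)
  have "((\<lambda>x. \<bar>det (matrix (G' (?R x)))\<bar> * f (?L (G (?R x)))) has_integral ?I) (?L ` K')"
    by (rule has_integral_reindex[OF \<sigma> _ j2, unfolded]) (simp add: \<open>compact K'\<close> compact_imp_bounded)
  moreover have "det (matrix (G' (?R x))) = det (matrix (g' x))" for x
    unfolding G'_def RL matrix_reindex_conjugate[OF \<sigma>] by (rule det_reindex[OF \<sigma>])
  ultimately have "((\<lambda>x. \<bar>det (matrix (g' x))\<bar> * f (g x)) has_integral ?I) K"
    by (simp add: LK G_def)
  then show ?thesis
    using k1 by (simp add: integral_unique)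
qed

section \<open>Ordinary differential equations\<close>

subsection \<open>Differential inequalities\<close>

text \<open>For every slack \<epsilon> the function m stays below the supersolution y whose initial
  value and source are both enlarged by \<epsilon>. Otherwise let q be the infimum of the times with
  m > y: at q continuity gives m \<le> y, and the forward bound with the same \<epsilon> keeps m
  \<le> y for a while after q. Forward increments are bounded instead of derivatives because the
  lemma is applied to norms and to the distance from a set, which need not be
  differentiable.\<close>

lemma dini_gronwall:
  fixes m :: "real \<Rightarrow> real"
  assumes cont: "continuous_on {0..T} m" and "L \<ge> 0" "b \<ge> 0" "m 0 \<ge> 0"
    and dini: "\<And>t \<epsilon>. 0 \<le> t \<Longrightarrow> t < T \<Longrightarrow> \<epsilon> > 0 \<Longrightarrow>
      \<exists>\<delta>>0. \<forall>s. 0 < s \<and> s < \<delta> \<longrightarrow> m (t + s) \<le> m t + s * (L * m t + b + \<epsilon>)"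
    and t: "t \<in> {0..T}"
  shows "m t \<le> (m 0 + b * t) * exp (L * t)"
proof -
  have strict: "m t \<le> (m 0 + \<epsilon> + (b + \<epsilon>) * t) * exp (L * t)" if "\<epsilon> > 0" for \<epsilon>
  proof (rule ccontr)
    assume contra: "\<not> ?thesis"
    define y where "y t = (m 0 + \<epsilon> + (b + \<epsilon>) * t) * exp (L * t)" for t
    have cy: "continuous_on UNIV y"
      unfolding y_def by (intro continuous_intros)
    \<comment> \<open>Euler steps of the comparison equation stay below y, by the convexity estimate
      exp (L * s) \<ge> 1 + L * s.\<close>
    have y_step: "y t + s * (L * y t + b + \<epsilon>) \<le> y (t + s)" if "t \<ge> 0" "s > 0" for t s
    proof -
      let ?c = "m 0 + \<epsilon> + (b + \<epsilon>) * t" and ?d = "b + \<epsilon>"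
      have c: "?c \<ge> 0" and d: "?d \<ge> 0" using assms that \<open>\<epsilon> > 0\<close> by auto
      have Et: "exp (L * t) \<ge> 1" and Es: "exp (L * s) \<ge> 1 + L * s" and Ls: "L * s \<ge> 0"
        using \<open>L \<ge> 0\<close> that by auto
      have "y t + s * (L * y t + ?d) \<le> (?c * exp (L * t)) * (1 + L * s) + ?d * s * exp (L * t)"
        using mult_left_mono[OF Et mult_nonneg_nonneg[OF d], of s] that by (simp add: y_def algebra_simps)
      also have "\<dots> \<le> (?c * exp (L * t)) * exp (L * s) + ?d * s * exp (L * t) * exp (L * s)"
      proof (rule add_mono)
        show "(?c * exp (L * t)) * (1 + L * s) \<le> (?c * exp (L * t)) * exp (L * s)"
          using c Es by (intro mult_left_mono) auto
        have "?d * s * exp (L * t) * 1 \<le> ?d * s * exp (L * t) * exp (L * s)"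
          using d Es Ls that by (intro mult_left_mono) auto
        then show "?d * s * exp (L * t) \<le> ?d * s * exp (L * t) * exp (L * s)" by simp
      qed
      also have "\<dots> = y (t + s)"
        by (simp add: y_def exp_add algebra_simps)
      finally show ?thesis by (simp add: add.assoc)
    qed
    define B where "B = {r \<in> {0..T}. m r > y r}"
    have "t \<in> B" using contra t by (auto simp: B_def y_def not_le)
    then have "B \<noteq> {}" by blast
    have bdd: "bdd_below B" by (auto simp: B_def bdd_below_def)
    define q where "q = Inf B"
    have q_le: "q \<le> r" if "r \<in> B" for r
      unfolding q_def using bdd that by (rule cInf_lower[rotated])
    have q0: "0 \<le> q" unfolding q_def using \<open>B \<noteq> {}\<close> by (rule cInf_greatest) (auto simp: B_def)
    have qT: "q \<le> T" using \<open>B \<noteq> {}\<close> q_le by (force simp: B_def)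
    have mq: "m q \<le> y q"
    proof (cases "q = 0")
      case True then show ?thesis using that by (simp add: y_def)
    next
      case False
      then have "q > 0" using q0 by simp
      have "((\<lambda>r. m r) \<longlongrightarrow> m q) (at q within {0..T})"
        using cont q0 qT by (auto simp: continuous_on_def)
      then have l1: "(m \<longlongrightarrow> m q) (at q within {0..<q})"
        by (rule tendsto_within_subset) (use qT in auto)
      have l2: "(y \<longlongrightarrow> y q) (at q within {0..<q})"
        using cy by (metis UNIV_I continuous_on_def tendsto_within_subset subset_UNIV)
      have "m r \<le> y r" if "r \<in> {0..<q}" for r
        using q_le[of r] that qT by (force simp: B_def)
      then have "eventually (\<lambda>r. m r \<le> y r) (at q within {0..<q})"
        by (simp add: eventually_at_filter)
      moreover have "at q within {0..<q} \<noteq> bot"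
        using \<open>q > 0\<close> by (simp add: trivial_limit_within islimpt_greaterThanLessThan2
            islimpt_subset[of q "{0<..<q}"] subset_eq)
      ultimately show ?thesis
        using tendsto_le[OF _ l2 l1] by blast
    qed
    have "q < T"
    proof (rule ccontr)
      assume "\<not> q < T"
      then have "q = T" using qT by simp
      obtain r where "r \<in> B" using \<open>B \<noteq> {}\<close> by blast
      then have "r = q" using q_le[of r] \<open>q = T\<close> by (auto simp: B_def)
      then show False using \<open>r \<in> B\<close> mq by (simp add: B_def)
    qed
    from dini[OF q0 this \<open>\<epsilon> > 0\<close>] obtain \<delta> where "\<delta> > 0"
      and \<delta>: "\<And>s. 0 < s \<Longrightarrow> s < \<delta> \<Longrightarrow> m (q + s) \<le> m q + s * (L * m q + b + \<epsilon>)" by blast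
    have "q + \<delta> \<le> r" if r: "r \<in> B" for r
    proof (rule ccontr)
      assume "\<not> q + \<delta> \<le> r"
      moreover have "r \<noteq> q" using r mq by (auto simp: B_def)
      ultimately have s: "0 < r - q" "r - q < \<delta>" using q_le[OF r] by auto
      have "m r \<le> m q + (r - q) * (L * m q + b + \<epsilon>)" using \<delta>[OF s] by simp
      also have "\<dots> \<le> y q + (r - q) * (L * y q + b + \<epsilon>)"
        using mq s \<open>L \<ge> 0\<close> by (intro add_mono mult_left_mono) auto
      also have "\<dots> \<le> y r" using y_step[OF q0 s(1)] by simp
      finally show False using r by (simp add: B_def)
    qed
    then have "q + \<delta> \<le> q" unfolding q_def using \<open>B \<noteq> {}\<close> by (intro cInf_greatest)
    then show False using \<open>\<delta> > 0\<close> by simp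
  qed
  show ?thesis
  proof (rule field_le_epsilon)
    fix e :: real assume "e > 0"
    \<comment> \<open>A slack d raises the bound at time t by d * (1 + t) * exp (L * t), which is
      thus exactly e.\<close>
    define d where "d = e / ((1 + t) * exp (L * t))"
    have "t \<ge> 0" using t by simp
    then have d: "d > 0" "d * ((1 + t) * exp (L * t)) = e"
      using \<open>e > 0\<close> by (auto simp: d_def)
    then show "m t \<le> (m 0 + b * t) * exp (L * t) + e"
      using strict[of d] by (simp add: algebra_simps)
  qed
qed

lemma norm_le_tangent_step:
  fixes e :: "real \<Rightarrow> 'a::real_normed_vector"
  assumes "(e has_vector_derivative e') (at t)" "\<epsilon> > 0"
  shows "\<exists>\<delta>>0. \<forall>s. 0 < s \<and> s < \<delta> \<longrightarrow> norm (e (t + s) - e t - s *\<^sub>R e') \<le> \<epsilon> * s"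
proof -
  obtain \<delta> where "\<delta> > 0" and \<delta>: "\<And>y. norm (y - t) < \<delta> \<Longrightarrow>
      norm (e y - e t - (y - t) *\<^sub>R e') \<le> \<epsilon> * norm (y - t)"
    using assms unfolding has_vector_derivative_def has_derivative_at_alt by blast
  have "norm (e (t + s) - e t - s *\<^sub>R e') \<le> \<epsilon> * s" if "0 < s" "s < \<delta>" for s
    using \<delta>[of "t + s"] that by simp
  then show ?thesis using \<open>\<delta> > 0\<close> by blast
qed

text \<open>The triangle inequality turns the derivative of e into a forward bound for its norm; the
  norm itself may fail to be differentiable at zeros of e.\<close>

lemma gronwall_forward:
  fixes e :: "real \<Rightarrow> 'a::real_normed_vector"
  assumes der: "\<And>s. (e has_vector_derivative e' s) (at s)"
    and bound: "\<And>s. 0 \<le> s \<Longrightarrow> s \<le> t \<Longrightarrow> norm (e' s) \<le> L * norm (e s) + b"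
    and "L \<ge> 0" "b \<ge> 0" "t \<ge> 0"
  shows "norm (e t) \<le> (norm (e 0) + b * t) * exp (L * t)"
proof (rule dini_gronwall)
  show "continuous_on {0..t} (\<lambda>s. norm (e s))"
    using der by (intro continuous_on_norm continuous_at_imp_continuous_on ballI)
      (meson has_vector_derivative_continuous)
next
  fix s \<epsilon> :: real assume s: "0 \<le> s" "s < t" and "\<epsilon> > 0"
  obtain \<delta> where "\<delta> > 0" and \<delta>: "\<And>r. 0 < r \<Longrightarrow> r < \<delta> \<Longrightarrow> norm (e (s + r) - e s - r *\<^sub>R e' s) \<le> \<epsilon> * r"
    using norm_le_tangent_step[OF der \<open>\<epsilon> > 0\<close>, of s] by blast
  have "norm (e (s + r)) \<le> norm (e s) + r * (L * norm (e s) + b + \<epsilon>)" if r: "0 < r" "r < \<delta>" for r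
  proof -
    have "e (s + r) = e s + r *\<^sub>R e' s + (e (s + r) - e s - r *\<^sub>R e' s)" by simp
    then have "norm (e (s + r)) \<le> norm (e s) + norm (r *\<^sub>R e' s) + norm (e (s + r) - e s - r *\<^sub>R e' s)"
      by (metis norm_triangle_ineq norm_triangle_le add_mono order_refl)
    also have "norm (r *\<^sub>R e' s) \<le> r * (L * norm (e s) + b)"
      using bound[of s] s r by simp
    finally show ?thesis using \<delta>[OF r] by (simp add: algebra_simps)
  qed
  then show "\<exists>\<delta>>0. \<forall>r. 0 < r \<and> r < \<delta> \<longrightarrow> norm (e (s + r)) \<le> norm (e s) + r * (L * norm (e s) + b + \<epsilon>)"
    using \<open>\<delta> > 0\<close> by blast
qed (use assms in auto)

lemma has_vector_derivative_reflect:
  assumes "(e has_vector_derivative e') (at (- s))"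
  shows "((\<lambda>s. e (- s)) has_vector_derivative - e') (at s)"
proof -
  have "((\<lambda>s::real. - s) has_vector_derivative - 1) (at s)"
    by (auto intro!: derivative_eq_intros)
  from vector_diff_chain_at[OF this assms] show ?thesis by (simp add: o_def)
qed

lemma gronwall:
  fixes e :: "real \<Rightarrow> 'a::real_normed_vector"
  assumes der: "\<And>s. (e has_vector_derivative e' s) (at s)"
    and bound: "\<And>s. \<bar>s\<bar> \<le> \<bar>t\<bar> \<Longrightarrow> norm (e' s) \<le> L * norm (e s) + b"
    and "L \<ge> 0" "b \<ge> 0"
  shows "norm (e t) \<le> (norm (e 0) + b * \<bar>t\<bar>) * exp (L * \<bar>t\<bar>)"
proof (cases "t \<ge> 0")
  case True
  then show ?thesis using gronwall_forward[OF der, of t L b] assms by simp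
next
  case False
  have "norm (e (- (- t))) \<le> (norm (e (- 0)) + b * - t) * exp (L * - t)"
    by (rule gronwall_forward[OF has_vector_derivative_reflect[OF der]]) (use False assms in auto)
  then show ?thesis using False by simp
qed

subsection \<open>Existence of solutions\<close>

lemma antiderivative_on_reals:
  fixes g :: "real \<Rightarrow> 'a::banach"
  assumes g: "continuous_on UNIV g"
  shows "\<exists>G. G 0 = 0 \<and> (\<forall>t. (G has_vector_derivative g t) (at t))"
proof -
  have int: "g integrable_on {a..b}" for a b
    using g continuous_on_subset integrable_continuous_real by blast
  define G where "G t = (if t \<ge> 0 then integral {0..t} g else - integral {t..0} g)" for t
  have "(G has_vector_derivative g t) (at t)" for t
  proof -
    \<comment> \<open>Both 0 and t are interior points of {- N..N}; there G differs by a constant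
      from an integral with fixed lower end, and a derivative within the interval is a full
      one.\<close>
    define N where "N = \<bar>t\<bar> + 1"
    have G: "G s = integral {- N..s} g - integral {- N..0} g" if "s \<in> {- N..N}" for s
      using Henstock_Kurzweil_Integration.integral_combine[where a = "- N" and c = 0 and b = s and f = g]
        Henstock_Kurzweil_Integration.integral_combine[where a = "- N" and c = s and b = 0 and f = g] that int
      by (auto simp: G_def N_def algebra_simps)
    have "((\<lambda>s. integral {- N..s} g) has_vector_derivative g t) (at t within {- N..N})"
      by (rule integral_has_vector_derivative) (use g continuous_on_subset in \<open>auto simp: N_def\<close>)
    then have "((\<lambda>s. integral {- N..s} g - integral {- N..0} g) has_vector_derivative g t) (at t within {- N..N})"
      by (auto intro!: derivative_eq_intros)
    then have "(G has_vector_derivative g t) (at t within {- N..N})"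
    proof (rule has_vector_derivative_transform[rotated 2])
      show "t \<in> {- N..N}" by (auto simp: N_def)
    qed (rule G)
    moreover have "at t within {- N..N} = at t"
      by (rule at_within_interior) (auto simp: N_def)
    ultimately show ?thesis by (simp only:)
  qed
  then show ?thesis by (intro exI[of _ G]) (simp add: G_def)
qed

text \<open>Integrating C * exp (k * s) gains the factor 1 / k. This gain makes the integral
  operator below a contraction in the exponentially weighted norm.\<close>

lemma norm_antiderivative_le_exp:
  fixes G :: "real \<Rightarrow> 'a::banach"
  assumes der: "\<And>t. (G has_vector_derivative g t) (at t)" and "G 0 = 0"
    and bound: "\<And>t. norm (g t) \<le> C * exp (k * \<bar>t\<bar>)" and "k > 0" "C \<ge> 0"
  shows "norm (G t) \<le> C / k * exp (k * \<bar>t\<bar>)"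
proof -
  have forward: "norm (H t) \<le> C / k * exp (k * t)"
    if H: "\<And>t. (H has_vector_derivative h t) (at t)" "H 0 = 0"
      "\<And>t. norm (h t) \<le> C * exp (k * \<bar>t\<bar>)" "t > 0" for H :: "real \<Rightarrow> 'a" and h t
  proof -
    have "norm (H t - H 0) \<le> C / k * exp (k * t) - C / k * exp (k * 0)"
    proof (rule differentiable_bound_general[OF \<open>t > 0\<close>])
      show "continuous_on {0..t} H"
        using H(1) by (meson continuous_at_imp_continuous_on has_vector_derivative_continuous)
      show "((\<lambda>t. C / k * exp (k * t)) has_vector_derivative C * exp (k * x)) (at x)" for x
        using \<open>k > 0\<close> by (auto intro!: derivative_eq_intros simp: has_real_derivative_iff_has_vector_derivative[symmetric])
      show "norm (h x) \<le> C * exp (k * x)" if "0 < x" for x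
        using H(3)[of x] that by simp
    qed (use H(1) \<open>k > 0\<close> in \<open>auto intro!: continuous_intros\<close>)
    then show ?thesis using H(2) \<open>k > 0\<close> \<open>C \<ge> 0\<close>
      by simp (smt (verit) divide_nonneg_pos)
  qed
  consider "t > 0" | "t = 0" | "t < 0" by linarith
  then show ?thesis
  proof cases
    case 1 then show ?thesis using forward[OF der \<open>G 0 = 0\<close> bound] by simp
  next
    case 2 then show ?thesis using assms by simp
  next
    case 3
    then show ?thesis
      using forward[OF has_vector_derivative_reflect[OF der], of "- t"] bound \<open>G 0 = 0\<close>
      by (simp add: norm_minus_cancel)
        (metis abs_minus_cancel)
  qed
qed

text \<open>Picard's fixed point argument. The unknown \<open>x\<close> is written as \<open>exp (k * \<bar>t\<bar>) *\<^sub>R y t\<close> with \<open>y\<close>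
  bounded; for \<open>k = 2 * L\<close> the integral operator halves distances.\<close>

theorem picard_lindelof_global:
  fixes f :: "real \<Rightarrow> 'b::banach \<Rightarrow> 'b"
  assumes cont: "\<And>x. continuous_on UNIV x \<Longrightarrow> continuous_on UNIV (\<lambda>t. f t (x t))"
    and lip: "\<And>t x y. norm (f t x - f t y) \<le> L * norm (x - y)" and "L > 0"
    and bound: "\<And>t. norm (f t 0) \<le> B"
  shows "\<exists>x. x 0 = x0 \<and> (\<forall>t. (x has_vector_derivative f t (x t)) (at t))"
proof -
  define k where "k = 2 * L"
  have k: "k > 0" using \<open>L > 0\<close> by (simp add: k_def)
  define E where "E t = exp (k * \<bar>t\<bar>)" for t :: real
  have E: "E t \<ge> 1" "E t > 0" "E t \<noteq> 0" for t using k by (auto simp: E_def)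
  have contE: "continuous_on UNIV E" unfolding E_def by (intro continuous_intros)
  have B: "B \<ge> 0" using bound[of 0] norm_ge_zero order_trans by blast
  define X where "X y t = E t *\<^sub>R apply_bcontfun y t" for y :: "real \<Rightarrow>\<^sub>C 'b" and t
  have contX: "continuous_on UNIV (X y)" for y
    unfolding X_def by (intro continuous_intros contE continuous_on_apply_bcontfun)
  obtain G where G0: "\<And>y. G y 0 = 0"
    and G: "\<And>y t. (G y has_vector_derivative f t (X y t)) (at t)"
    using antiderivative_on_reals[OF cont[OF contX]] by metis
  have contG: "continuous_on UNIV (G y)" for y
    using G by (meson continuous_at_imp_continuous_on has_vector_derivative_continuous)
  \<comment> \<open>The integral operator of the initial value problem, conjugated by the weight E;
    the weight allows a contraction on the whole real line instead of short intervals.\<close>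
  define S where "S y t = (1 / E t) *\<^sub>R (x0 + G y t)" for y and t :: real
  have contS: "continuous_on UNIV (S y)" for y
    unfolding S_def using E by (intro continuous_intros contE contG) auto
  \<comment> \<open>The Lipschitz bound and the bound at 0 give linear growth of f, so that E
    dominates and S sends bounded functions to bounded functions.\<close>
  have "norm (G y t) \<le> (B + L * norm y) / k * exp (k * \<bar>t\<bar>)" for y t
  proof (rule norm_antiderivative_le_exp[OF G G0 _ k])
    fix s
    have "norm (f s (X y s)) \<le> norm (f s 0) + norm (f s (X y s) - f s 0)"
      by (metis add.commute diff_add_cancel norm_triangle_ineq)
    also have "\<dots> \<le> B + L * norm (X y s)" using bound lip[of s "X y s" 0] by (simp add: add_mono)
    also have "\<dots> \<le> B * E s + L * (E s * norm y)"
      using E[of s] B \<open>L > 0\<close> norm_bounded[of y s] unfolding X_def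
      by (intro add_mono mult_left_mono) (auto simp: mult_le_cancel_left1 mult_left_mono)
    finally show "norm (f s (X y s)) \<le> (B + L * norm y) * exp (k * \<bar>s\<bar>)"
      by (simp add: E_def algebra_simps)
  qed (use B \<open>L > 0\<close> in auto)
  then have normS: "norm (S y t) \<le> norm x0 + (B + L * norm y) / k" for y t
  proof -
    have "norm (S y t) \<le> (norm x0 + norm (G y t)) / E t"
      using E[of t] norm_triangle_ineq[of x0 "G y t"] by (simp add: S_def divide_right_mono)
    also have "\<dots> \<le> (norm x0 * E t + (B + L * norm y) / k * E t) / E t"
      using E[of t] \<open>norm (G y t) \<le> (B + L * norm y) / k * exp (k * \<bar>t\<bar>)\<close>
      by (intro divide_right_mono add_mono) (auto simp: E_def mult_le_cancel_left1)
    also have "\<dots> = norm x0 + (B + L * norm y) / k"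
      using E(3)[of t] by (simp add: add_divide_distrib)
    finally show ?thesis .
  qed
  define \<S> where "\<S> y = Bcontfun (S y)" for y
  have \<S>: "apply_bcontfun (\<S> y) = S y" for y
    unfolding \<S>_def by (rule Bcontfun_inverse[OF bcontfun_normI[OF contS normS]])
  have "dist (\<S> y) (\<S> z) \<le> 1 / 2 * dist y z" for y z
  proof (rule dist_bound)
    fix t
    have "norm (G y t - G z t) \<le> (L * dist y z) / k * exp (k * \<bar>t\<bar>)"
    proof (rule norm_antiderivative_le_exp[where G = "\<lambda>t. G y t - G z t", OF _ _ _ k])
      show "((\<lambda>t. G y t - G z t) has_vector_derivative f s (X y s) - f s (X z s)) (at s)" for s
        by (intro derivative_intros G)
      fix s
      have "norm (f s (X y s) - f s (X z s)) \<le> L * norm (X y s - X z s)" by (rule lip)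
      also have "X y s - X z s = E s *\<^sub>R (apply_bcontfun y s - apply_bcontfun z s)"
        by (simp add: X_def scaleR_diff_right)
      also have "L * norm \<dots> \<le> L * (E s * dist y z)"
        using E[of s] \<open>L > 0\<close> dist_bounded[of y s z] by (intro mult_left_mono) (auto simp: dist_norm)
      finally show "norm (f s (X y s) - f s (X z s)) \<le> L * dist y z * exp (k * \<bar>s\<bar>)"
        by (simp add: E_def algebra_simps)
    qed (use G0 \<open>L > 0\<close> in auto)
    then have *: "norm (G y t - G z t) \<le> 1 / 2 * dist y z * E t"
      using \<open>L > 0\<close> by (simp add: k_def E_def)
    have "dist (S y t) (S z t) = norm (G y t - G z t) / E t"
      using E[of t] by (simp add: S_def dist_norm scaleR_diff_right[symmetric])
    also have "\<dots> \<le> 1 / 2 * dist y z"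
      using * E(2)[of t] by (simp add: divide_le_eq)
    finally show "dist (apply_bcontfun (\<S> y) t) (apply_bcontfun (\<S> z) t) \<le> 1 / 2 * dist y z"
      unfolding \<S> .
  qed
  then obtain y where y: "\<S> y = y"
    using banach_fix_type[of "1 / 2" \<S>] by auto
  have X: "X y t = x0 + G y t" for t
  proof -
    have "apply_bcontfun y t = S y t" using \<S>[of y] y by simp
    then show ?thesis using E(3)[of t] by (simp add: X_def S_def)
  qed
  have "(X y has_vector_derivative f t (X y t)) (at t)" for t
  proof -
    have "((\<lambda>t. x0 + G y t) has_vector_derivative f t (X y t)) (at t)"
      using G by (auto intro!: derivative_eq_intros)
    moreover have "X y = (\<lambda>t. x0 + G y t)" using X by (rule ext)
    ultimately show ?thesis by metis
  qed
  then show ?thesis using X[of 0] G0 by (intro exI[of _ "X y"]) auto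
qed

subsection \<open>The flow of a vector field and its derivative\<close>

text \<open>An increment splits into one in x, controlled by c t, and one in t with x fixed. The
  flow and its derivative are Lipschitz in the starting point with constants that grow with time,
  hence a function c.\<close>

lemma continuous_on_pair_if_lipschitz:
  fixes f :: "real \<Rightarrow> 'a::metric_space \<Rightarrow> 'b::metric_space"
  assumes lip: "\<And>t x y. dist (f t x) (f t y) \<le> c t * dist x y"
    and c: "continuous_on UNIV c" and cont: "\<And>x. continuous_on UNIV (\<lambda>t. f t x)"
  shows "continuous_on UNIV (\<lambda>(t, x). f t x)"
proof -
  have "((\<lambda>p. f (fst p) (snd p)) \<longlongrightarrow> f (fst p0) (snd p0)) (at p0)" for p0
  proof (rule metric_tendsto_imp_tendsto)
    have fst: "((\<lambda>p. fst p) \<longlongrightarrow> fst p0) (at p0)" and snd: "((\<lambda>p. snd p) \<longlongrightarrow> snd p0) (at p0)"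
      by (auto intro: tendsto_intros)
    have "isCont c (fst p0)" "isCont (\<lambda>t. f t (snd p0)) (fst p0)"
      using c cont by (auto simp: continuous_on_eq_continuous_at)
    then have "((\<lambda>p. c (fst p)) \<longlongrightarrow> c (fst p0)) (at p0)"
      and "((\<lambda>p. f (fst p) (snd p0)) \<longlongrightarrow> f (fst p0) (snd p0)) (at p0)"
      using isCont_tendsto_compose fst by blast+
    then have "((\<lambda>p. c (fst p) * dist (snd p) (snd p0) + dist (f (fst p) (snd p0)) (f (fst p0) (snd p0)))
        \<longlongrightarrow> c (fst p0) * dist (snd p0) (snd p0) + dist (f (fst p0) (snd p0)) (f (fst p0) (snd p0))) (at p0)"
      by (intro tendsto_intros snd) 
    then show "((\<lambda>p. c (fst p) * dist (snd p) (snd p0) + dist (f (fst p) (snd p0)) (f (fst p0) (snd p0)))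
        \<longlongrightarrow> 0) (at p0)" by simp
    have "dist (f (fst p) (snd p)) (f (fst p0) (snd p0)) \<le>
        c (fst p) * dist (snd p) (snd p0) + dist (f (fst p) (snd p0)) (f (fst p0) (snd p0))" for p
      using dist_triangle[of "f (fst p) (snd p)" "f (fst p0) (snd p0)" "f (fst p) (snd p0)"] lip[of "fst p" "snd p" "snd p0"]
      by linarith
    then show "\<forall>\<^sub>F p in at p0. dist (f (fst p) (snd p)) (f (fst p0) (snd p0)) \<le>
      dist (c (fst p) * dist (snd p) (snd p0) + dist (f (fst p) (snd p0)) (f (fst p0) (snd p0))) 0"
      by (intro always_eventually allI) (auto simp: dist_real_def intro: order_trans[OF _ abs_ge_self])
  qed
  then show ?thesis
    by (simp add: continuous_on_def case_prod_beta)
qed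

lemma lipschitz_if_derivative_bounded:
  fixes F :: "'a::real_normed_vector \<Rightarrow> 'b::real_normed_vector" and DF :: "'a \<Rightarrow> 'a \<Rightarrow>\<^sub>L 'b"
  assumes "\<And>x. (F has_derivative DF x) (at x)" "\<And>x. norm (DF x) \<le> L"
  shows "norm (F x - F y) \<le> L * norm (x - y)"
  by (rule differentiable_bound[OF convex_UNIV]) (use assms in \<open>auto simp: norm_blinfun.rep_eq\<close>)

lemma ode_solution_unique:
  fixes x y :: "real \<Rightarrow> 'a::real_normed_vector"
  assumes x: "\<And>t. (x has_vector_derivative F (x t)) (at t)"
    and y: "\<And>t. (y has_vector_derivative F (y t)) (at t)" and "x 0 = y 0"
    and lip: "\<And>x y. norm (F x - F y) \<le> L * norm (x - y)" and "L \<ge> 0"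
  shows "x t = y t"
proof -
  have "norm (x t - y t) \<le> (norm (x 0 - y 0) + 0 * \<bar>t\<bar>) * exp (L * \<bar>t\<bar>)"
    by (rule gronwall[where e = "\<lambda>t. x t - y t" and e' = "\<lambda>t. F (x t) - F (y t)"])
      (use lip \<open>L \<ge> 0\<close> in \<open>auto intro!: derivative_intros x y\<close>)
  then show ?thesis using \<open>x 0 = y 0\<close> by simp
qed

text \<open>Picard iteration gives the trajectories \<phi> and, along each of them, the solution w
  of the linear variational equation. Gronwall is then applied to \<phi> y - \<phi> x, to w x - w y
  and to the remainder \<phi> y - \<phi> x - w x (y - x): the first two are of first order in y - x,
  the last one is of second order, which identifies w as the derivative.\<close>

theorem smooth_flow_exists:
  fixes F :: "'a::banach \<Rightarrow> 'a" and DF :: "'a \<Rightarrow> 'a \<Rightarrow>\<^sub>L 'a"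
  assumes DF: "\<And>x. (F has_derivative DF x) (at x)"
    and L: "\<And>x. norm (DF x) \<le> L" and "L > 0"
    and K: "\<And>x y. norm (DF x - DF y) \<le> K * norm (x - y)"
    and B: "\<And>x. norm (F x) \<le> B"
  obtains \<Phi> :: "real \<Rightarrow> 'a \<Rightarrow> 'a" and W :: "real \<Rightarrow> 'a \<Rightarrow> 'a \<Rightarrow>\<^sub>L 'a"
  where "\<And>x. \<Phi> 0 x = x" "\<And>x. W 0 x = id_blinfun"
    "\<And>t x. ((\<lambda>t. \<Phi> t x) has_vector_derivative F (\<Phi> t x)) (at t)"
    "\<And>t x. ((\<lambda>t. W t x) has_vector_derivative DF (\<Phi> t x) o\<^sub>L W t x) (at t)"
    "\<And>t x. (\<Phi> t has_derivative W t x) (at x)"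
    "continuous_on UNIV (\<lambda>(t, x). \<Phi> t x)" "continuous_on UNIV (\<lambda>(t, x). W t x)"
proof -
  have L0: "L \<ge> 0" using \<open>L > 0\<close> by simp
  have K0: "K * norm (x - y) \<ge> 0" for x y :: 'a
    using K[of x y] norm_ge_zero order_trans by blast
  have lip: "norm (F x - F y) \<le> L * norm (x - y)" for x y
    by (rule lipschitz_if_derivative_bounded[OF DF L])
  have contF: "continuous_on UNIV F"
    using DF by (meson continuous_at_imp_continuous_on has_derivative_continuous)
  have "continuous_on UNIV DF"
  proof (rule continuous_onI)
    fix x e assume "e > (0::real)"
    define d where "d = e / (\<bar>K\<bar> + 1)"
    have "d > 0" using \<open>e > 0\<close> by (simp add: d_def)
    have "dist (DF x') (DF x) \<le> e" if "dist x' x < d" for x'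
    proof -
      have "dist (DF x') (DF x) \<le> (\<bar>K\<bar> + 1) * norm (x' - x)"
        using K[of x' x] by (simp add: dist_norm) (smt (verit) mult_right_mono norm_ge_zero)
      also have "\<dots> \<le> (\<bar>K\<bar> + 1) * d"
        using that by (intro mult_left_mono) (auto simp: dist_norm)
      finally show ?thesis by (simp add: d_def)
    qed
    then show "\<exists>d>0. \<forall>x'\<in>UNIV. dist x' x < d \<longrightarrow> dist (DF x') (DF x) \<le> e"
      using \<open>d > 0\<close> by blast
  qed
  have "\<exists>x. x 0 = x0 \<and> (\<forall>t. (x has_vector_derivative F (x t)) (at t))" for x0
  proof (rule picard_lindelof_global)
    show "continuous_on UNIV (\<lambda>t. F (x t))" if "continuous_on UNIV x" for x :: "real \<Rightarrow> 'a"
      by (rule continuous_on_compose2[OF contF that]) auto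
  qed (use lip \<open>L > 0\<close> B in auto)
  then obtain \<phi> where \<phi>0: "\<And>x. \<phi> x 0 = x"
    and \<phi>: "\<And>x t. (\<phi> x has_vector_derivative F (\<phi> x t)) (at t)" by metis
  have cont\<phi>: "continuous_on UNIV (\<phi> x)" for x
    using \<phi> by (meson continuous_at_imp_continuous_on has_vector_derivative_continuous)
  have "\<exists>w. w 0 = id_blinfun \<and> (\<forall>t. (w has_vector_derivative DF (\<phi> x t) o\<^sub>L w t) (at t))" for x
  proof (rule picard_lindelof_global)
    show "continuous_on UNIV (\<lambda>t. DF (\<phi> x t) o\<^sub>L w t)" if "continuous_on UNIV w" for w
      by (intro continuous_intros that continuous_on_compose2[OF \<open>continuous_on UNIV DF\<close> cont\<phi>]) auto
    show "norm ((DF (\<phi> x t) o\<^sub>L v) - (DF (\<phi> x t) o\<^sub>L w)) \<le> L * norm (v - w)" for t and v w :: "'a \<Rightarrow>\<^sub>L 'a"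
      using order_trans[OF norm_blinfun_compose mult_right_mono[OF L norm_ge_zero], of "\<phi> x t" "v - w"]
      by (simp add: bounded_bilinear.diff_right[OF bounded_bilinear_blinfun_compose])
  qed (use \<open>L > 0\<close> in \<open>auto simp: bounded_bilinear.zero_right[OF bounded_bilinear_blinfun_compose]\<close>)
  then obtain w where w0: "\<And>x. w x 0 = id_blinfun"
    and w: "\<And>x t. (w x has_vector_derivative DF (\<phi> x t) o\<^sub>L w x t) (at t)" by metis
  have contw: "continuous_on UNIV (w x)" for x
    using w by (meson continuous_at_imp_continuous_on has_vector_derivative_continuous)
  have lip\<phi>: "norm (\<phi> y t - \<phi> x t) \<le> norm (y - x) * exp (L * \<bar>t\<bar>)" for x y t
    using gronwall[where e = "\<lambda>t. \<phi> y t - \<phi> x t" and e' = "\<lambda>t. F (\<phi> y t) - F (\<phi> x t)" and L = L and b = 0 and t = t]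
      lip L0 \<phi>0 by (auto intro!: derivative_intros \<phi>)
  have normw: "norm (w x t) \<le> exp (L * \<bar>t\<bar>)" for x t
  proof -
    have "norm (w x t) \<le> (norm (w x 0) + 0 * \<bar>t\<bar>) * exp (L * \<bar>t\<bar>)"
    proof (rule gronwall[OF w])
      show "norm (DF (\<phi> x s) o\<^sub>L w x s) \<le> L * norm (w x s) + 0" for s
        using order_trans[OF norm_blinfun_compose mult_right_mono[OF L norm_ge_zero]] by simp
    qed (use L0 in auto)
    also have "\<dots> \<le> 1 * exp (L * \<bar>t\<bar>)"
      unfolding w0 using norm_blinfun_id_le by (intro mult_right_mono) auto
    finally show ?thesis by simp
  qed
  \<comment> \<open>Of the three factors exp (L * \<bar>t\<bar>), one comes from the distance of the
    trajectories, one from the size of w and one from Gronwall.\<close>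
  have lipw: "norm (w x t - w y t) \<le> (\<bar>K\<bar> * \<bar>t\<bar> * exp (3 * L * \<bar>t\<bar>)) * norm (x - y)" for x y t
  proof -
    let ?b = "\<bar>K\<bar> * norm (x - y) * exp (L * \<bar>t\<bar>) * exp (L * \<bar>t\<bar>)"
    have "norm (w x t - w y t) \<le> (norm (w x 0 - w y 0) + ?b * \<bar>t\<bar>) * exp (L * \<bar>t\<bar>)"
    proof (rule gronwall[where e = "\<lambda>t. w x t - w y t"])
      show "((\<lambda>t. w x t - w y t) has_vector_derivative (DF (\<phi> x s) o\<^sub>L w x s) - (DF (\<phi> y s) o\<^sub>L w y s)) (at s)" for s
        by (intro derivative_intros w)
      fix s assume s: "\<bar>s\<bar> \<le> \<bar>t\<bar>"
      have Es: "exp (L * \<bar>s\<bar>) \<le> exp (L * \<bar>t\<bar>)" using s L0 by (simp add: mult_left_mono)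
      have 1: "norm (DF (\<phi> x s) o\<^sub>L (w x s - w y s)) \<le> L * norm (w x s - w y s)"
        using order_trans[OF norm_blinfun_compose mult_right_mono[OF L norm_ge_zero]] .
      have "norm (DF (\<phi> x s) - DF (\<phi> y s)) \<le> \<bar>K\<bar> * (norm (x - y) * exp (L * \<bar>t\<bar>))"
      proof -
        have "norm (DF (\<phi> x s) - DF (\<phi> y s)) \<le> \<bar>K\<bar> * norm (\<phi> x s - \<phi> y s)"
          using K[of "\<phi> x s" "\<phi> y s"] by (smt (verit) mult_right_mono norm_ge_zero)
        also have "norm (\<phi> x s - \<phi> y s) \<le> norm (x - y) * exp (L * \<bar>t\<bar>)"
          using order_trans[OF lip\<phi> mult_left_mono[OF Es norm_ge_zero]] .
        finally show ?thesis by (simp add: mult_left_mono)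
      qed
      then have 2: "norm ((DF (\<phi> x s) - DF (\<phi> y s)) o\<^sub>L w y s) \<le> \<bar>K\<bar> * (norm (x - y) * exp (L * \<bar>t\<bar>)) * exp (L * \<bar>t\<bar>)"
        by (intro order_trans[OF norm_blinfun_compose] mult_mono order_trans[OF normw Es]) auto
      have "(DF (\<phi> x s) o\<^sub>L w x s) - (DF (\<phi> y s) o\<^sub>L w y s) =
          (DF (\<phi> x s) o\<^sub>L (w x s - w y s)) + ((DF (\<phi> x s) - DF (\<phi> y s)) o\<^sub>L w y s)"
        by (simp add: bounded_bilinear.diff_left[OF bounded_bilinear_blinfun_compose] bounded_bilinear.diff_right[OF bounded_bilinear_blinfun_compose])
      then show "norm ((DF (\<phi> x s) o\<^sub>L w x s) - (DF (\<phi> y s) o\<^sub>L w y s)) \<le> L * norm (w x s - w y s) + ?b"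
        using norm_triangle_le[OF add_mono[OF 1 2]] by (simp add: mult.assoc)
    qed (use L0 in auto)
    also have "\<dots> = (\<bar>K\<bar> * \<bar>t\<bar> * exp (3 * L * \<bar>t\<bar>)) * norm (x - y)"
    proof -
      have "exp (3 * L * \<bar>t\<bar>) = exp (L * \<bar>t\<bar>) * exp (L * \<bar>t\<bar>) * exp (L * \<bar>t\<bar>)"
        by (simp add: exp_add[symmetric])
      then show ?thesis by (simp add: w0)
    qed
    finally show ?thesis .
  qed
  \<comment> \<open>Taylor remainder of first order: along the segment, DF varies by at most
    \<bar>K\<bar> * norm (b - a).\<close>
  have lin: "norm (F b - F a - DF a (b - a)) \<le> \<bar>K\<bar> * norm (b - a) * norm (b - a)" for a b
  proof -
    have "norm (F b - F a - DF a (b - a)) \<le> norm (b - a) * (\<bar>K\<bar> * norm (b - a))"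
    proof (rule differentiable_bound_linearization[where S = "closed_segment a b"
          and f = F and f' = "\<lambda>x. blinfun_apply (DF x)" and ?x0.0 = a])
      show "a + t *\<^sub>R (b - a) \<in> closed_segment a b" if "t \<in> {0..1}" for t
        using that by (auto simp: closed_segment_def algebra_simps intro!: exI[of _ t])
      show "(F has_derivative DF x) (at x within closed_segment a b)" for x
        using DF has_derivative_at_withinI by blast
      fix x assume "x \<in> closed_segment a b"
      then have "norm (x - a) \<le> norm (b - a)"
        by (metis norm_minus_commute segment_bound(1))
      moreover have "norm (DF x - DF a) \<le> \<bar>K\<bar> * norm (x - a)"
        using K[of x a] by (smt (verit) mult_right_mono norm_ge_zero)
      ultimately have "norm (DF x - DF a) \<le> \<bar>K\<bar> * norm (b - a)"
        by (smt (verit) mult_left_mono abs_ge_zero)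
      then show "onorm (blinfun_apply (DF x) - blinfun_apply (DF a)) \<le> \<bar>K\<bar> * norm (b - a)"
        by (simp add: norm_blinfun.rep_eq minus_blinfun.rep_eq fun_diff_def)
    qed auto
    then show ?thesis by (simp add: mult.assoc mult.left_commute)
  qed
  have der: "((\<lambda>x. \<phi> x t) has_derivative w x t) (at x)" for x t
  proof -
    let ?C = "\<bar>K\<bar> * exp (L * \<bar>t\<bar>) * exp (L * \<bar>t\<bar>) * \<bar>t\<bar> * exp (L * \<bar>t\<bar>)"
    show ?thesis
    proof (rule has_derivativeI_sandwich[where e = 1 and H = "\<lambda>y. ?C * norm (y - x)"])
    show "((\<lambda>y. ?C * norm (y - x)) \<longlongrightarrow> 0) (at x)"
      by (rule tendsto_eq_intros refl | simp)+
    fix y assume "y \<noteq> x"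
    \<comment> \<open>This error vanishes at time 0; its derivative is DF applied to the error
      itself plus the remainder from \<open>lin\<close>, which is quadratic in norm (y - x).\<close>
    let ?e = "\<lambda>s. \<phi> y s - \<phi> x s - w x s (y - x)"
    let ?b = "\<bar>K\<bar> * (norm (y - x) * exp (L * \<bar>t\<bar>)) * (norm (y - x) * exp (L * \<bar>t\<bar>))"
    have "norm (?e t) \<le> (norm (?e 0) + ?b * \<bar>t\<bar>) * exp (L * \<bar>t\<bar>)"
    proof (rule gronwall[where e = ?e])
      show "(?e has_vector_derivative F (\<phi> y s) - F (\<phi> x s) - (DF (\<phi> x s) o\<^sub>L w x s) (y - x)) (at s)" for s
        by (intro derivative_intros \<phi> bounded_linear.has_vector_derivative[OF blinfun.bounded_linear_left w])
      fix s assume s: "\<bar>s\<bar> \<le> \<bar>t\<bar>"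
      have Es: "exp (L * \<bar>s\<bar>) \<le> exp (L * \<bar>t\<bar>)" using s L0 by (simp add: mult_left_mono)
      let ?d = "\<phi> y s - \<phi> x s"
      have d: "norm ?d \<le> norm (y - x) * exp (L * \<bar>t\<bar>)"
        using order_trans[OF lip\<phi> mult_left_mono[OF Es norm_ge_zero]] .
      have 1: "norm (DF (\<phi> x s) (?e s)) \<le> L * norm (?e s)"
        using order_trans[OF norm_blinfun mult_right_mono[OF L norm_ge_zero]] .
      have 2: "norm (F (\<phi> y s) - F (\<phi> x s) - DF (\<phi> x s) ?d) \<le> ?b"
        using d by (intro order_trans[OF lin] mult_mono) auto
      have "F (\<phi> y s) - F (\<phi> x s) - (DF (\<phi> x s) o\<^sub>L w x s) (y - x) =
          DF (\<phi> x s) (?e s) + (F (\<phi> y s) - F (\<phi> x s) - DF (\<phi> x s) ?d)"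
        by (simp add: blinfun.diff_right)
      then show "norm (F (\<phi> y s) - F (\<phi> x s) - (DF (\<phi> x s) o\<^sub>L w x s) (y - x)) \<le> L * norm (?e s) + ?b"
        using norm_triangle_le[OF add_mono[OF 1 2]] by (simp only:)
    qed (use L0 in auto)
    also have "\<dots> = ?C * norm (y - x) * norm (y - x)"
      by (simp add: \<phi>0 w0 mult_ac)
    finally show "norm (\<phi> y t - \<phi> x t - w x t (y - x)) / norm (y - x) \<le> ?C * norm (y - x)"
      using \<open>y \<noteq> x\<close> by (simp add: divide_le_eq)
    qed (auto intro: blinfun.bounded_linear_right)
  qed
  show thesis
  proof (rule that[of "\<lambda>t x. \<phi> x t" "\<lambda>t x. w x t"])
    show "continuous_on UNIV (\<lambda>(t, x). \<phi> x t)"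
      by (rule continuous_on_pair_if_lipschitz[where c = "\<lambda>t. exp (L * \<bar>t\<bar>)"])
        (use lip\<phi> cont\<phi> in \<open>auto simp: dist_norm mult.commute intro!: continuous_intros\<close>)
    show "continuous_on UNIV (\<lambda>(t, x). w x t)"
      by (rule continuous_on_pair_if_lipschitz[where c = "\<lambda>t. \<bar>K\<bar> * \<bar>t\<bar> * exp (3 * L * \<bar>t\<bar>)"])
        (use lipw contw in \<open>auto simp: dist_norm intro!: continuous_intros\<close>)
  qed (use \<phi>0 w0 \<phi> w der in auto)
qed

section \<open>Smooth functions\<close>

subsection \<open>Closure properties\<close>

lemma higher_differentiable_on_cong:
  assumes "open U" "\<And>x. x \<in> U \<Longrightarrow> f x = g x" "higher_differentiable_on k U f"
  shows "higher_differentiable_on k U g"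
  using assms(2,3)
proof (induction k arbitrary: f g)
  case 0
  then show ?case using continuous_on_cong by (metis higher_differentiable_on.simps(1))
next
  case (Suc k)
  have d: "f differentiable (at x)" if "x \<in> U" for x
    using Suc.prems(2) that by simp
  have eq: "frechet_derivative f (at x) = frechet_derivative g (at x)" if "x \<in> U" for x
    using frechet_derivative_transform_within_open[OF d[OF that] \<open>open U\<close> that] Suc.prems(1) by blast
  have "g differentiable (at x)" if "x \<in> U" for x
    using has_derivative_transform_within_open[OF _ \<open>open U\<close> that] d[OF that] Suc.prems(1)
    unfolding differentiable_def by blast
  moreover have "higher_differentiable_on k U (\<lambda>x. frechet_derivative g (at x) v)" for v
    by (rule Suc.IH[of "\<lambda>x. frechet_derivative f (at x) v"]) (use Suc.prems(2) eq in auto)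
  ultimately show ?case by simp
qed

lemma higher_differentiable_on_SucI:
  assumes "open U" "\<And>x. x \<in> U \<Longrightarrow> (f has_derivative f' x) (at x)"
    "\<And>v. higher_differentiable_on k U (\<lambda>x. f' x v)"
  shows "higher_differentiable_on (Suc k) U f"
proof -
  have "f' x = frechet_derivative f (at x)" if "x \<in> U" for x
    using assms(2)[OF that] by (rule frechet_derivative_at)
  then have "higher_differentiable_on k U (\<lambda>x. frechet_derivative f (at x) v)" for v
    by (intro higher_differentiable_on_cong[OF \<open>open U\<close> _ assms(3)[of v]]) auto
  then show ?thesis
    using assms(2) by (auto simp: differentiable_def)
qed

lemma higher_differentiable_on_SucD:
  assumes "higher_differentiable_on (Suc k) U f"
  shows "x \<in> U \<Longrightarrow> (f has_derivative frechet_derivative f (at x)) (at x)"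
    "higher_differentiable_on k U (\<lambda>x. frechet_derivative f (at x) v)"
  using assms by (auto simp: frechet_derivative_works)

lemma higher_differentiable_on_le_Suc:
  "higher_differentiable_on (Suc k) U f \<Longrightarrow> higher_differentiable_on k U f"
proof (induction k arbitrary: f)
  case 0
  then show ?case
    by (auto intro!: continuous_at_imp_continuous_on differentiable_imp_continuous_within)
next
  case (Suc k)
  then show ?case by (metis higher_differentiable_on.simps(2))
qed

lemma higher_differentiable_on_subset:
  "higher_differentiable_on k U f \<Longrightarrow> V \<subseteq> U \<Longrightarrow> higher_differentiable_on k V f"
  by (induction k arbitrary: f) (auto intro: continuous_on_subset)

lemma higher_differentiable_on_const: "higher_differentiable_on k U (\<lambda>x. c)"
  by (induction k arbitrary: c) auto

lemma higher_differentiable_on_add: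
  assumes "open U"
  shows "higher_differentiable_on k U f \<Longrightarrow> higher_differentiable_on k U g \<Longrightarrow>
    higher_differentiable_on k U (\<lambda>x. f x + g x)"
proof (induction k arbitrary: f g)
  case 0
  then show ?case by (auto intro: continuous_on_add)
next
  case (Suc k)
  show ?case
    by (rule higher_differentiable_on_SucI[OF \<open>open U\<close> has_derivative_add])
      (use Suc higher_differentiable_on_SucD in blast)+
qed

lemma higher_differentiable_on_scaleR:
  fixes f :: "'a::real_normed_vector \<Rightarrow> real"
  assumes "open U"
  shows "higher_differentiable_on k U f \<Longrightarrow> higher_differentiable_on k U g \<Longrightarrow>
    higher_differentiable_on k U (\<lambda>x. f x *\<^sub>R g x)"
proof (induction k arbitrary: f g)
  case 0
  then show ?case by (auto intro: continuous_on_scaleR)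
next
  case (Suc k)
  note D = higher_differentiable_on_SucD[OF Suc.prems(1)] higher_differentiable_on_SucD[OF Suc.prems(2)]
  show ?case
    by (rule higher_differentiable_on_SucI[OF \<open>open U\<close> has_derivative_scaleR[OF D(1) D(3)]])
      (auto intro!: higher_differentiable_on_add[OF \<open>open U\<close>] Suc.IH D Suc.prems[THEN higher_differentiable_on_le_Suc])
qed

lemma higher_differentiable_on_linear_compose:
  assumes "open U" "bounded_linear T"
  shows "higher_differentiable_on k U f \<Longrightarrow> higher_differentiable_on k U (\<lambda>x. T (f x))"
proof (induction k arbitrary: f)
  case 0
  then show ?case using assms(2) by (auto intro: bounded_linear.continuous_on)
next
  case (Suc k)
  show ?case
    by (rule higher_differentiable_on_SucI[OF \<open>open U\<close> bounded_linear.has_derivative[OF assms(2)]])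
      (use Suc higher_differentiable_on_SucD in blast)+
qed

lemma higher_differentiable_on_linear:
  assumes "open U" "bounded_linear T"
  shows "higher_differentiable_on k U T"
proof (cases k)
  case 0
  then show ?thesis using assms by (simp add: linear_continuous_on)
next
  case (Suc k')
  show ?thesis unfolding Suc
    by (rule higher_differentiable_on_SucI[OF \<open>open U\<close> bounded_linear_imp_has_derivative[OF assms(2)]])
      (rule higher_differentiable_on_const)
qed

text \<open>The derivative of 1 / f contains 1 / f again, but only to order k, where the induction
  hypothesis applies.\<close>

lemma higher_differentiable_on_inverse:
  fixes f :: "'a::real_normed_vector \<Rightarrow> real"
  assumes "open U" and nz: "\<And>x. x \<in> U \<Longrightarrow> f x \<noteq> 0"
  shows "higher_differentiable_on k U f \<Longrightarrow> higher_differentiable_on k U (\<lambda>x. inverse (f x))"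
proof (induction k)
  case 0
  then show ?case using nz by (auto intro: continuous_on_inverse)
next
  case (Suc k)
  note D = higher_differentiable_on_SucD[OF Suc.prems]
  have IH: "higher_differentiable_on k U (\<lambda>x. inverse (f x))"
    using Suc higher_differentiable_on_le_Suc by blast
  show ?case
  proof (rule higher_differentiable_on_SucI[OF \<open>open U\<close> Deriv.has_derivative_inverse[OF nz D(1)]])
    fix v
    have "higher_differentiable_on k U (\<lambda>x. - 1 *\<^sub>R (inverse (f x) *\<^sub>R (frechet_derivative f (at x) v *\<^sub>R inverse (f x))))"
      by (intro higher_differentiable_on_scaleR[OF \<open>open U\<close>] higher_differentiable_on_const IH D)
    then show "higher_differentiable_on k U (\<lambda>x. - (inverse (f x) * frechet_derivative f (at x) v * inverse (f x)))"
      by (simp add: mult.assoc)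
  qed auto
qed

lemma higher_differentiable_on_Un:
  assumes "open U" "open V"
  shows "higher_differentiable_on k U f \<Longrightarrow> higher_differentiable_on k V f \<Longrightarrow>
    higher_differentiable_on k (U \<union> V) f"
  by (induction k arbitrary: f) (use assms continuous_on_open_Un in auto)

lemma smooth_on_cong:
  "open U \<Longrightarrow> (\<And>x. x \<in> U \<Longrightarrow> f x = g x) \<Longrightarrow> smooth_on U f \<Longrightarrow> smooth_on U g"
  unfolding smooth_on_def using higher_differentiable_on_cong by blast

lemma smooth_on_subset: "smooth_on U f \<Longrightarrow> V \<subseteq> U \<Longrightarrow> smooth_on V f"
  unfolding smooth_on_def using higher_differentiable_on_subset by blast

lemma smooth_on_const: "smooth_on U (\<lambda>x. c)"
  by (simp add: smooth_on_def higher_differentiable_on_const)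

lemma smooth_on_add:
  "open U \<Longrightarrow> smooth_on U f \<Longrightarrow> smooth_on U g \<Longrightarrow> smooth_on U (\<lambda>x. f x + g x)"
  by (simp add: smooth_on_def higher_differentiable_on_add)

lemma smooth_on_sum:
  "open U \<Longrightarrow> (\<And>i. i \<in> I \<Longrightarrow> smooth_on U (f i)) \<Longrightarrow> smooth_on U (\<lambda>x. \<Sum>i\<in>I. f i x)"
  by (induction I rule: infinite_finite_induct) (auto intro: smooth_on_const smooth_on_add)

lemma smooth_on_scaleR:
  fixes f :: "'a::real_normed_vector \<Rightarrow> real"
  shows "open U \<Longrightarrow> smooth_on U f \<Longrightarrow> smooth_on U g \<Longrightarrow> smooth_on U (\<lambda>x. f x *\<^sub>R g x)"
  by (simp add: smooth_on_def higher_differentiable_on_scaleR)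

lemma smooth_on_mult:
  fixes f g :: "'a::real_normed_vector \<Rightarrow> real"
  shows "open U \<Longrightarrow> smooth_on U f \<Longrightarrow> smooth_on U g \<Longrightarrow> smooth_on U (\<lambda>x. f x * g x)"
  using smooth_on_scaleR[of U f g] by simp

lemma smooth_on_linear_compose:
  "open U \<Longrightarrow> bounded_linear T \<Longrightarrow> smooth_on U f \<Longrightarrow> smooth_on U (\<lambda>x. T (f x))"
  by (simp add: smooth_on_def higher_differentiable_on_linear_compose)

lemma smooth_on_inverse:
  fixes f :: "'a::real_normed_vector \<Rightarrow> real"
  shows "open U \<Longrightarrow> (\<And>x. x \<in> U \<Longrightarrow> f x \<noteq> 0) \<Longrightarrow> smooth_on U f \<Longrightarrow> smooth_on U (\<lambda>x. inverse (f x))"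
  by (simp add: smooth_on_def higher_differentiable_on_inverse)

lemma smooth_on_Un:
  "open U \<Longrightarrow> open V \<Longrightarrow> smooth_on U f \<Longrightarrow> smooth_on V f \<Longrightarrow> smooth_on (U \<union> V) f"
  by (simp add: smooth_on_def higher_differentiable_on_Un)

lemma smooth_on_has_derivative:
  "smooth_on U f \<Longrightarrow> x \<in> U \<Longrightarrow> (f has_derivative frechet_derivative f (at x)) (at x)"
  unfolding smooth_on_def using higher_differentiable_on_SucD(1) by blast

lemma smooth_on_frechet_derivative:
  "smooth_on U f \<Longrightarrow> smooth_on U (\<lambda>x. frechet_derivative f (at x) v)"
  unfolding smooth_on_def using higher_differentiable_on_SucD(2) by blast

lemma smooth_on_imp_continuous_on: "smooth_on U f \<Longrightarrow> continuous_on U f"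
  unfolding smooth_on_def using higher_differentiable_on.simps(1) by blast

text \<open>F is arbitrary outside U, but the product vanishes on the complement of the support of
  \<rho>, and this open set covers the space together with U.\<close>

lemma smooth_on_scaleR_extend:
  fixes \<rho> :: "'a::real_normed_vector \<Rightarrow> real"
  assumes "smooth_on UNIV \<rho>" "open U" "closure {x. \<rho> x \<noteq> 0} \<subseteq> U" "smooth_on U F"
  shows "smooth_on UNIV (\<lambda>x. \<rho> x *\<^sub>R F x)"
proof -
  let ?V = "- closure {x. \<rho> x \<noteq> 0}"
  have "smooth_on U (\<lambda>x. \<rho> x *\<^sub>R F x)"
    using assms smooth_on_subset[OF assms(1)] by (intro smooth_on_scaleR) auto
  moreover have "smooth_on ?V (\<lambda>x. \<rho> x *\<^sub>R F x)"
    by (rule smooth_on_cong[OF _ _ smooth_on_const[of _ 0]])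
      (use closure_subset[of "{x. \<rho> x \<noteq> 0}"] in auto)
  ultimately have "smooth_on (U \<union> ?V) (\<lambda>x. \<rho> x *\<^sub>R F x)"
    using \<open>open U\<close> by (intro smooth_on_Un) auto
  moreover have "U \<union> ?V = UNIV" using assms(3) by auto
  ultimately show ?thesis by simp
qed

subsection \<open>Derivatives as bounded linear functions\<close>

text \<open>The derivative as a point of a normed space of operators, so that it has a norm and can
  itself be differentiated.\<close>

definition derivative_blinfun ::
  "('a::euclidean_space \<Rightarrow> 'b::real_normed_vector) \<Rightarrow> 'a \<Rightarrow> 'a \<Rightarrow>\<^sub>L 'b" where
  "derivative_blinfun f x = Blinfun (frechet_derivative f (at x))"

lemma derivative_blinfun_apply:
  assumes "smooth_on U f" "x \<in> U"
  shows "blinfun_apply (derivative_blinfun f x) = frechet_derivative f (at x)"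
  unfolding derivative_blinfun_def
  by (rule bounded_linear_Blinfun_apply) (rule has_derivative_bounded_linear[OF smooth_on_has_derivative[OF assms]])

lemma has_derivative_derivative_blinfun:
  assumes "smooth_on U f" "x \<in> U"
  shows "(f has_derivative derivative_blinfun f x) (at x)"
  unfolding derivative_blinfun_apply[OF assms] by (rule smooth_on_has_derivative[OF assms])

text \<open>Smoothness is defined by derivatives in fixed directions, whereas here the whole
  operator varies. In a basis the operator is a finite sum of fixed linear images of the directional
  derivatives along basis vectors.\<close>

lemma smooth_on_derivative_blinfun:
  fixes f :: "'a::euclidean_space \<Rightarrow> 'b::real_normed_vector"
  assumes "open U" "smooth_on U f"
  shows "smooth_on U (derivative_blinfun f)"
proof (rule smooth_on_cong[OF \<open>open U\<close>])
  let ?T = "\<lambda>a y. blinfun_scaleR_left y o\<^sub>L blinfun_inner_right a :: 'a \<Rightarrow>\<^sub>L 'b"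
  show "smooth_on U (\<lambda>x. \<Sum>a\<in>Basis. ?T a (frechet_derivative f (at x) a))"
    by (intro smooth_on_sum smooth_on_linear_compose[where T = "?T _"] smooth_on_frechet_derivative assms
        bounded_linear_compose[OF bounded_bilinear.bounded_linear_left[OF bounded_bilinear_blinfun_compose]]
        bounded_linear_blinfun_scaleR_left)
  fix x assume "x \<in> U"
  have lin: "linear (frechet_derivative f (at x))"
    using has_derivative_linear[OF smooth_on_has_derivative[OF assms(2) \<open>x \<in> U\<close>]] .
  show "(\<Sum>a\<in>Basis. ?T a (frechet_derivative f (at x) a)) = derivative_blinfun f x"
  proof (rule blinfun_eqI)
    fix v
    have "frechet_derivative f (at x) v = (\<Sum>a\<in>Basis. (v \<bullet> a) *\<^sub>R frechet_derivative f (at x) a)"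
      by (subst (1) euclidean_representation[of v, symmetric])
        (simp add: linear_sum[OF lin] linear_cmul[OF lin])
    then show "blinfun_apply (\<Sum>a\<in>Basis. ?T a (frechet_derivative f (at x) a)) v = derivative_blinfun f x v"
      by (simp add: derivative_blinfun_apply[OF assms(2) \<open>x \<in> U\<close>] blinfun.sum_left inner_commute)
  qed
qed

lemma derivative_blinfun_eq_0:
  assumes "open U" "x \<in> U" "\<And>y. y \<in> U \<Longrightarrow> f y = 0"
  shows "derivative_blinfun f x = 0"
proof -
  have "(f has_derivative (\<lambda>v. 0)) (at x)"
    by (rule has_derivative_transform_within_open[OF has_derivative_const[of 0] assms(1,2)]) (simp add: assms(3))
  from frechet_derivative_at[OF this, symmetric] show ?thesis
    by (simp add: derivative_blinfun_def zero_blinfun_def)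
qed

lemma smooth_compact_support_bounded:
  fixes f :: "'a::euclidean_space \<Rightarrow> 'b::real_normed_vector"
  assumes "smooth_on UNIV f" "compact K" "\<And>x. x \<notin> K \<Longrightarrow> f x = 0"
  obtains C where "\<And>x. norm (f x) \<le> C"
proof -
  have "compact (f ` K)"
    using assms smooth_on_imp_continuous_on compact_continuous_image continuous_on_subset by blast
  then obtain C where C: "\<And>y. y \<in> f ` K \<Longrightarrow> norm y \<le> C"
    using compact_imp_bounded bounded_iff by metis
  show thesis
  proof (rule that)
    fix x show "norm (f x) \<le> \<bar>C\<bar>"
      using C[of "f x"] assms(3)[of x] by (cases "x \<in> K") auto
  qed
qed

subsection \<open>Bump functions\<close>

text \<open>The powers of \<open>inverse s\<close> make the span of these functions closed under
  differentiation, so that smoothness of exp (- 1 / s) across 0 can be proved for all j at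
  once.\<close>

definition flat :: "nat \<Rightarrow> real \<Rightarrow> real" where
  "flat j s = (if s > 0 then inverse s ^ j * exp (- inverse s) else 0)"

lemma flat_nonneg: "flat j s \<ge> 0"
  by (simp add: flat_def)

lemma flat_eq_0_iff: "flat j s = 0 \<longleftrightarrow> s \<le> 0"
  by (auto simp: flat_def)

lemma has_real_derivative_flat:
  "(flat j has_real_derivative - real j * flat (j + 1) s + flat (j + 2) s) (at s)"
proof -
  consider "s > 0" | "s < 0" | "s = 0" by linarith
  then show ?thesis
  proof cases
    case 1
    have "((\<lambda>s. inverse s ^ j * exp (- inverse s)) has_real_derivative - real j * flat (j + 1) s + flat (j + 2) s) (at s)"
    proof -
      have "((\<lambda>s. inverse s ^ j) has_real_derivative - real j * inverse s ^ (j + 1)) (at s)"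
      proof (cases j)
        case (Suc i)
        have "((\<lambda>s. inverse s ^ Suc i) has_real_derivative
            (1 + real i) * (- (inverse s ^ Suc (Suc 0)) * inverse s ^ i)) (at s)"
          using 1 by (intro DERIV_power_Suc DERIV_inverse) auto
        then show ?thesis by (simp add: Suc algebra_simps)
      qed simp
      moreover have "((\<lambda>s. exp (- inverse s)) has_real_derivative exp (- inverse s) * inverse s ^ 2) (at s)"
        using 1 by (auto intro!: derivative_eq_intros simp: power2_eq_square)
      ultimately show ?thesis
        using 1 DERIV_mult by (fastforce simp: flat_def algebra_simps power2_eq_square)
    qed
    then show ?thesis
      by (rule has_field_derivative_transform_within_open[where S = "{0<..}"]) (use 1 in \<open>auto simp: flat_def\<close>)
  next
    case 2
    then have "(flat j has_real_derivative 0) (at s)"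
      by (intro has_field_derivative_transform_within_open[OF DERIV_const[of 0], where S = "{..<0}"]) (auto simp: flat_def)
    then show ?thesis using 2 by (simp add: flat_def)
  next
    case 3
    \<comment> \<open>From the right, the difference quotient at 0 is a power of 1 / h divided by
      exp (1 / h), and the exponential wins.\<close>
    have right: "((\<lambda>h. flat j h / h) \<longlongrightarrow> 0) (at_right 0)"
    proof -
      have "((\<lambda>h. inverse h ^ (j + 1) / exp (inverse h)) \<longlongrightarrow> 0) (at_right (0::real))"
        using filterlim_compose[OF tendsto_power_div_exp_0 filterlim_inverse_at_top_right] .
      moreover have "eventually (\<lambda>h. inverse h ^ (j + 1) / exp (inverse h) = flat j h / h) (at_right (0::real))"
        unfolding eventually_at_filter by (auto simp: flat_def exp_minus field_simps)
      ultimately show ?thesis by (rule Lim_transform_eventually)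
    qed
    have left: "((\<lambda>h. flat j h / h) \<longlongrightarrow> 0) (at_left 0)"
      by (rule Lim_transform_eventually[OF tendsto_const[of 0]])
        (auto simp: flat_def eventually_at_filter)
    have "((\<lambda>h. (flat j (0 + h) - flat j 0) / h) \<longlongrightarrow> 0) (at 0)"
      using filterlim_split_at[OF left right] by (simp add: flat_def)
    then have "(flat j has_real_derivative 0) (at 0)"
      by (simp add: DERIV_def)
    then show ?thesis using 3 by (simp add: flat_def)
  qed
qed

text \<open>Differentiation gives terms of the same shape, with new smooth coefficients and indices
  j, j + 1 and j + 2; the induction therefore generalizes over P and j.\<close>

lemma higher_differentiable_on_mult_flat:
  fixes P q :: "'a::real_normed_vector \<Rightarrow> real"
  assumes "open U" "smooth_on U q"
  shows "smooth_on U P \<Longrightarrow> higher_differentiable_on k U (\<lambda>x. P x * flat j (q x))"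
proof (induction k arbitrary: P j)
  case 0
  have "continuous_on UNIV (flat j)"
    by (meson DERIV_isCont continuous_at_imp_continuous_on has_real_derivative_flat)
  then have "continuous_on U (\<lambda>x. flat j (q x))"
    by (rule continuous_on_compose2[OF _ smooth_on_imp_continuous_on[OF assms(2)] subset_UNIV])
  then show ?case
    using smooth_on_imp_continuous_on[OF 0] by (auto intro: continuous_on_mult)
next
  case (Suc k)
  let ?D = "\<lambda>f x. frechet_derivative f (at x)"
  show ?case
  proof (rule higher_differentiable_on_SucI[OF \<open>open U\<close>])
    fix x assume "x \<in> U"
    have "((\<lambda>x. flat j (q x)) has_derivative (\<lambda>v. ?D q x v * (- real j * flat (j + 1) (q x) + flat (j + 2) (q x)))) (at x)"
      using has_derivative_compose[OF smooth_on_has_derivative[OF assms(2) \<open>x \<in> U\<close>]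
          has_real_derivative_flat[of j "q x", unfolded has_field_derivative_def]]
      by (simp add: mult.commute)
    from has_derivative_mult[OF smooth_on_has_derivative[OF Suc.prems \<open>x \<in> U\<close>] this]
    show "((\<lambda>x. P x * flat j (q x)) has_derivative
      (\<lambda>v. P x * (?D q x v * (- real j * flat (j + 1) (q x) + flat (j + 2) (q x))) + ?D P x v * flat j (q x))) (at x)" .
  next
    fix v
    have s: "smooth_on U (\<lambda>x. P x * ?D q x v)" "smooth_on U (\<lambda>x. - real j * (P x * ?D q x v))"
      "smooth_on U (\<lambda>x. ?D P x v)"
      by (rule smooth_on_mult[OF \<open>open U\<close>] smooth_on_const smooth_on_frechet_derivative assms(2) Suc.prems)+
    have "higher_differentiable_on k U (\<lambda>x. (- real j * (P x * ?D q x v)) * flat (j + 1) (q x) +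
        ((P x * ?D q x v) * flat (j + 2) (q x) + ?D P x v * flat j (q x)))"
      by (intro higher_differentiable_on_add[OF \<open>open U\<close>] Suc.IH s)
    then show "higher_differentiable_on k U
      (\<lambda>x. P x * (?D q x v * (- real j * flat (j + 1) (q x) + flat (j + 2) (q x))) + ?D P x v * flat j (q x))"
      by (simp add: algebra_simps)
  qed
qed

lemma smooth_on_flat:
  fixes q :: "'a::real_normed_vector \<Rightarrow> real"
  assumes "open U" "smooth_on U q"
  shows "smooth_on U (\<lambda>x. flat j (q x))"
  using higher_differentiable_on_mult_flat[OF assms smooth_on_const[of U 1], of _ j]
  by (simp add: smooth_on_def)

lemma smooth_on_norm_square: "smooth_on UNIV (\<lambda>x::'a::real_inner. (x - c) \<bullet> (x - c))"
  unfolding smooth_on_def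
proof
  fix k
  have "higher_differentiable_on (Suc k) UNIV (\<lambda>x::'a. (x - c) \<bullet> (x - c))"
  proof (rule higher_differentiable_on_SucI)
    show "((\<lambda>x. (x - c) \<bullet> (x - c)) has_derivative (\<lambda>v. x \<bullet> (2 *\<^sub>R v) + (- 2 * (c \<bullet> v)))) (at x)" for x
      by (auto intro!: derivative_eq_intros simp: algebra_simps inner_commute)
    show "higher_differentiable_on k UNIV (\<lambda>x. x \<bullet> (2 *\<^sub>R v) + (- 2 * (c \<bullet> v)))" for v :: 'a
      by (intro higher_differentiable_on_add higher_differentiable_on_const higher_differentiable_on_linear
          bounded_linear_inner_left) auto
  qed auto
  then show "higher_differentiable_on k UNIV (\<lambda>x::'a. (x - c) \<bullet> (x - c))"
    by (rule higher_differentiable_on_le_Suc)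
qed

lemma smooth_bump:
  fixes c :: "'a::euclidean_space"
  assumes "r > 0"
  obtains \<beta> :: "'a \<Rightarrow> real" where "smooth_on UNIV \<beta>" "\<And>x. \<beta> x \<ge> 0" "\<And>x. \<beta> x \<noteq> 0 \<longleftrightarrow> x \<in> ball c r"
proof
  let ?q = "\<lambda>x::'a. r\<^sup>2 + (- 1) * ((x - c) \<bullet> (x - c))"
  show "smooth_on UNIV (\<lambda>x. flat 0 (?q x))"
    by (intro smooth_on_flat smooth_on_add smooth_on_mult smooth_on_const smooth_on_norm_square) auto
  show "flat 0 (?q x) \<noteq> 0 \<longleftrightarrow> x \<in> ball c r" for x
  proof -
    have "flat 0 (?q x) \<noteq> 0 \<longleftrightarrow> (norm (x - c))\<^sup>2 < r\<^sup>2"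
      by (simp add: flat_eq_0_iff power2_norm_eq_inner not_le)
    also have "\<dots> \<longleftrightarrow> norm (x - c) < r"
      using assms by (metis less_imp_le norm_ge_zero pos2 power2_less_imp_less power_strict_mono)
    finally show ?thesis by (simp add: dist_norm norm_minus_commute)
  qed
qed (rule flat_nonneg)

subsection \<open>Partitions of unity and extension of smooth maps\<close>

text \<open>The normalizing denominator \<open>\<sigma> + flat 0 (s0 - \<sigma>)\<close> is positive everywhere and equals \<open>\<sigma>\<close> on \<open>M\<close>.\<close>

lemma smooth_partition_of_unity:
  fixes M :: "'a::euclidean_space set"
  assumes "compact M" and U: "\<And>p. p \<in> M \<Longrightarrow> open (U p) \<and> p \<in> U p"
  obtains m and c :: "nat \<Rightarrow> 'a" and \<rho> :: "nat \<Rightarrow> 'a \<Rightarrow> real"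
  where "\<And>i. i < m \<Longrightarrow> c i \<in> M" "\<And>i. i < m \<Longrightarrow> smooth_on UNIV (\<rho> i)" "\<And>i x. i < m \<Longrightarrow> \<rho> i x \<ge> 0"
    "\<And>i. i < m \<Longrightarrow> closure {x. \<rho> i x \<noteq> 0} \<subseteq> U (c i)" "\<And>i. i < m \<Longrightarrow> compact (closure {x. \<rho> i x \<noteq> 0})"
    "\<And>p. p \<in> M \<Longrightarrow> (\<Sum>i<m. \<rho> i p) = 1"
proof (cases "M = {}")
  case True
  show thesis by (rule that[of 0]) (use True in auto)
next
  case False
  \<comment> \<open>Closed balls, since the closure of each support has to stay inside U p.\<close>
  have "\<forall>p\<in>M. \<exists>r>0. cball p r \<subseteq> U p"
    using U open_contains_cball by blast
  then obtain r where r: "\<And>p. p \<in> M \<Longrightarrow> r p > 0" "\<And>p. p \<in> M \<Longrightarrow> cball p (r p) \<subseteq> U p" by metis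
  obtain C where C: "C \<subseteq> M" "finite C" "M \<subseteq> (\<Union>p\<in>C. ball p (r p))"
    using compactE_image[OF \<open>compact M\<close>, of M "\<lambda>p. ball p (r p)"] r(1) by force
  obtain c m where "bij_betw c {..<m::nat} C"
    using ex_bij_betw_nat_finite[OF \<open>finite C\<close>] unfolding atLeast0LessThan by blast
  then have c: "c ` {..<m} = C" by (simp add: bij_betw_def)
  then have cM: "c i \<in> M" if "i < m" for i using that C(1) by blast
  have "\<forall>i\<in>{..<m}. \<exists>\<beta> :: 'a \<Rightarrow> real. smooth_on UNIV \<beta> \<and> (\<forall>x. \<beta> x \<ge> 0) \<and> (\<forall>x. \<beta> x \<noteq> 0 \<longleftrightarrow> x \<in> ball (c i) (r (c i)))"
    using smooth_bump r(1)[OF cM] by (metis lessThan_iff)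
  then obtain \<beta> :: "nat \<Rightarrow> 'a \<Rightarrow> real" where \<beta>: "\<And>i. i < m \<Longrightarrow> smooth_on UNIV (\<beta> i)"
    "\<And>i x. i < m \<Longrightarrow> \<beta> i x \<ge> 0" "\<And>i x. i < m \<Longrightarrow> \<beta> i x \<noteq> 0 \<longleftrightarrow> x \<in> ball (c i) (r (c i))"
    by (metis lessThan_iff)
  define \<sigma> where "\<sigma> x = (\<Sum>i<m. \<beta> i x)" for x
  have smooth\<sigma>: "smooth_on UNIV \<sigma>"
    unfolding \<sigma>_def by (intro smooth_on_sum) (auto intro: \<beta>)
  have \<sigma>0: "\<sigma> x \<ge> 0" for x unfolding \<sigma>_def by (intro sum_nonneg) (auto intro: \<beta>)
  have \<sigma>pos: "\<sigma> x > 0" if "x \<in> M" for x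
  proof -
    obtain i where i: "i < m" "x \<in> ball (c i) (r (c i))"
    proof -
      obtain p where p: "p \<in> C" "x \<in> ball p (r p)" using C(3) \<open>x \<in> M\<close> by blast
      then obtain i where "i < m" "p = c i" using c by auto
      then show ?thesis using p that by blast
    qed
    have "0 < \<beta> i x" using \<beta>(2,3)[of i x] i by force
    also have "\<dots> \<le> \<sigma> x" unfolding \<sigma>_def using i \<beta>(2) by (intro member_le_sum) auto
    finally show ?thesis .
  qed
  \<comment> \<open>The value \<sigma> p0 is the constant s0 of the normalizing denominator: the
    minimum of \<sigma> on M, which is positive.\<close>
  obtain p0 where "p0 \<in> M" and p0: "\<And>x. x \<in> M \<Longrightarrow> \<sigma> p0 \<le> \<sigma> x"
    using continuous_attains_inf[OF \<open>compact M\<close> False, of \<sigma>]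
      continuous_on_subset[OF smooth_on_imp_continuous_on[OF smooth\<sigma>]] by blast
  define d where "d x = \<sigma> x + flat 0 (\<sigma> p0 + (- 1) * \<sigma> x)" for x
  have smoothd: "smooth_on UNIV d"
    unfolding d_def by (intro smooth_on_add smooth_on_flat smooth_on_mult smooth_on_const smooth\<sigma>) auto
  have dpos: "d x > 0" for x
  proof (cases "\<sigma> x < \<sigma> p0")
    case True
    then show ?thesis using \<sigma>0[of x] flat_nonneg[of 0 "\<sigma> p0 + (- 1) * \<sigma> x"] flat_eq_0_iff[of 0 "\<sigma> p0 + (- 1) * \<sigma> x"]
      by (simp add: d_def add_nonneg_pos)
  next
    case False
    then show ?thesis using \<sigma>pos[OF \<open>p0 \<in> M\<close>] flat_nonneg[of 0 "\<sigma> p0 + (- 1) * \<sigma> x"] by (simp add: d_def)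
  qed
  have dM: "d x = \<sigma> x" if "x \<in> M" for x
    using p0[OF that] by (simp add: d_def flat_def)
  define \<rho> where "\<rho> i x = \<beta> i x * inverse (d x)" for i x
  have "{x. \<rho> i x \<noteq> 0} \<subseteq> cball (c i) (r (c i))" if "i < m" for i
    using \<beta>(3)[OF that] by (auto simp: \<rho>_def)
  then have cl: "closure {x. \<rho> i x \<noteq> 0} \<subseteq> cball (c i) (r (c i))" if "i < m" for i
    using that by (simp add: closure_minimal)
  show thesis
  proof (rule that[of m c \<rho>])
    show "smooth_on UNIV (\<rho> i)" if "i < m" for i
      unfolding \<rho>_def using dpos by (intro smooth_on_mult smooth_on_inverse smoothd \<beta> that) (auto simp: less_imp_neq[symmetric] order_less_imp_not_eq2)
    show "closure {x. \<rho> i x \<noteq> 0} \<subseteq> U (c i)" if "i < m" for i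
      using cl r(2) cM that by blast
    show "compact (closure {x. \<rho> i x \<noteq> 0})" if "i < m" for i
      using cl[OF that] by (meson bounded_cball bounded_subset closed_closure compact_eq_bounded_closed)
    show "(\<Sum>i<m. \<rho> i p) = 1" if "p \<in> M" for p
      using dM[OF that] \<sigma>pos[OF that] by (simp add: \<rho>_def sum_distrib_right[symmetric] \<sigma>_def[symmetric])
    show "\<rho> i x \<ge> 0" if "i < m" for i x
      unfolding \<rho>_def using \<beta>(2)[OF that, of x] dpos[of x] by simp
  qed (use cM in auto)
qed

text \<open>Local extensions are averaged with a partition of unity; at a point of M every extension
  of nonzero weight already has the right value. The compact support will bound the derivatives of F
  and so supply global Lipschitz constants for the flow.\<close>

lemma smooth_extension:
  fixes f :: "'a::euclidean_space \<Rightarrow> 'b::real_normed_vector"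
  assumes "compact M" "smooth_map_on M f"
  obtains F K where "smooth_on UNIV F" "compact K" "\<And>x. x \<notin> K \<Longrightarrow> F x = 0" "\<And>x. x \<in> M \<Longrightarrow> F x = f x"
proof -
  have "\<forall>p\<in>M. \<exists>U F. open U \<and> p \<in> U \<and> smooth_on U F \<and> (\<forall>x\<in>U \<inter> M. F x = f x)"
    using assms(2) by (simp add: smooth_map_on_def)
  then obtain U F where UF: "\<And>p. p \<in> M \<Longrightarrow> open (U p) \<and> p \<in> U p"
    "\<And>p. p \<in> M \<Longrightarrow> smooth_on (U p) (F p)" "\<And>p x. p \<in> M \<Longrightarrow> x \<in> U p \<Longrightarrow> x \<in> M \<Longrightarrow> F p x = f x"
    by (metis IntI)
  obtain m and c :: "nat \<Rightarrow> 'a" and \<rho> :: "nat \<Rightarrow> 'a \<Rightarrow> real"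
    where \<rho>: "\<And>i. i < m \<Longrightarrow> c i \<in> M" "\<And>i. i < m \<Longrightarrow> smooth_on UNIV (\<rho> i)"
      "\<And>i. i < m \<Longrightarrow> closure {x. \<rho> i x \<noteq> 0} \<subseteq> U (c i)" "\<And>i. i < m \<Longrightarrow> compact (closure {x. \<rho> i x \<noteq> 0})"
      "\<And>p. p \<in> M \<Longrightarrow> (\<Sum>i<m. \<rho> i p) = 1"
    using smooth_partition_of_unity[OF assms(1) UF(1)] by metis
  let ?G = "\<lambda>x. \<Sum>i<m. \<rho> i x *\<^sub>R F (c i) x"
  show thesis
  proof (rule that)
    show "smooth_on UNIV ?G"
    proof (rule smooth_on_sum)
      fix i assume "i \<in> {..<m}"
      then have i: "i < m" by simp
      show "smooth_on UNIV (\<lambda>x. \<rho> i x *\<^sub>R F (c i) x)"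
        by (rule smooth_on_scaleR_extend[OF \<rho>(2)[OF i] _ \<rho>(3)[OF i] UF(2)[OF \<rho>(1)[OF i]]])
          (use UF(1)[OF \<rho>(1)[OF i]] in blast)
    qed simp
    show "compact (\<Union>i<m. closure {x. \<rho> i x \<noteq> 0})"
      using \<rho>(4) by (intro compact_UN) auto
    show "?G x = 0" if "x \<notin> (\<Union>i<m. closure {x. \<rho> i x \<noteq> 0})" for x
    proof -
      have "\<rho> i x = 0" if "i < m" for i
        using \<open>x \<notin> _\<close> that closure_subset[of "{x. \<rho> i x \<noteq> 0}"] by blast
      then show ?thesis by simp
    qed
    show "?G x = f x" if "x \<in> M" for x
    proof -
      have "\<rho> i x *\<^sub>R F (c i) x = \<rho> i x *\<^sub>R f x" if "i < m" for i
      proof (cases "\<rho> i x = 0")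
        case False
        then have "x \<in> closure {x. \<rho> i x \<noteq> 0}" by (intro subsetD[OF closure_subset]) simp
        then have "x \<in> U (c i)" by (rule subsetD[OF \<rho>(3)[OF that]])
        from UF(3)[OF \<rho>(1)[OF that] this \<open>x \<in> M\<close>] show ?thesis by simp
      qed simp
      then have "?G x = (\<Sum>i<m. \<rho> i x *\<^sub>R f x)" by (intro sum.cong) auto
      also have "\<dots> = f x" using \<rho>(5)[OF that] by (metis scaleR_one scaleR_sum_left)
      finally show ?thesis .
    qed
  qed
qed

section \<open>Flows on compact submanifolds\<close>

text \<open>Nagumo's argument: if \<open>q\<close> is a point of \<open>M\<close> nearest to \<open>x t\<close>, then following a curve in \<open>M\<close>
  with velocity \<open>F q\<close> shows that the distance to \<open>M\<close> grows at most at the rate \<open>L\<close> times itself.\<close>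

lemma invariant_if_tangent_forward:
  fixes x :: "real \<Rightarrow> 'a::euclidean_space"
  assumes "closed M" and x: "\<And>t. (x has_vector_derivative F (x t)) (at t)" and "x 0 \<in> M"
    and lip: "\<And>x y. norm (F x - F y) \<le> L * norm (x - y)" and "L \<ge> 0"
    and tangent: "\<And>q. q \<in> M \<Longrightarrow> \<exists>c \<epsilon>. \<epsilon> > 0 \<and> (\<forall>s. 0 < s \<and> s < \<epsilon> \<longrightarrow> c s \<in> M) \<and> c 0 = q \<and>
      (c has_vector_derivative F q) (at (0::real))"
    and "t \<ge> 0"
  shows "x t \<in> M"
proof -
  have "M \<noteq> {}" using \<open>x 0 \<in> M\<close> by blast
  have "infdist (x t) M \<le> (infdist (x 0) M + 0 * t) * exp (L * t)"
  proof (rule dini_gronwall)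
    have "continuous_on UNIV x"
      using x by (meson continuous_at_imp_continuous_on has_vector_derivative_continuous)
    then show "continuous_on {0..t} (\<lambda>t. infdist (x t) M)"
      by (intro continuous_on_infdist) (auto intro: continuous_on_subset)
  next
    fix r \<epsilon> :: real assume "\<epsilon> > 0"
    obtain q where q: "q \<in> M" "infdist (x r) M = dist (x r) q"
      using infdist_attains_inf[OF \<open>closed M\<close> \<open>M \<noteq> {}\<close>] by metis
    obtain c \<epsilon>0 where "\<epsilon>0 > 0" and cM: "\<And>s. 0 < s \<Longrightarrow> s < \<epsilon>0 \<Longrightarrow> c s \<in> M" and "c 0 = q"
      and c: "(c has_vector_derivative F q) (at 0)"
      using tangent[OF q(1)] by blast
    have "\<epsilon> / 2 > 0" using \<open>\<epsilon> > 0\<close> by simp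
    obtain \<delta>1 where "\<delta>1 > 0" and \<delta>1: "\<And>s. 0 < s \<Longrightarrow> s < \<delta>1 \<Longrightarrow> norm (x (r + s) - x r - s *\<^sub>R F (x r)) \<le> \<epsilon> / 2 * s"
      using norm_le_tangent_step[OF x \<open>\<epsilon> / 2 > 0\<close>, of r] by blast
    obtain \<delta>2 where "\<delta>2 > 0" and \<delta>2: "\<And>s. 0 < s \<Longrightarrow> s < \<delta>2 \<Longrightarrow> norm (c s - q - s *\<^sub>R F q) \<le> \<epsilon> / 2 * s"
      using norm_le_tangent_step[OF c \<open>\<epsilon> / 2 > 0\<close>] \<open>c 0 = q\<close> by auto
    define \<delta> where "\<delta> = min \<epsilon>0 (min \<delta>1 \<delta>2)"
    have "infdist (x (r + s)) M \<le> infdist (x r) M + s * (L * infdist (x r) M + 0 + \<epsilon>)"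
      if s: "0 < s" "s < \<delta>" for s
    proof -
      have "infdist (x (r + s)) M \<le> norm (x (r + s) - c s)"
        using infdist_le[OF cM] s by (simp add: \<delta>_def dist_norm)
      \<comment> \<open>The solution is compared with the curve c through the nearest point: the
        initial gap, the gap of the velocities, and two tangent errors of at most \<epsilon> / 2 * s
        each.\<close>
      also have "x (r + s) - c s = ((x r - q) + s *\<^sub>R (F (x r) - F q)) +
          ((x (r + s) - x r - s *\<^sub>R F (x r)) - (c s - q - s *\<^sub>R F q))"
        by (simp add: algebra_simps)
      also have "norm \<dots> \<le> (norm (x r - q) + norm (s *\<^sub>R (F (x r) - F q))) +
          (norm (x (r + s) - x r - s *\<^sub>R F (x r)) + norm (c s - q - s *\<^sub>R F q))"
        by (intro norm_triangle_le add_mono norm_triangle_ineq norm_triangle_ineq4)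
      also have "\<dots> \<le> (norm (x r - q) + s * (L * norm (x r - q))) + (\<epsilon> / 2 * s + \<epsilon> / 2 * s)"
        using s lip[of "x r" q] \<delta>1[of s] \<delta>2[of s]
        by (intro add_mono) (auto simp: \<delta>_def intro: mult_left_mono)
      also have "\<dots> = infdist (x r) M + s * (L * infdist (x r) M + 0 + \<epsilon>)"
        by (simp add: q(2) dist_norm algebra_simps)
      finally show ?thesis .
    qed
    moreover have "\<delta> > 0" using \<open>\<epsilon>0 > 0\<close> \<open>\<delta>1 > 0\<close> \<open>\<delta>2 > 0\<close> by (simp add: \<delta>_def)
    ultimately show "\<exists>\<delta>>0. \<forall>s. 0 < s \<and> s < \<delta> \<longrightarrow>
        infdist (x (r + s)) M \<le> infdist (x r) M + s * (L * infdist (x r) M + 0 + \<epsilon>)" by blast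
  qed (use assms infdist_nonneg in auto)
  then have "infdist (x t) M = 0"
    using \<open>x 0 \<in> M\<close> infdist_nonneg[of "x t" M] by simp
  then show ?thesis
    using in_closed_iff_infdist_zero[OF \<open>closed M\<close> \<open>M \<noteq> {}\<close>] by blast
qed

text \<open>For negative times the solution and the curves in M are run backwards, with the field -
  F; the curves of \<open>tangent_space\<close> are defined on both sides of 0 and so survive the
  reversal.\<close>

lemma invariant_if_tangent:
  fixes x :: "real \<Rightarrow> 'a::euclidean_space"
  assumes "closed M" and x: "\<And>t. (x has_vector_derivative F (x t)) (at t)" and "x 0 \<in> M"
    and lip: "\<And>x y. norm (F x - F y) \<le> L * norm (x - y)" and "L \<ge> 0"
    and tangent: "\<And>q. q \<in> M \<Longrightarrow> F q \<in> tangent_space M q"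
  shows "x t \<in> M"
proof -
  have curve: "\<exists>c \<epsilon>. \<epsilon> > 0 \<and> (\<forall>s. - \<epsilon> < s \<and> s < \<epsilon> \<longrightarrow> c s \<in> M) \<and> c 0 = q \<and>
      (c has_vector_derivative F q) (at (0::real))" if q: "q \<in> M" for q
  proof -
    obtain c \<epsilon> where "\<epsilon> > 0" "c ` {- \<epsilon><..<\<epsilon>} \<subseteq> M" "c 0 = q" "(c has_vector_derivative F q) (at (0::real))"
      using tangent[OF q] unfolding tangent_space_def by blast
    then show ?thesis by (intro exI[of _ c] exI[of _ \<epsilon>]) auto
  qed
  show ?thesis
  proof (cases "t \<ge> 0")
    case True
    have "\<exists>c \<epsilon>. \<epsilon> > 0 \<and> (\<forall>s. 0 < s \<and> s < \<epsilon> \<longrightarrow> c s \<in> M) \<and> c 0 = q \<and>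
      (c has_vector_derivative F q) (at (0::real))" if q: "q \<in> M" for q
    proof -
      obtain c \<epsilon> where "\<epsilon> > 0" "\<forall>s. - \<epsilon> < s \<and> s < \<epsilon> \<longrightarrow> c s \<in> M" "c 0 = q"
        "(c has_vector_derivative F q) (at (0::real))"
        using curve[OF q] by blast
      then show ?thesis by (intro exI[of _ c] exI[of _ \<epsilon>]) auto
    qed
    from invariant_if_tangent_forward[OF assms(1-5) this True] show ?thesis .
  next
    case False
    have "x (- (- t)) \<in> M"
    proof (rule invariant_if_tangent_forward[where F = "\<lambda>x. - F x" and x = "\<lambda>t. x (- t)" and t = "- t"])
      show "((\<lambda>t. x (- t)) has_vector_derivative - F (x (- s))) (at s)" for s
        by (rule has_vector_derivative_reflect[OF x])
      show "norm (- F x - - F y) \<le> L * norm (x - y)" for x y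
        using lip[of y x] by (simp add: norm_minus_commute)
      fix q assume "q \<in> M"
      obtain c \<epsilon> where c: "\<epsilon> > 0" "\<forall>s. - \<epsilon> < s \<and> s < \<epsilon> \<longrightarrow> c s \<in> M" "c 0 = q"
        "(c has_vector_derivative F q) (at (0::real))"
        using curve[OF \<open>q \<in> M\<close>] by blast
      then have "((\<lambda>s. c (- s)) has_vector_derivative - F q) (at 0)"
        by (intro has_vector_derivative_reflect) simp
      then show "\<exists>c \<epsilon>. \<epsilon> > 0 \<and> (\<forall>s. 0 < s \<and> s < \<epsilon> \<longrightarrow> c s \<in> M) \<and> c 0 = q \<and>
          (c has_vector_derivative - F q) (at (0::real))"
        using c by (intro exI[of _ "\<lambda>s. c (- s)"] exI[of _ \<epsilon>]) auto
    qed (use assms False in auto)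
    then show ?thesis by simp
  qed
qed

lemma continuous_on_flow_compose:
  assumes "continuous_on UNIV (\<lambda>(t, x). \<Phi> t x)" "continuous_on UNIV f"
  shows "continuous_on UNIV (\<lambda>(t, x). f (\<Phi> t x))"
  using continuous_on_compose2[OF assms(2,1) subset_UNIV] unfolding case_prod_unfold .

text \<open>Collects what the sequel uses of the flow, with the ambient field hidden. Among the
  derivatives of H o phi_t within M, B t p is the one of the extended flow; this choice is
  continuous in (t, p) and differentiable in t, which an arbitrary choice need not be.\<close>

theorem flow_pullback:
  fixes M :: "'a::euclidean_space set" and H :: "'a \<Rightarrow> 'b::euclidean_space"
  assumes "compact M" "smooth_vector_field M Y" "smooth_on UNIV H"
  obtains B B' :: "real \<Rightarrow> 'a \<Rightarrow> 'a \<Rightarrow>\<^sub>L 'b"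
  where "\<And>p. p \<in> M \<Longrightarrow> flow M Y 0 p = p" "\<And>t p. p \<in> M \<Longrightarrow> flow M Y t p \<in> M"
    "\<And>t p. p \<in> M \<Longrightarrow> flow M Y t differentiable (at p within M)"
    "\<And>t p. p \<in> M \<Longrightarrow> ((\<lambda>x. H (flow M Y t x)) has_derivative B t p) (at p within M)"
    "\<And>t p. ((\<lambda>t. B t p) has_vector_derivative B' t p) (at t)"
    "continuous_on UNIV (\<lambda>(t, p). B t p)" "continuous_on UNIV (\<lambda>(t, p). B' t p)"
proof -
  have YM: "smooth_map_on M Y" and tangent: "\<And>p. p \<in> M \<Longrightarrow> Y p \<in> tangent_space M p"
    using assms(2) by (auto simp: smooth_vector_field_def)
  obtain F K where F: "smooth_on UNIV F" and K: "compact K" "\<And>x. x \<notin> K \<Longrightarrow> F x = 0"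
    and FY: "\<And>x. x \<in> M \<Longrightarrow> F x = Y x"
    using smooth_extension[OF \<open>compact M\<close> YM] by metis
  let ?DF = "derivative_blinfun F"
  have DF: "smooth_on UNIV ?DF" and DDF: "smooth_on UNIV (derivative_blinfun ?DF)"
    by (rule smooth_on_derivative_blinfun[OF open_UNIV] F)+
  have openK: "open (- K)" using K(1) compact_imp_closed by auto
  have DF0: "?DF x = 0" if "x \<notin> K" for x
    by (rule derivative_blinfun_eq_0[OF openK]) (use that K(2) in auto)
  have DDF0: "derivative_blinfun ?DF x = 0" if "x \<notin> K" for x
    by (rule derivative_blinfun_eq_0[OF openK]) (use that DF0 in auto)
  obtain B where B: "\<And>x. norm (F x) \<le> B" using smooth_compact_support_bounded[OF F K(1) K(2)] by blast
  obtain L0 where L0: "\<And>x. norm (?DF x) \<le> L0" using smooth_compact_support_bounded[OF DF K(1) DF0] by blast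
  obtain C where C: "\<And>x. norm (derivative_blinfun ?DF x) \<le> C"
    using smooth_compact_support_bounded[OF DDF K(1) DDF0] by blast
  define L where "L = \<bar>L0\<bar> + 1"
  have "L > 0" by (simp add: L_def)
  have L: "norm (?DF x) \<le> L" for x using L0[of x] by (simp add: L_def)
  have derF: "(F has_derivative ?DF x) (at x)" for x
    by (rule has_derivative_derivative_blinfun[OF F]) simp
  have lipDF: "norm (?DF x - ?DF y) \<le> C * norm (x - y)" for x y
    by (rule lipschitz_if_derivative_bounded[OF has_derivative_derivative_blinfun[OF DF UNIV_I] C])
  have lipF: "norm (F x - F y) \<le> L * norm (x - y)" for x y
    by (rule lipschitz_if_derivative_bounded[OF derF L])
  obtain \<Phi> W where \<Phi>0: "\<And>x. \<Phi> 0 x = x" and "\<And>x. W 0 x = id_blinfun"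
    and \<Phi>: "\<And>t x. ((\<lambda>t. \<Phi> t x) has_vector_derivative F (\<Phi> t x)) (at t)"
    and W: "\<And>t x. ((\<lambda>t. W t x) has_vector_derivative ?DF (\<Phi> t x) o\<^sub>L W t x) (at t)"
    and D\<Phi>: "\<And>t x. (\<Phi> t has_derivative W t x) (at x)"
    and cont\<Phi>: "continuous_on UNIV (\<lambda>(t, x). \<Phi> t x)" and contW: "continuous_on UNIV (\<lambda>(t, x). W t x)"
    by (rule smooth_flow_exists[OF derF L \<open>L > 0\<close> lipDF B], rule that)
  have \<Phi>M: "\<Phi> t p \<in> M" if "p \<in> M" for t p
    by (rule invariant_if_tangent[OF compact_imp_closed[OF \<open>compact M\<close>] \<Phi> _ lipF])
      (use \<Phi>0 FY that tangent \<open>L > 0\<close> in auto)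
  have flow: "flow M Y t p = \<Phi> t p" if "p \<in> M" for t p
    unfolding flow_def
  proof (rule the_equality)
    show "\<exists>c. integral_curve M Y c \<and> c 0 = p \<and> c t = \<Phi> t p"
      using \<Phi> \<Phi>M[OF that] \<Phi>0 FY by (intro exI[of _ "\<lambda>t. \<Phi> t p"]) (auto simp: integral_curve_def, metis)
    \<comment> \<open>An integral curve in M also solves the ambient equation, because F = Y on M;
      uniqueness there makes the description in \<open>flow\<close> unambiguous.\<close>
    fix q assume "\<exists>c. integral_curve M Y c \<and> c 0 = p \<and> c t = q"
    then obtain c where c: "integral_curve M Y c" "c 0 = p" "c t = q" by blast
    have "(c has_vector_derivative F (c s)) (at s)" for s
      using c(1) FY by (metis integral_curve_def)
    from ode_solution_unique[OF this \<Phi> _ lipF, of p t] show "q = \<Phi> t p"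
      using c \<Phi>0 \<open>L > 0\<close> by simp
  qed
  let ?DH = "derivative_blinfun H"
  have DH: "smooth_on UNIV ?DH" and DDH: "smooth_on UNIV (derivative_blinfun ?DH)"
    by (rule smooth_on_derivative_blinfun[OF open_UNIV] assms(3))+
  define P where "P t x = ?DH (\<Phi> t x) o\<^sub>L W t x" for t x
  \<comment> \<open>Product rule for P: the first term differentiates W by the variational equation,
    the second one differentiates DH along the trajectory.\<close>
  define P' where "P' t x = (?DH (\<Phi> t x) o\<^sub>L (?DF (\<Phi> t x) o\<^sub>L W t x)) +
    (derivative_blinfun ?DH (\<Phi> t x) (F (\<Phi> t x)) o\<^sub>L W t x)" for t x
  have HD: "((\<lambda>x. H (\<Phi> t x)) has_derivative P t x) (at x)" for t x
  proof -
    have "((\<lambda>x. H (\<Phi> t x)) has_derivative (\<lambda>v. ?DH (\<Phi> t x) (W t x v))) (at x)"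
      by (rule has_derivative_compose[OF D\<Phi> has_derivative_derivative_blinfun[OF assms(3) UNIV_I]])
    then show ?thesis by (simp add: P_def blinfun_compose.rep_eq o_def)
  qed
  have contF: "continuous_on UNIV F" "continuous_on UNIV ?DF" "continuous_on UNIV ?DH"
    "continuous_on UNIV (derivative_blinfun ?DH)"
    by (rule F DF DH DDH smooth_on_imp_continuous_on)+
  show thesis
  proof (rule that)
    show "flow M Y 0 p = p" if "p \<in> M" for p using flow[OF that] \<Phi>0 by simp
    show "flow M Y t p \<in> M" if "p \<in> M" for t p using flow[OF that] \<Phi>M[OF that] by simp
    have *: "(flow M Y t has_derivative W t p) (at p within M)" if "p \<in> M" for t p
      by (rule has_derivative_transform[OF that flow has_derivative_at_withinI[OF D\<Phi>]])
    show "flow M Y t differentiable (at p within M)" if "p \<in> M" for t p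
      using *[OF that] by (auto simp: differentiable_def)
    show "((\<lambda>x. H (flow M Y t x)) has_derivative P t p) (at p within M)" if "p \<in> M" for t p
      by (rule has_derivative_transform[OF that _ has_derivative_at_withinI[OF HD]]) (simp add: flow)
    show "((\<lambda>t. P t p) has_vector_derivative P' t p) (at t)" for t p
    proof -
      have "((?DH \<circ> (\<lambda>t. \<Phi> t p)) has_vector_derivative derivative_blinfun ?DH (\<Phi> t p) (F (\<Phi> t p))) (at t)"
        by (rule vector_derivative_diff_chain_within[OF \<Phi> has_derivative_at_withinI])
          (rule has_derivative_derivative_blinfun[OF DH UNIV_I])
      from bounded_bilinear.has_vector_derivative[OF bounded_bilinear_blinfun_compose this W]
      show ?thesis unfolding P_def P'_def o_def .
    qed
    note comps = contF[THEN continuous_on_flow_compose[OF cont\<Phi>]]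
    show "continuous_on UNIV (\<lambda>(t, p). P t p)"
      unfolding P_def using comps contW by (auto simp: case_prod_beta intro!: continuous_intros)
    show "continuous_on UNIV (\<lambda>(t, p). P' t p)"
      unfolding P'_def using comps contW by (auto simp: case_prod_beta intro!: continuous_intros)
  qed
qed

section \<open>Local parametrizations\<close>

text \<open>Near \<tau> u the increments of k are those of the identity up to a small relative
  error, so the increments of \<tau> and of k o \<tau> are comparable; continuity brings \<tau> x
  into that neighbourhood. This takes the place of an inverse function theorem.\<close>

lemma has_derivative_if_has_derivative_compose_id:
  fixes \<tau> :: "'a::real_normed_vector \<Rightarrow> 'b::real_normed_vector"
  assumes k: "(k has_derivative (\<lambda>v. v)) (at (\<tau> u))" and "isCont \<tau> u"
    and D: "((\<lambda>x. k (\<tau> x)) has_derivative D) (at u)"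
  shows "(\<tau> has_derivative D) (at u)"
  unfolding has_derivative_at_alt
proof (intro conjI allI impI)
  show bl: "bounded_linear D" using D has_derivative_bounded_linear by blast
  obtain C where "C > 0" and C: "\<And>v. norm (D v) \<le> norm v * C"
    using bounded_linear.pos_bounded[OF bl] by blast
  fix e :: real assume "e > 0"
  \<comment> \<open>The bound 1 / 2 lets the error be absorbed, which gives norm (\<tau> x - \<tau>
    u) \<le> 2 * (C + 1) * norm (x - u); the other bound makes \<eta> * (2 * (C + 1)) at most half
    of e. The summand 1 in C + 1 pays for e' \<le> 1.\<close>
  define \<eta> where "\<eta> = min (1 / 2) (e / (4 * (C + 1)))"
  have "\<eta> \<le> e / (4 * (C + 1))" by (simp add: \<eta>_def)
  then have "\<eta> * (4 * (C + 1)) \<le> e"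
    using \<open>C > 0\<close> by (simp add: pos_le_divide_eq)
  then have "\<eta> * (2 * (C + 1)) \<le> e / 2" by (simp add: algebra_simps)
  moreover have "\<eta> > 0" "\<eta> \<le> 1 / 2"
    unfolding \<eta>_def using \<open>e > 0\<close> \<open>C > 0\<close> by (simp_all only: min_less_iff_conj min.cobounded1) auto
  ultimately have \<eta>: "\<eta> > 0" "\<eta> \<le> 1 / 2" "\<eta> * (2 * (C + 1)) \<le> e / 2" by auto
  obtain d1 where "d1 > 0" and d1: "\<And>y. norm (y - \<tau> u) < d1 \<Longrightarrow> norm (k y - k (\<tau> u) - (y - \<tau> u)) \<le> \<eta> * norm (y - \<tau> u)"
    using k \<eta>(1) unfolding has_derivative_at_alt by blast
  obtain d2 where "d2 > 0" and d2: "\<And>x. norm (x - u) < d2 \<Longrightarrow> norm (\<tau> x - \<tau> u) < d1"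
    using \<open>isCont \<tau> u\<close> \<open>d1 > 0\<close> unfolding continuous_at_eps_delta dist_norm by blast
  define e' where "e' = min 1 (e / 2)"
  have e': "e' > 0" "e' \<le> 1" "e' \<le> e / 2" using \<open>e > 0\<close> by (auto simp: e'_def)
  obtain d3 where "d3 > 0" and d3: "\<And>x. norm (x - u) < d3 \<Longrightarrow> norm (k (\<tau> x) - k (\<tau> u) - D (x - u)) \<le> e' * norm (x - u)"
    using D e'(1) unfolding has_derivative_at_alt by blast
  have "norm (\<tau> x - \<tau> u - D (x - u)) \<le> e * norm (x - u)" if x: "norm (x - u) < min d2 d3" for x
  proof -
    let ?y = "\<tau> x - \<tau> u" and ?z = "k (\<tau> x) - k (\<tau> u)"
    have 1: "norm (?z - ?y) \<le> \<eta> * norm ?y" using d1 d2 x by simp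
    have 2: "norm (?z - D (x - u)) \<le> e' * norm (x - u)" using d3 x by simp
    have "norm ?y \<le> norm ?z + norm (?z - ?y)"
      by (metis norm_minus_commute norm_triangle_sub)
    also have "\<dots> \<le> norm ?z + 1 / 2 * norm ?y"
      using 1 mult_right_mono[OF \<eta>(2) norm_ge_zero[of ?y]] by linarith
    finally have "norm ?y \<le> 2 * norm ?z" by simp
    moreover have "norm ?z \<le> norm (D (x - u)) + norm (?z - D (x - u))"
      by (metis norm_triangle_sub)
    moreover have "e' * norm (x - u) \<le> 1 * norm (x - u)"
      using e'(2) by (intro mult_right_mono) auto
    ultimately have 3: "norm ?y \<le> 2 * (C + 1) * norm (x - u)"
      using 2 C[of "x - u"] by (simp add: algebra_simps)
    have "norm (?y - D (x - u)) \<le> norm (?z - D (x - u)) + norm (?z - ?y)"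
    proof -
      have "?y - D (x - u) = (?z - D (x - u)) - (?z - ?y)" by simp
      then show ?thesis by (metis norm_triangle_ineq4)
    qed
    also have "\<dots> \<le> e / 2 * norm (x - u) + \<eta> * (2 * (C + 1) * norm (x - u))"
      using 1 2 mult_right_mono[OF e'(3) norm_ge_zero[of "x - u"]] mult_left_mono[OF 3 less_imp_le[OF \<eta>(1)]]
      by linarith
    also have "\<dots> \<le> e / 2 * norm (x - u) + e / 2 * norm (x - u)"
      using mult_right_mono[OF \<eta>(3) norm_ge_zero[of "x - u"]] by (simp add: mult.assoc)
    finally show ?thesis by simp
  qed
  then show "\<exists>d>0. \<forall>x. norm (x - u) < d \<longrightarrow> norm (\<tau> x - \<tau> u - D (x - u)) \<le> e * norm (x - u)"
    using \<open>d2 > 0\<close> \<open>d3 > 0\<close> by (intro exI[of _ "min d2 d3"]) auto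
qed

section \<open>Elementary facts about parametrizations\<close>

lemma parametrization_has_derivative:
  assumes "local_parametrization M V \<psi>" "u \<in> V"
  shows "(\<psi> has_derivative frechet_derivative \<psi> (at u)) (at u)"
proof -
  have "higher_differentiable_on (Suc 0) V \<psi>"
    using assms(1) unfolding local_parametrization_def smooth_on_def by blast
  then show ?thesis using assms(2) by (simp add: frechet_derivative_works)
qed

lemma parametrization_linear:
  "local_parametrization M V \<psi> \<Longrightarrow> u \<in> V \<Longrightarrow> linear (frechet_derivative \<psi> (at u))"
  using parametrization_has_derivative has_derivative_linear by blast

lemma parametrization_inj:
  "local_parametrization M V \<psi> \<Longrightarrow> u \<in> V \<Longrightarrow> inj (frechet_derivative \<psi> (at u))"
  by (auto simp: local_parametrization_def)

lemma parametrization_inj_on: "local_parametrization M V \<psi> \<Longrightarrow> inj_on \<psi> V"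
  unfolding local_parametrization_def homeomorphism_def by (metis inj_on_inverseI)

lemma parametrization_continuous: "local_parametrization M V \<psi> \<Longrightarrow> continuous_on V \<psi>"
  unfolding local_parametrization_def homeomorphism_def by blast

lemma parametrization_open: "local_parametrization M V \<psi> \<Longrightarrow> open V"
  by (simp add: local_parametrization_def)

lemma parametrization_image_subset: "local_parametrization M V \<psi> \<Longrightarrow> \<psi> ` V \<subseteq> M"
  unfolding local_parametrization_def by (meson openin_imp_subset)

lemma parametrization_image_open:
  assumes "local_parametrization M V \<psi>"
  obtains T where "open T" "\<psi> ` V = M \<inter> T"
  using assms unfolding local_parametrization_def openin_open by blast

lemma parametrization_inverse_continuous:
  assumes "local_parametrization M V \<psi>"
  shows "continuous_on (\<psi> ` V) (inv_into V \<psi>)"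
proof -
  obtain \<theta> where \<theta>: "homeomorphism V (\<psi> ` V) \<psi> \<theta>"
    using assms unfolding local_parametrization_def by blast
  have "inv_into V \<psi> p = \<theta> p" if "p \<in> \<psi> ` V" for p
    using that \<theta> parametrization_inj_on[OF assms] by (auto simp: homeomorphism_def)
  then show ?thesis
    using \<theta> continuous_on_cong unfolding homeomorphism_def by metis
qed

lemma parametrization_preimage_open:
  assumes "local_parametrization M V \<psi>" "local_parametrization M V' \<psi>'"
  shows "open (V \<inter> \<psi> -` (\<psi>' ` V'))"
proof -
  obtain T where T: "open T" "\<psi>' ` V' = M \<inter> T"
    using parametrization_image_open[OF assms(2)] .
  then have "V \<inter> \<psi> -` (\<psi>' ` V') = V \<inter> \<psi> -` T"
    using parametrization_image_subset[OF assms(1)] by auto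
  then show ?thesis
    using continuous_open_preimage[OF parametrization_continuous parametrization_open T(1)] assms(1) by metis
qed

text \<open>The transition map is differentiable because it is continuous and becomes differentiable after
  composition with a left inverse of the derivative of \<open>\<psi>'\<close> and \<open>\<psi>'\<close> itself.\<close>

lemma transition_has_derivative:
  assumes lp: "local_parametrization M V \<psi>" "local_parametrization M V' \<psi>'"
    and u: "u \<in> V" "u' \<in> V'" "\<psi> u = \<psi>' u'"
  defines "\<tau> \<equiv> inv_into V' \<psi>' \<circ> \<psi>"
  shows "\<tau> u = u'" "(\<tau> has_derivative frechet_derivative \<tau> (at u)) (at u)"
    "frechet_derivative \<psi> (at u) v = frechet_derivative \<psi>' (at u') (frechet_derivative \<tau> (at u) v)"
proof -
  let ?S = "V \<inter> \<psi> -` (\<psi>' ` V')"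
  note S = parametrization_preimage_open[OF lp]
  have uS: "u \<in> ?S" using u by auto
  show \<tau>u: "\<tau> u = u'"
    using u parametrization_inj_on[OF lp(2)] by (simp add: \<tau>_def)
  have \<psi>\<tau>: "\<psi>' (\<tau> x) = \<psi> x" if "x \<in> ?S" for x
    using that by (simp add: \<tau>_def f_inv_into_f)
  have "continuous_on ?S \<tau>"
    unfolding \<tau>_def
    by (intro continuous_on_compose continuous_on_subset[OF parametrization_continuous[OF lp(1)]]
        continuous_on_subset[OF parametrization_inverse_continuous[OF lp(2)]]) auto
  then have cont: "isCont \<tau> u"
    using S uS by (simp add: continuous_on_eq_continuous_at)
  note D' = parametrization_has_derivative[OF lp(2) u(2)] and D = parametrization_has_derivative[OF lp(1) u(1)]
  obtain L where L: "linear L" "L \<circ> frechet_derivative \<psi>' (at u') = id"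
    using linear_injective_left_inverse[OF parametrization_linear[OF lp(2) u(2)] parametrization_inj[OF lp(2) u(2)]]
    by blast
  then have blL: "bounded_linear L" by (simp add: linear_conv_bounded_linear)
  have "((\<lambda>y. L (\<psi>' y)) has_derivative (\<lambda>v. v)) (at (\<tau> u))"
    using bounded_linear.has_derivative[OF blL D'] L(2) by (simp add: \<tau>u o_def fun_eq_iff)
  moreover have "((\<lambda>x. L (\<psi>' (\<tau> x))) has_derivative (\<lambda>v. L (frechet_derivative \<psi> (at u) v))) (at u)"
    by (rule has_derivative_transform_within_open[OF bounded_linear.has_derivative[OF blL D] S uS])
      (simp add: \<psi>\<tau>)
  ultimately have "(\<tau> has_derivative (\<lambda>v. L (frechet_derivative \<psi> (at u) v))) (at u)"
    using cont has_derivative_if_has_derivative_compose_id[of "\<lambda>y. L (\<psi>' y)" \<tau>] by blast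
  then show D\<tau>: "(\<tau> has_derivative frechet_derivative \<tau> (at u)) (at u)"
    by (metis frechet_derivative_at)
  have "((\<lambda>x. \<psi>' (\<tau> x)) has_derivative (\<lambda>v. frechet_derivative \<psi>' (at u') (frechet_derivative \<tau> (at u) v))) (at u)"
    using has_derivative_compose[OF D\<tau>] D' \<tau>u by metis
  then have "(\<psi> has_derivative (\<lambda>v. frechet_derivative \<psi>' (at u') (frechet_derivative \<tau> (at u) v))) (at u)"
    by (rule has_derivative_transform_within_open[OF _ S uS]) (rule \<psi>\<tau>)
  from has_derivative_unique[OF D this]
  show "frechet_derivative \<psi> (at u) v = frechet_derivative \<psi>' (at u') (frechet_derivative \<tau> (at u) v)"
    by metis
qed

text \<open>M need not be open, so derivatives within M need not be unique as linear maps. Composed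
  with \<psi> they become derivatives at a point of the open set V, which are unique.\<close>

lemma derivative_within_unique_on_tangent:
  assumes lp: "local_parametrization M V \<psi>" "u \<in> V"
    and "(F has_derivative D1) (at (\<psi> u) within M)" "(F has_derivative D2) (at (\<psi> u) within M)"
  shows "D1 (coord_vector \<psi> u i) = D2 (coord_vector \<psi> u i)"
proof -
  have *: "((F \<circ> \<psi>) has_derivative (D \<circ> frechet_derivative \<psi> (at u))) (at u)"
    if "(F has_derivative D) (at (\<psi> u) within M)" for D
  proof -
    have "(\<psi> has_derivative frechet_derivative \<psi> (at u)) (at u within V)"
      using parametrization_has_derivative[OF lp] by (rule has_derivative_at_withinI)
    then have "((F \<circ> \<psi>) has_derivative (D \<circ> frechet_derivative \<psi> (at u))) (at u within V)"
      using has_derivative_subset[OF that parametrization_image_subset[OF lp(1)]] by (rule diff_chain_within)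
    then show ?thesis using at_within_open[OF lp(2) parametrization_open[OF lp(1)]] by simp
  qed
  from has_derivative_unique[OF *[OF assms(3)] *[OF assms(4)]] show ?thesis
    unfolding coord_vector_def by (metis comp_apply)
qed

lemma frechet_derivative_coord_vector:
  assumes "local_parametrization M V \<psi>" "u \<in> V"
  shows "frechet_derivative \<psi> (at u) c = (\<Sum>i\<in>UNIV. c $ i *\<^sub>R coord_vector \<psi> u i)"
proof -
  note lin = parametrization_linear[OF assms]
  have "frechet_derivative \<psi> (at u) c = frechet_derivative \<psi> (at u) (\<Sum>i\<in>UNIV. c $ i *\<^sub>R axis i 1)"
    by (simp add: basis_expansion scalar_mult_eq_scaleR[symmetric])
  then show ?thesis by (simp add: linear_sum[OF lin] linear_cmul[OF lin] coord_vector_def)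
qed

section \<open>The metric in coordinates\<close>

abbreviation gram :: "(real ^ 'n::finite \<Rightarrow> 'a::euclidean_space) \<Rightarrow> real ^ 'n \<Rightarrow> real ^ 'n ^ 'n" where
  "gram \<equiv> tensor_coeffs induced_metric"

definition volume_density :: "(real ^ 'n::finite \<Rightarrow> 'a::euclidean_space) \<Rightarrow> real ^ 'n \<Rightarrow> real" where
  "volume_density \<psi> u = sqrt (det (gram \<psi> u))"

lemma gram_nth: "gram \<psi> u $ i $ j = coord_vector \<psi> u i \<bullet> coord_vector \<psi> u j"
  by (simp add: tensor_coeffs_def induced_metric_def)

lemma transition_coord_vector:
  assumes lp: "local_parametrization M V \<psi>" "local_parametrization M V' \<psi>'"
    and u: "u \<in> V" "u' \<in> V'" "\<psi> u = \<psi>' u'"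
  shows "coord_vector \<psi> u i =
    (\<Sum>k\<in>UNIV. matrix (frechet_derivative (inv_into V' \<psi>' \<circ> \<psi>) (at u)) $ k $ i *\<^sub>R coord_vector \<psi>' u' k)"
proof -
  have "coord_vector \<psi> u i =
      frechet_derivative \<psi>' (at u') (frechet_derivative (inv_into V' \<psi>' \<circ> \<psi>) (at u) (axis i 1))"
    unfolding coord_vector_def by (rule transition_has_derivative(3)[OF assms])
  then show ?thesis
    by (simp add: frechet_derivative_coord_vector[OF lp(2) u(2)] matrix_def)
qed

text \<open>The Gram matrix changes by congruence with the Jacobian matrix, its determinant
  therefore by the square of the Jacobian determinant.\<close>

lemma volume_density_transition:
  assumes lp: "local_parametrization M V \<psi>" "local_parametrization M V' \<psi>'"
    and u: "u \<in> V" "u' \<in> V'" "\<psi> u = \<psi>' u'"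
  shows "volume_density \<psi> u =
    \<bar>det (matrix (frechet_derivative (inv_into V' \<psi>' \<circ> \<psi>) (at u)))\<bar> * volume_density \<psi>' u'"
proof -
  let ?J = "matrix (frechet_derivative (inv_into V' \<psi>' \<circ> \<psi>) (at u))"
  have "gram \<psi> u $ i $ j = (transpose ?J ** (gram \<psi>' u' ** ?J)) $ i $ j" for i j
    unfolding gram_nth transition_coord_vector[OF assms]
    by (simp add: inner_sum_left inner_sum_right matrix_matrix_mult_def transpose_def gram_nth
        sum_distrib_left mult_ac, subst sum.swap, simp add: mult_ac inner_commute)
  then have "gram \<psi> u = transpose ?J ** (gram \<psi>' u' ** ?J)"
    by (simp add: vec_eq_iff)
  then have "det (gram \<psi> u) = (det ?J)\<^sup>2 * det (gram \<psi>' u')"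
    by (simp add: det_mul det_transpose power2_eq_square)
  then show ?thesis
    by (simp add: volume_density_def real_sqrt_mult)
qed

text \<open>The quadratic form of the Gram matrix is the squared norm of the image under the
  derivative of \<psi>, which is injective.\<close>

lemma invertible_gram:
  assumes "local_parametrization M V \<psi>" "u \<in> V"
  shows "invertible (gram \<psi> u)"
proof -
  have "x = 0" if "gram \<psi> u *v x = 0" for x
  proof -
    let ?y = "frechet_derivative \<psi> (at u) x"
    have "?y \<bullet> ?y = (\<Sum>i\<in>UNIV. x $ i * (gram \<psi> u *v x) $ i)"
      by (simp add: frechet_derivative_coord_vector[OF assms] inner_sum_left inner_sum_right
          matrix_vector_mult_def gram_nth sum_distrib_left mult_ac inner_commute)
    then have "?y = 0" using that by simp
    then show "x = 0"
      using parametrization_inj[OF assms] parametrization_linear[OF assms] by (metis injD linear_0)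
  qed
  then show ?thesis
    by (metis invertible_left_inverse matrix_left_invertible_ker)
qed

lemma invertible_matrix_inv:
  assumes "invertible A"
  shows "A ** matrix_inv A = mat 1" "matrix_inv A ** A = mat 1"
  using someI_ex[OF assms[unfolded invertible_def]] unfolding matrix_inv_def by auto

lemma gram_inverse:
  assumes "local_parametrization M V \<psi>" "u \<in> V"
  defines "ginv \<equiv> matrix_inv (gram \<psi> u)"
  shows "(\<Sum>k\<in>UNIV. gram \<psi> u $ i $ k * ginv $ k $ j) = (if i = j then 1 else 0)"
    and "ginv $ i $ j = ginv $ j $ i"
proof -
  note inv = invertible_gram[OF assms(1,2)]
  have r: "gram \<psi> u ** ginv = mat 1" and l: "ginv ** gram \<psi> u = mat 1"
    unfolding ginv_def by (rule invertible_matrix_inv[OF inv])+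
  have "(gram \<psi> u ** ginv) $ i $ j = (mat 1 :: real ^ _ ^ _) $ i $ j" using r by simp
  then show "(\<Sum>k\<in>UNIV. gram \<psi> u $ i $ k * ginv $ k $ j) = (if i = j then 1 else 0)"
    by (simp add: matrix_matrix_mult_def mat_def)
  have sym: "transpose (gram \<psi> u) = gram \<psi> u"
    by (simp add: vec_eq_iff transpose_def gram_nth inner_commute)
  have "transpose ginv ** gram \<psi> u = mat 1"
    using arg_cong[OF r, of transpose] by (simp add: matrix_transpose_mul sym transpose_mat)
  then have "transpose ginv ** gram \<psi> u ** ginv = ginv" by simp
  then have "transpose ginv = ginv" by (simp add: matrix_mul_assoc[symmetric] r)
  from arg_cong[OF this, of "\<lambda>X. X $ j $ i"] show "ginv $ i $ j = ginv $ j $ i"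
    by (simp add: transpose_def)
qed

section \<open>Orthogonal projection to the tangent space\<close>

text \<open>Coefficients of the orthogonal projection of x to the span of the coordinate vectors:
  the solution of the normal equations.\<close>

definition chart_components :: "(real ^ 'n::finite \<Rightarrow> 'a::euclidean_space) \<Rightarrow> real ^ 'n \<Rightarrow> 'a \<Rightarrow> 'n \<Rightarrow> real" where
  "chart_components \<psi> u x i = (\<Sum>j\<in>UNIV. matrix_inv (gram \<psi> u) $ i $ j * (coord_vector \<psi> u j \<bullet> x))"

definition chart_projection :: "(real ^ 'n::finite \<Rightarrow> 'a::euclidean_space) \<Rightarrow> real ^ 'n \<Rightarrow> 'a \<Rightarrow> 'a" where
  "chart_projection \<psi> u x = (\<Sum>i\<in>UNIV. chart_components \<psi> u x i *\<^sub>R coord_vector \<psi> u i)"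

lemma chart_projection_orthogonal:
  assumes "local_parametrization M V \<psi>" "u \<in> V"
  shows "coord_vector \<psi> u k \<bullet> chart_projection \<psi> u x = coord_vector \<psi> u k \<bullet> x"
proof -
  have "coord_vector \<psi> u k \<bullet> chart_projection \<psi> u x =
      (\<Sum>i\<in>UNIV. \<Sum>j\<in>UNIV. gram \<psi> u $ k $ i * matrix_inv (gram \<psi> u) $ i $ j * (coord_vector \<psi> u j \<bullet> x))"
    by (simp add: chart_projection_def chart_components_def inner_sum_right gram_nth sum_distrib_left mult_ac)
  also have "\<dots> = (\<Sum>j\<in>UNIV. (\<Sum>i\<in>UNIV. gram \<psi> u $ k $ i * matrix_inv (gram \<psi> u) $ i $ j) * (coord_vector \<psi> u j \<bullet> x))"
    by (subst sum.swap) (simp add: sum_distrib_right)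
  also have "\<dots> = coord_vector \<psi> u k \<bullet> x"
    unfolding gram_inverse(1)[OF assms] by (simp add: if_distrib[where f = "\<lambda>c. c * _"] cong: if_cong)
  finally show ?thesis .
qed

text \<open>The difference of the projections is orthogonal to both families of coordinate vectors,
  as each family is a combination of the other. Both projections lie in these spans, so the
  difference is orthogonal to itself.\<close>

lemma chart_projection_transition:
  fixes \<psi> \<psi>' :: "real ^ 'n::finite \<Rightarrow> 'a::euclidean_space"
  assumes lp: "local_parametrization M V \<psi>" "local_parametrization M V' \<psi>'"
    and u: "u \<in> V" "u' \<in> V'" "\<psi> u = \<psi>' u'"
  shows "chart_projection \<psi> u x = chart_projection \<psi>' u' x"
proof -
  let ?J = "matrix (frechet_derivative (inv_into V' \<psi>' \<circ> \<psi>) (at u))"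
    and ?J' = "matrix (frechet_derivative (inv_into V \<psi> \<circ> \<psi>') (at u'))"
  let ?d = "chart_projection \<psi> u x - chart_projection \<psi>' u' x"
  note coord = transition_coord_vector[OF lp u]
    and coord' = transition_coord_vector[OF lp(2,1) u(2,1) u(3)[symmetric]]
  have "coord_vector \<psi> u k \<bullet> chart_projection \<psi>' u' x = coord_vector \<psi> u k \<bullet> x" for k
    unfolding coord by (simp add: inner_sum_left chart_projection_orthogonal[OF lp(2) u(2)])
  then have d: "coord_vector \<psi> u k \<bullet> ?d = 0" for k
    by (simp add: inner_diff_right chart_projection_orthogonal[OF lp(1) u(1)])
  then have d': "coord_vector \<psi>' u' k \<bullet> ?d = 0" for k
    unfolding coord' inner_sum_left by simp
  have orth: "chart_projection \<theta> v x \<bullet> w = 0" if "\<And>k. coord_vector \<theta> v k \<bullet> w = 0"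
    for \<theta> and v :: "real ^ 'n" and w :: 'a
    by (simp add: chart_projection_def inner_sum_left that)
  have "chart_projection \<psi> u x \<bullet> ?d = 0" using d by (rule orth)
  moreover have "chart_projection \<psi>' u' x \<bullet> ?d = 0" using d' by (rule orth)
  ultimately have "?d \<bullet> ?d = 0" by (simp only: inner_diff_left)
  then show ?thesis by simp
qed

text \<open>Parseval turns the sum over the ambient basis into the Gram matrix g, and g^-1 g g^-1 =
  g^-1.\<close>

lemma sum_chart_components:
  assumes "local_parametrization M V \<psi>" "u \<in> V"
  shows "(\<Sum>a\<in>Basis. chart_components \<psi> u a i * chart_components \<psi> u a k) = matrix_inv (gram \<psi> u) $ i $ k"
proof -
  let ?h = "matrix_inv (gram \<psi> u)" and ?e = "coord_vector \<psi> u"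
  have "(\<Sum>a\<in>Basis. chart_components \<psi> u a i * chart_components \<psi> u a k) =
      (\<Sum>a\<in>Basis. \<Sum>p\<in>UNIV. \<Sum>q\<in>UNIV. ?h $ i $ p * ?h $ k $ q * ((?e p \<bullet> a) * (?e q \<bullet> a)))"
    by (simp add: chart_components_def sum_product mult_ac)
  also have "\<dots> = (\<Sum>p\<in>UNIV. \<Sum>q\<in>UNIV. \<Sum>a\<in>Basis. ?h $ i $ p * ?h $ k $ q * ((?e p \<bullet> a) * (?e q \<bullet> a)))"
    by (subst sum.swap, rule sum.cong[OF refl], rule sum.swap)
  also have "\<dots> = (\<Sum>p\<in>UNIV. \<Sum>q\<in>UNIV. ?h $ i $ p * ?h $ k $ q * gram \<psi> u $ p $ q)"
    by (simp add: sum_distrib_left[symmetric] euclidean_inner[of "?e _", symmetric] gram_nth)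
  also have "\<dots> = (\<Sum>p\<in>UNIV. ?h $ i $ p * (\<Sum>q\<in>UNIV. gram \<psi> u $ p $ q * ?h $ q $ k))"
    by (simp add: sum_distrib_left gram_inverse(2)[OF assms, of k] mult_ac)
  also have "\<dots> = ?h $ i $ k"
    unfolding gram_inverse(1)[OF assms] by (simp add: if_distrib cong: if_cong)
  finally show ?thesis .
qed

text \<open>Since \<open>\<Sum>a\<in>Basis. c\<^sub>i a * c\<^sub>k a\<close> is the entry \<open>g\<^sup>i\<^sup>k\<close> of the inverse matrix, the contraction with
  \<open>g\<^sup>i\<^sup>k g\<^sup>j\<^sup>l\<close> is a sum over the projections of an orthonormal basis of the ambient space.\<close>

lemma tensor_metric_coords_eq_projection:
  assumes lp: "local_parametrization M V \<psi>" "u \<in> V"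
    and "bilinear \<sigma>" "bilinear \<tau>"
    and S: "\<And>i j. S (\<psi> u) (coord_vector \<psi> u i) (coord_vector \<psi> u j) = \<sigma> (coord_vector \<psi> u i) (coord_vector \<psi> u j)"
    and T: "\<And>i j. T (\<psi> u) (coord_vector \<psi> u i) (coord_vector \<psi> u j) = \<tau> (coord_vector \<psi> u i) (coord_vector \<psi> u j)"
  defines "P \<equiv> chart_projection \<psi> u"
  shows "tensor_metric_coords S T \<psi> u = (\<Sum>a\<in>Basis. \<Sum>b\<in>Basis. \<sigma> (P a) (P b) * \<tau> (P a) (P b))"
proof -
  let ?h = "matrix_inv (gram \<psi> u)" and ?e = "coord_vector \<psi> u" and ?c = "chart_components \<psi> u"
  let ?B = "Basis \<times> Basis :: ('a \<times> 'a) set"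
  \<comment> \<open>Indices are grouped in pairs, q = (i, j) of coordinates and x = (a, b) of
    ambient basis vectors, so that the contraction becomes a double sum over q and q' with the
    kernel computed in \<open>CC\<close>.\<close>
  define C where "C q x = ?c (fst x) (fst q) * ?c (snd x) (snd q)" for q :: "'b \<times> 'b" and x :: "'a \<times> 'a"
  define \<alpha> where "\<alpha> q = \<sigma> (?e (fst q)) (?e (snd q))" for q
  define \<beta> where "\<beta> q = \<tau> (?e (fst q)) (?e (snd q))" for q
  have expand: "\<phi> (P a) (P b) = (\<Sum>q\<in>UNIV. C q (a, b) * \<phi> (?e (fst q)) (?e (snd q)))"
    if "bilinear \<phi>" for \<phi> :: "'a \<Rightarrow> 'a \<Rightarrow> real" and a b
    unfolding P_def chart_projection_def C_def bilinear_sum[OF that]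
    by (simp add: bilinear_lmul[OF that] bilinear_rmul[OF that] case_prod_beta mult_ac)
  have CC: "(\<Sum>x\<in>?B. C q x * C q' x) = ?h $ fst q $ fst q' * ?h $ snd q $ snd q'" for q q'
  proof -
    have "(\<Sum>x\<in>?B. C q x * C q' x) = (\<Sum>a\<in>Basis. \<Sum>b\<in>Basis.
        (?c a (fst q) * ?c a (fst q')) * (?c b (snd q) * ?c b (snd q')))"
      by (simp add: sum.cartesian_product[symmetric] C_def mult_ac case_prod_beta)
        (simp add: sum.cartesian_product case_prod_beta mult_ac)
    then show ?thesis
      by (simp add: sum_product[symmetric] sum_chart_components[OF lp])
  qed
  have "(\<Sum>a\<in>Basis. \<Sum>b\<in>Basis. \<sigma> (P a) (P b) * \<tau> (P a) (P b)) =
      (\<Sum>x\<in>?B. (\<Sum>q\<in>UNIV. C q x * \<alpha> q) * (\<Sum>q\<in>UNIV. C q x * \<beta> q))"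
    unfolding expand[OF assms(3)] expand[OF assms(4)] \<alpha>_def \<beta>_def
    by (simp add: sum.cartesian_product case_prod_beta)
  also have "\<dots> = (\<Sum>x\<in>?B. \<Sum>q\<in>UNIV. \<Sum>q'\<in>UNIV. \<alpha> q * \<beta> q' * (C q x * C q' x))"
    by (simp add: sum_product mult_ac)
  also have "\<dots> = (\<Sum>q\<in>UNIV. \<Sum>q'\<in>UNIV. \<Sum>x\<in>?B. \<alpha> q * \<beta> q' * (C q x * C q' x))"
    by (subst sum.swap, rule sum.cong[OF refl], rule sum.swap)
  also have "\<dots> = (\<Sum>q\<in>UNIV. \<Sum>q'\<in>UNIV. \<alpha> q * \<beta> q' * ?h $ fst q $ fst q' * ?h $ snd q $ snd q')"
    by (simp add: sum_distrib_left[symmetric] CC mult_ac)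
  also have "\<dots> = (\<Sum>i\<in>UNIV. \<Sum>j\<in>UNIV. \<Sum>k\<in>UNIV. \<Sum>l\<in>UNIV. \<alpha> (i, j) * \<beta> (k, l) * ?h $ i $ k * ?h $ j $ l)"
  proof -
    have "(\<Sum>q\<in>UNIV. f q) = (\<Sum>i\<in>UNIV. \<Sum>j\<in>UNIV. f (i, j))" for f :: "'b \<times> 'b \<Rightarrow> real"
      by (simp add: sum.cartesian_product)
    then show ?thesis by (simp only: fst_conv snd_conv)
  qed
  also have "\<dots> = tensor_metric_coords S T \<psi> u"
    by (simp add: tensor_metric_coords_def Let_def S T \<alpha>_def \<beta>_def tensor_coeffs_def[of S] tensor_coeffs_def[of T])
  finally show ?thesis by simp
qed

subsection \<open>Continuity\<close>

lemma continuous_on_det: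
  fixes A :: "'a::topological_space \<Rightarrow> real ^ 'n::finite ^ 'n"
  assumes "\<And>i j. continuous_on S (\<lambda>x. A x $ i $ j)"
  shows "continuous_on S (\<lambda>x. det (A x))"
  unfolding det_def by (intro continuous_intros assms)

text \<open>Cramer's rule; as a quotient of determinants the entry is visibly continuous in
  A.\<close>

lemma matrix_inv_nth:
  fixes A :: "real ^ 'n::finite ^ 'n"
  assumes "invertible A"
  shows "matrix_inv A $ i $ j = det (\<chi> k l. if l = i then axis j 1 $ k else A $ k $ l) / det A"
proof -
  have "det A \<noteq> 0" using assms by (simp add: invertible_det_nz)
  have "A *v (matrix_inv A *v axis j 1) = axis j 1"
    by (simp add: matrix_vector_mul_assoc invertible_matrix_inv(1)[OF assms])
  then have "matrix_inv A *v axis j 1 = (\<chi> i. det (\<chi> k l. if l = i then axis j 1 $ k else A $ k $ l) / det A)"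
    using cramer[OF \<open>det A \<noteq> 0\<close>] by blast
  then have "(matrix_inv A *v axis j 1) $ i = det (\<chi> k l. if l = i then axis j 1 $ k else A $ k $ l) / det A"
    by simp
  then show ?thesis by (simp add: matrix_vector_mul_component inner_axis row_def)
qed

lemma continuous_on_coord_vector:
  assumes "local_parametrization M V \<psi>"
  shows "continuous_on V (\<lambda>u. coord_vector \<psi> u i)"
proof -
  have "higher_differentiable_on (Suc 0) V \<psi>"
    using assms(1) unfolding local_parametrization_def smooth_on_def by blast
  then show ?thesis by (simp add: coord_vector_def)
qed

lemma continuous_on_volume_density:
  assumes "local_parametrization M V \<psi>"
  shows "continuous_on V (volume_density \<psi>)"
  unfolding volume_density_def
  by (intro continuous_on_real_sqrt continuous_on_det)
    (simp add: gram_nth, intro continuous_intros continuous_on_coord_vector[OF assms])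

lemma continuous_on_chart_projection:
  assumes lp: "local_parametrization M V \<psi>"
  shows "continuous_on V (\<lambda>u. chart_projection \<psi> u x)"
proof -
  have gram: "continuous_on V (\<lambda>u. gram \<psi> u $ i $ j)" for i j
    unfolding gram_nth by (intro continuous_intros continuous_on_coord_vector[OF lp])
  have inv: "continuous_on V (\<lambda>u. matrix_inv (gram \<psi> u) $ i $ j)" for i j
  proof -
    have "continuous_on V (\<lambda>u. det (\<chi> k l. if l = i then axis j 1 $ k else gram \<psi> u $ k $ l) / det (gram \<psi> u))"
    proof (intro continuous_on_divide continuous_on_det gram ballI)
      show "det (gram \<psi> u) \<noteq> 0" if "u \<in> V" for u
        using invertible_gram[OF lp that] by (simp add: invertible_det_nz)
      show "continuous_on V (\<lambda>u. (\<chi> k l. if l = i then axis j 1 $ k else gram \<psi> u $ k $ l) $ p $ q)" for p q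
        by (cases "q = i") (auto intro: gram)
    qed
    then show ?thesis
      by (rule continuous_on_eq) (simp add: matrix_inv_nth[OF invertible_gram[OF lp]])
  qed
  show ?thesis
    unfolding chart_projection_def chart_components_def
    by (intro continuous_on_sum continuous_on_scaleR continuous_on_mult continuous_on_inner continuous_on_const
        inv continuous_on_coord_vector[OF lp])
qed

section \<open>Integration on compact oriented manifolds\<close>

lemma smooth_map_on_imp_continuous_on:
  assumes "smooth_map_on M f"
  shows "continuous_on M f"
  unfolding continuous_on_def
proof
  fix p assume "p \<in> M"
  obtain U F where UF: "open U \<and> p \<in> U \<and> smooth_on U F \<and> (\<forall>x\<in>U \<inter> M. F x = f x)"
    using assms \<open>p \<in> M\<close> unfolding smooth_map_on_def by blast
  then have U: "open U" "p \<in> U" and F: "smooth_on U F" "\<And>x. x \<in> U \<inter> M \<Longrightarrow> F x = f x"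
    by auto
  have "isCont F p"
    using smooth_on_imp_continuous_on[OF F(1)] U continuous_on_eq_continuous_at by blast
  then have "(F \<longlongrightarrow> F p) (at p within M)"
    using isCont_def tendsto_within_subset by blast
  moreover have "eventually (\<lambda>x. F x = f x) (at p within M)"
    unfolding eventually_at_topological using U F(2) by blast
  moreover have "F p = f p" using F(2) U \<open>p \<in> M\<close> by blast
  ultimately show "(f \<longlongrightarrow> f p) (at p within M)"
    using Lim_transform_eventually by metis
qed

locale compact_oriented_manifold =
  fixes M :: "'a::euclidean_space set" and A :: "('n::finite, 'a) chart set"
  assumes oriented: "oriented_manifold M A" and compact_M: "compact M"
begin

section \<open>Chart-independent projection, tensor metric and volume form\<close>

lemma chart_parametrization: "(V, \<psi>) \<in> A \<Longrightarrow> local_parametrization M V \<psi>"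
  using oriented unfolding oriented_manifold_def by blast

lemma chart_at:
  assumes "p \<in> M"
  obtains V \<psi> u where "(V, \<psi>) \<in> A" "u \<in> V" "\<psi> u = p"
  using assms oriented unfolding oriented_manifold_def by blast

lemma transition_det_pos:
  assumes "(V, \<psi>) \<in> A" "(V', \<psi>') \<in> A" "u \<in> V" "u' \<in> V'" "\<psi> u = \<psi>' u'"
  shows "det (matrix (frechet_derivative (inv_into V' \<psi>' \<circ> \<psi>) (at u))) > 0"
  using oriented assms unfolding oriented_manifold_def by (metis (mono_tags, lifting) case_prodD image_eqI)

text \<open>Independence of the chart is \<open>chart_projection_transition\<close>; without charts
  the energy density can be one continuous function on the whole of M.\<close>

definition tangent_projection :: "'a \<Rightarrow> 'a \<Rightarrow> 'a" where
  "tangent_projection p x = (THE y. \<exists>(V, \<psi>)\<in>A. \<exists>u\<in>V. \<psi> u = p \<and> y = chart_projection \<psi> u x)"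

lemma tangent_projection_eq:
  assumes "(V, \<psi>) \<in> A" "u \<in> V"
  shows "tangent_projection (\<psi> u) x = chart_projection \<psi> u x"
  unfolding tangent_projection_def
proof (rule the_equality)
  show "\<exists>(V', \<psi>')\<in>A. \<exists>u'\<in>V'. \<psi>' u' = \<psi> u \<and> chart_projection \<psi> u x = chart_projection \<psi>' u' x"
    using assms by blast
  fix y assume "\<exists>(V', \<psi>')\<in>A. \<exists>u'\<in>V'. \<psi>' u' = \<psi> u \<and> y = chart_projection \<psi>' u' x"
  then obtain V' \<psi>' u' where "(V', \<psi>') \<in> A" "u' \<in> V'" "\<psi>' u' = \<psi> u" "y = chart_projection \<psi>' u' x"
    by blast
  then show "y = chart_projection \<psi> u x"
    using chart_projection_transition[OF chart_parametrization chart_parametrization] assms by metis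
qed

lemma continuous_on_tangent_projection: "continuous_on M (\<lambda>p. tangent_projection p x)"
  unfolding continuous_on_eq_continuous_within
proof
  fix p assume "p \<in> M"
  then obtain V \<psi> u where c: "(V, \<psi>) \<in> A" "u \<in> V" "\<psi> u = p" by (rule chart_at)
  note lp = chart_parametrization[OF c(1)]
  obtain T where T: "open T" "\<psi> ` V = M \<inter> T" by (rule parametrization_image_open[OF lp])
  have "continuous_on (\<psi> ` V) (\<lambda>p. chart_projection \<psi> (inv_into V \<psi> p) x)"
    by (rule continuous_on_compose2[OF continuous_on_chart_projection[OF lp] parametrization_inverse_continuous[OF lp]])
      (auto simp: inv_into_into)
  moreover have "chart_projection \<psi> (inv_into V \<psi> q) x = tangent_projection q x" if "q \<in> \<psi> ` V" for q
    using tangent_projection_eq[OF c(1) inv_into_into[OF that]] f_inv_into_f[OF that] by metis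
  ultimately have "continuous_on (\<psi> ` V) (\<lambda>p. tangent_projection p x)"
    by (rule continuous_on_eq)
  then have "continuous (at p within \<psi> ` V) (\<lambda>p. tangent_projection p x)"
    using c(2,3) continuous_on_eq_continuous_within by blast
  moreover have "at p within \<psi> ` V = at p within M"
    by (rule at_within_nhd[of p T]) (use T c in auto)
  ultimately show "continuous (at p within M) (\<lambda>p. tangent_projection p x)" by simp
qed

text \<open>Agreement with \<sigma> and \<tau> on coordinate vectors determines all coefficients,
  and the right-hand side is the same in every chart; so the description in
  \<open>tensor_metric\<close> has exactly one value.\<close>

lemma tensor_metric_eq:
  assumes "p \<in> M" "bilinear \<sigma>" "bilinear \<tau>"
    and S: "\<And>V \<psi> u i j. (V, \<psi>) \<in> A \<Longrightarrow> u \<in> V \<Longrightarrow> \<psi> u = p \<Longrightarrow>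
      S p (coord_vector \<psi> u i) (coord_vector \<psi> u j) = \<sigma> (coord_vector \<psi> u i) (coord_vector \<psi> u j)"
    and T: "\<And>V \<psi> u i j. (V, \<psi>) \<in> A \<Longrightarrow> u \<in> V \<Longrightarrow> \<psi> u = p \<Longrightarrow>
      T p (coord_vector \<psi> u i) (coord_vector \<psi> u j) = \<tau> (coord_vector \<psi> u i) (coord_vector \<psi> u j)"
  defines "P \<equiv> tangent_projection p"
  shows "tensor_metric A S T p = (\<Sum>a\<in>Basis. \<Sum>b\<in>Basis. \<sigma> (P a) (P b) * \<tau> (P a) (P b))"
proof -
  have coords: "tensor_metric_coords S T \<psi> u = (\<Sum>a\<in>Basis. \<Sum>b\<in>Basis. \<sigma> (P a) (P b) * \<tau> (P a) (P b))"
    if "(V, \<psi>) \<in> A" "u \<in> V" "\<psi> u = p" for V \<psi> u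
  proof -
    have "P = chart_projection \<psi> u"
      unfolding P_def using tangent_projection_eq[OF that(1,2)] that(3) by auto
    then show ?thesis
      using tensor_metric_coords_eq_projection[OF chart_parametrization[OF that(1)] that(2) assms(2,3), of S T]
        S[OF that] T[OF that] that(3) by simp
  qed
  obtain V \<psi> u where c: "(V, \<psi>) \<in> A" "u \<in> V" "\<psi> u = p" using \<open>p \<in> M\<close> by (rule chart_at)
  show ?thesis
    unfolding tensor_metric_def
  proof (rule the_equality)
    show "\<exists>(V, \<psi>)\<in>A. \<exists>u\<in>V. \<psi> u = p \<and>
        (\<Sum>a\<in>Basis. \<Sum>b\<in>Basis. \<sigma> (P a) (P b) * \<tau> (P a) (P b)) = tensor_metric_coords S T \<psi> u"
      using c coords[OF c] by (intro bexI[of _ "(V, \<psi>)"]) auto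
    fix r assume "\<exists>(V, \<psi>)\<in>A. \<exists>u\<in>V. \<psi> u = p \<and> r = tensor_metric_coords S T \<psi> u"
    then obtain V' \<psi>' u' where c': "(V', \<psi>') \<in> A" "u' \<in> V'" "\<psi>' u' = p"
      and r: "r = tensor_metric_coords S T \<psi>' u'" by blast
    show "r = (\<Sum>a\<in>Basis. \<Sum>b\<in>Basis. \<sigma> (P a) (P b) * \<tau> (P a) (P b))"
      unfolding r by (rule coords[OF c'])
  qed
qed

text \<open>The components of one chart's coordinate vectors in another chart form the Jacobian
  matrix of the transition map. Its determinant is positive in an oriented atlas and so equals the
  absolute value in \<open>volume_density_transition\<close>.\<close>

lemma volume_form_coord_vector:
  assumes c: "(V, \<psi>) \<in> A" "u \<in> V"
  shows "volume_form A (\<psi> u) (coord_vector \<psi> u) = volume_density \<psi> u"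
proof -
  have *: "sqrt (det (gram \<psi>' u')) * det (\<chi> i j. components \<psi>' u' (coord_vector \<psi> u j) $ i) = volume_density \<psi> u"
    if c': "(V', \<psi>') \<in> A" "u' \<in> V'" "\<psi>' u' = \<psi> u" for V' \<psi>' u'
  proof -
    note lp = chart_parametrization[OF c(1)] chart_parametrization[OF c'(1)]
    let ?J = "frechet_derivative (inv_into V' \<psi>' \<circ> \<psi>) (at u)"
    have "components \<psi>' u' (coord_vector \<psi> u j) = ?J (axis j 1)" for j
      unfolding components_def
    proof (rule the_equality)
      show "frechet_derivative \<psi>' (at u') (?J (axis j 1)) = coord_vector \<psi> u j"
        unfolding coord_vector_def
        by (rule transition_has_derivative(3)[OF lp c(2) c'(2) c'(3)[symmetric], symmetric])
      then show "w = ?J (axis j 1)" if "frechet_derivative \<psi>' (at u') w = coord_vector \<psi> u j" for w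
        using that parametrization_inj[OF lp(2) c'(2)] by (metis injD)
    qed
    then have "(\<chi> i j. components \<psi>' u' (coord_vector \<psi> u j) $ i) = matrix ?J"
      by (simp add: matrix_def vec_eq_iff)
    then show ?thesis
      using volume_density_transition[OF lp c(2) c'(2) c'(3)[symmetric]]
        transition_det_pos[OF c(1) c'(1) c(2) c'(2) c'(3)[symmetric]]
      by (simp add: volume_density_def)
  qed
  show ?thesis
    unfolding volume_form_def
  proof (rule the_equality)
    show "\<exists>(V', \<psi>')\<in>A. \<exists>u'\<in>V'. \<psi>' u' = \<psi> u \<and>
        volume_density \<psi> u = sqrt (det (gram \<psi>' u')) * det (\<chi> i j. components \<psi>' u' (coord_vector \<psi> u j) $ i)"
      using *[OF c refl] c by force
  qed (use * in force)
qed

subsection \<open>Integrals over charts\<close>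

definition chart_integral :: "('n, 'a) chart \<Rightarrow> ('a \<Rightarrow> real) \<Rightarrow> real" where
  "chart_integral c f = integral (fst c) (\<lambda>u. f (snd c u) * volume_density (snd c) u)"

lemma compact_closure_subset_M: "compact (closure {p \<in> M. Q p})"
proof -
  have "closure {p \<in> M. Q p} \<subseteq> M"
    using compact_M by (intro closure_minimal) (auto simp: compact_imp_closed)
  then have "M \<inter> closure {p \<in> M. Q p} = closure {p \<in> M. Q p}" by blast
  then show ?thesis using compact_Int_closed[OF compact_M closed_closure] by metis
qed

lemma compact_chart_preimage:
  assumes "(V, \<psi>) \<in> A" "compact C" "C \<subseteq> \<psi> ` V"
  shows "compact (inv_into V \<psi> ` C)" "inv_into V \<psi> ` C \<subseteq> V"
    "\<And>u. u \<in> V \<Longrightarrow> u \<notin> inv_into V \<psi> ` C \<Longrightarrow> \<psi> u \<notin> C"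
proof -
  note lp = chart_parametrization[OF assms(1)]
  show "compact (inv_into V \<psi> ` C)"
    by (intro compact_continuous_image continuous_on_subset[OF parametrization_inverse_continuous[OF lp]] assms)
  show "inv_into V \<psi> ` C \<subseteq> V"
    using assms(3) by (auto simp: inv_into_into)
  show "\<psi> u \<notin> C" if "u \<in> V" "u \<notin> inv_into V \<psi> ` C" for u
    using that parametrization_inj_on[OF lp] by (metis image_eqI inv_into_f_f)
qed

text \<open>V is open and the density may be unbounded near its edge; but the integrand vanishes
  outside the preimage K of C, which is compact and on which it is continuous.\<close>

lemma chart_integrand:
  assumes c: "(V, \<psi>) \<in> A" and f: "continuous_on M f"
    and C: "compact C" "C \<subseteq> \<psi> ` V" "\<And>p. p \<in> M \<Longrightarrow> p \<notin> C \<Longrightarrow> f p = 0"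
  defines "K \<equiv> inv_into V \<psi> ` C"
  shows "continuous_on K (\<lambda>u. f (\<psi> u) * volume_density \<psi> u)"
    "(\<lambda>u. f (\<psi> u) * volume_density \<psi> u) integrable_on K"
    "(\<lambda>u. f (\<psi> u) * volume_density \<psi> u) integrable_on V"
    "chart_integral (V, \<psi>) f = integral K (\<lambda>u. f (\<psi> u) * volume_density \<psi> u)"
proof -
  note lp = chart_parametrization[OF c]
  note K = compact_chart_preimage[OF c C(1,2), folded K_def]
  let ?g = "\<lambda>u. f (\<psi> u) * volume_density \<psi> u"
  have "continuous_on K (\<lambda>u. f (\<psi> u))"
    by (rule continuous_on_compose2[OF f continuous_on_subset[OF parametrization_continuous[OF lp] K(2)]])
      (use parametrization_image_subset[OF lp] K(2) in blast)
  then show cont: "continuous_on K ?g"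
    by (intro continuous_on_mult continuous_on_subset[OF continuous_on_volume_density[OF lp] K(2)])
  show int: "?g integrable_on K"
    using absolutely_integrable_continuous_compact[OF K(1) cont] set_lebesgue_integral_eq_integral(1) by blast
  have "((\<lambda>u. if u \<in> K then ?g u else 0) has_integral integral K ?g) V"
    using integrable_integral[OF int] has_integral_restrict[OF K(2), of ?g] by simp
  moreover have "(if u \<in> K then ?g u else 0) = ?g u" if "u \<in> V" for u
    using C(3)[of "\<psi> u"] K(3)[OF that] parametrization_image_subset[OF lp] that by auto
  ultimately have "(?g has_integral integral K ?g) V" by (rule has_integral_eq[rotated])
  then show "?g integrable_on V" "chart_integral (V, \<psi>) f = integral K ?g"
    by (auto simp: chart_integral_def integral_unique)
qed

text \<open>Both integrals live on preimages of the common set C, and the transition map carries one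
  preimage onto the other; \<open>volume_density_transition\<close> absorbs the Jacobian
  factor.\<close>

lemma chart_integral_transition:
  assumes c: "(V, \<psi>) \<in> A" and c': "(V', \<psi>') \<in> A" and f: "continuous_on M f"
    and C: "compact C" "C \<subseteq> \<psi> ` V" "C \<subseteq> \<psi>' ` V'" "\<And>p. p \<in> M \<Longrightarrow> p \<notin> C \<Longrightarrow> f p = 0"
  shows "chart_integral (V, \<psi>) f = chart_integral (V', \<psi>') f"
proof -
  note lp = chart_parametrization[OF c] chart_parametrization[OF c']
  define K where "K = inv_into V \<psi> ` C"
  define K' where "K' = inv_into V' \<psi>' ` C"
  let ?\<tau> = "inv_into V' \<psi>' \<circ> \<psi>"
  let ?D = "\<lambda>u. frechet_derivative ?\<tau> (at u)"
  let ?F = "\<lambda>u. f (\<psi>' u) * volume_density \<psi>' u"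
  note K = compact_chart_preimage[OF c C(1,2), folded K_def]
  have \<psi>K: "\<psi> (inv_into V \<psi> p) = p" if "p \<in> C" for p
    using that C(2) by (metis f_inv_into_f subsetD)
  have \<tau>K: "?\<tau> ` K = K'"
    unfolding K_def K'_def image_image o_def using \<psi>K by (intro image_cong) auto
  have \<tau>: "?\<tau> u \<in> V'" "\<psi>' (?\<tau> u) = \<psi> u" if "u \<in> K" for u
  proof -
    have "\<psi> u \<in> C" using that \<psi>K by (auto simp: K_def)
    then have "\<psi> u \<in> \<psi>' ` V'" using C(3) by blast
    then show "?\<tau> u \<in> V'" "\<psi>' (?\<tau> u) = \<psi> u" by (simp_all add: inv_into_into f_inv_into_f)
  qed
  have "integral K (\<lambda>u. \<bar>det (matrix (?D u))\<bar> * ?F (?\<tau> u)) = integral (?\<tau> ` K) ?F"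
  proof (rule change_of_variables_compact[OF K(1)])
    show "(?\<tau> has_derivative ?D u) (at u within K)" if "u \<in> K" for u
      using transition_has_derivative(2)[OF lp _ \<tau>(1)[OF that] \<tau>(2)[OF that, symmetric]] K(2) that
        has_derivative_at_withinI by blast
    show "inj_on ?\<tau> K"
    proof (rule inj_onI)
      fix u v assume "u \<in> K" "v \<in> K" "?\<tau> u = ?\<tau> v"
      then have "\<psi> u = \<psi> v" using \<tau>(2) by metis
      then show "u = v"
        using parametrization_inj_on[OF lp(1)] K(2) \<open>u \<in> K\<close> \<open>v \<in> K\<close> by (meson inj_onD subsetD)
    qed
    show "continuous_on (?\<tau> ` K) ?F"
      unfolding \<tau>K K'_def by (rule chart_integrand(1)[OF c' f C(1,3,4)])
  qed
  moreover have "\<bar>det (matrix (?D u))\<bar> * ?F (?\<tau> u) = f (\<psi> u) * volume_density \<psi> u" if "u \<in> K" for u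
    using volume_density_transition[OF lp _ \<tau>(1)[OF that] \<tau>(2)[OF that, symmetric]] K(2) that \<tau>(2)[OF that]
    by (auto simp: mult_ac)
  ultimately have "integral K (\<lambda>u. f (\<psi> u) * volume_density \<psi> u) = integral K' ?F"
    unfolding \<tau>K by (metis (mono_tags, lifting) integral_cong)
  then show ?thesis
    using chart_integrand(4)[OF c f C(1,2,4)] chart_integrand(4)[OF c' f C(1,3,4)] by (simp add: K_def K'_def)
qed

section \<open>Partitions of unity and the integral of a form\<close>

lemma partition_of_unityD:
  assumes "partition_of_unity M A m c \<rho>"
  shows "i < m \<Longrightarrow> (fst (c i), snd (c i)) \<in> A" "i < m \<Longrightarrow> continuous_on M (\<rho> i)"
    "i < m \<Longrightarrow> closure {p \<in> M. \<rho> i p \<noteq> 0} \<subseteq> snd (c i) ` fst (c i)" "p \<in> M \<Longrightarrow> (\<Sum>i<m. \<rho> i p) = 1"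
    "p \<in> M \<Longrightarrow> p \<notin> closure {p \<in> M. \<rho> i p \<noteq> 0} \<Longrightarrow> \<rho> i p = 0"
proof -
  show "p \<in> M \<Longrightarrow> p \<notin> closure {p \<in> M. \<rho> i p \<noteq> 0} \<Longrightarrow> \<rho> i p = 0"
    using closure_subset[of "{p \<in> M. \<rho> i p \<noteq> 0}"] by blast
qed (use assms smooth_map_on_imp_continuous_on in \<open>auto simp: partition_of_unity_def\<close>)

definition partition_integral ::
  "nat \<Rightarrow> (nat \<Rightarrow> ('n, 'a) chart) \<Rightarrow> (nat \<Rightarrow> 'a \<Rightarrow> real) \<Rightarrow> ('a \<Rightarrow> real) \<Rightarrow> real" where
  "partition_integral m c \<rho> f = (\<Sum>i<m. chart_integral (c i) (\<lambda>p. \<rho> i p * f p))"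

lemma chart_integral_subdivide:
  assumes c: "(V, \<psi>) \<in> A" and f: "continuous_on M f"
    and C: "compact C" "C \<subseteq> \<psi> ` V" "\<And>p. p \<in> M \<Longrightarrow> p \<notin> C \<Longrightarrow> f p = 0"
    and pu: "partition_of_unity M A m d \<rho>"
  shows "chart_integral (V, \<psi>) f = (\<Sum>j<m. chart_integral (V, \<psi>) (\<lambda>p. \<rho> j p * f p))"
proof -
  have sub: "\<psi> ` V \<subseteq> M" by (rule parametrization_image_subset[OF chart_parametrization[OF c]])
  have int: "(\<lambda>u. \<rho> j (\<psi> u) * f (\<psi> u) * volume_density \<psi> u) integrable_on V" if "j < m" for j
    by (rule chart_integrand(3)[OF c _ C(1,2)])
      (use C(3) partition_of_unityD(2)[OF pu that] f in \<open>auto intro: continuous_on_mult\<close>)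
  have "chart_integral (V, \<psi>) f = integral V (\<lambda>u. \<Sum>j<m. \<rho> j (\<psi> u) * f (\<psi> u) * volume_density \<psi> u)"
    unfolding chart_integral_def fst_conv snd_conv
  proof (rule integral_cong)
    fix u assume "u \<in> V"
    then have "(\<Sum>j<m. \<rho> j (\<psi> u)) = 1" using sub partition_of_unityD(4)[OF pu] by blast
    then show "f (\<psi> u) * volume_density \<psi> u = (\<Sum>j<m. \<rho> j (\<psi> u) * f (\<psi> u) * volume_density \<psi> u)"
      by (simp add: sum_distrib_right[symmetric])
  qed
  also have "\<dots> = (\<Sum>j<m. integral V (\<lambda>u. \<rho> j (\<psi> u) * f (\<psi> u) * volume_density \<psi> u))"
    using int by (intro integral_sum) auto
  finally show ?thesis by (simp add: chart_integral_def)
qed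

text \<open>Both sides become the double sum of the integrals of \<rho> i * \<rho>' j * f, each
  supported in the intersection of two chart images, where either chart computes the same
  value.\<close>

lemma partition_integral_independent:
  assumes pu: "partition_of_unity M A m c \<rho>" and pu': "partition_of_unity M A m' c' \<rho>'"
    and f: "continuous_on M f"
  shows "partition_integral m c \<rho> f = partition_integral m' c' \<rho>' f"
proof -
  note P = partition_of_unityD[OF pu] and P' = partition_of_unityD[OF pu']
  have "chart_integral (c i) (\<lambda>p. \<rho> i p * f p) = (\<Sum>j<m'. chart_integral (c i) (\<lambda>p. \<rho>' j p * (\<rho> i p * f p)))"
    if i: "i < m" for i
    using chart_integral_subdivide[OF P(1)[OF i] continuous_on_mult[OF P(2)[OF i] f] compact_closure_subset_M P(3)[OF i] _ pu']
      P(5) by simp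
  moreover have "chart_integral (c' j) (\<lambda>p. \<rho>' j p * f p) = (\<Sum>i<m. chart_integral (c' j) (\<lambda>p. \<rho> i p * (\<rho>' j p * f p)))"
    if j: "j < m'" for j
    using chart_integral_subdivide[OF P'(1)[OF j] continuous_on_mult[OF P'(2)[OF j] f] compact_closure_subset_M P'(3)[OF j] _ pu]
      P'(5) by simp
  moreover have "chart_integral (c i) (\<lambda>p. \<rho>' j p * (\<rho> i p * f p)) = chart_integral (c' j) (\<lambda>p. \<rho> i p * (\<rho>' j p * f p))"
    if i: "i < m" and j: "j < m'" for i j
  proof -
    let ?C = "closure {p \<in> M. \<rho> i p \<noteq> 0} \<inter> closure {p \<in> M. \<rho>' j p \<noteq> 0}"
    have "chart_integral (fst (c i), snd (c i)) (\<lambda>p. \<rho>' j p * (\<rho> i p * f p)) =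
        chart_integral (fst (c' j), snd (c' j)) (\<lambda>p. \<rho>' j p * (\<rho> i p * f p))"
    proof (rule chart_integral_transition[OF P(1)[OF i] P'(1)[OF j]])
      show "continuous_on M (\<lambda>p. \<rho>' j p * (\<rho> i p * f p))"
        by (intro continuous_on_mult P(2)[OF i] P'(2)[OF j] f)
      show "compact ?C" by (intro compact_Int compact_closure_subset_M)
      show "?C \<subseteq> snd (c i) ` fst (c i)" "?C \<subseteq> snd (c' j) ` fst (c' j)"
        using P(3)[OF i] P'(3)[OF j] by blast+
      show "\<rho>' j p * (\<rho> i p * f p) = 0" if "p \<in> M" "p \<notin> ?C" for p
        using P(5)[OF that(1), of i] P'(5)[OF that(1), of j] that(2) by auto
    qed
    then show ?thesis by (simp add: mult.left_commute)
  qed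
  ultimately show ?thesis
    unfolding partition_integral_def by (simp add: sum.swap[of _ "{..<m'}"])
qed

text \<open>Chart images are traces on M of ambient open sets, and an ambient partition subordinate
  to those sets restricts to M.\<close>

lemma partition_of_unity_exists: "\<exists>m c \<rho>. partition_of_unity M A m c \<rho>"
proof -
  have "\<exists>c T. c \<in> A \<and> open T \<and> p \<in> T \<and> snd c ` fst c = M \<inter> T" if "p \<in> M" for p
  proof -
    obtain V \<psi> u where c: "(V, \<psi>) \<in> A" "u \<in> V" "\<psi> u = p" using \<open>p \<in> M\<close> by (rule chart_at)
    obtain T where "open T" "\<psi> ` V = M \<inter> T"
      by (rule parametrization_image_open[OF chart_parametrization[OF c(1)]])
    then show ?thesis using c by (intro exI[of _ "(V, \<psi>)"] exI[of _ T]) auto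
  qed
  then obtain chart T where ch: "\<And>p. p \<in> M \<Longrightarrow> chart p \<in> A" "\<And>p. p \<in> M \<Longrightarrow> open (T p) \<and> p \<in> T p"
    "\<And>p. p \<in> M \<Longrightarrow> snd (chart p) ` fst (chart p) = M \<inter> T p" by metis
  show ?thesis
  proof (rule smooth_partition_of_unity[OF compact_M, of T])
    show "open (T p) \<and> p \<in> T p" if "p \<in> M" for p using ch(2)[OF that] .
  next
    fix m and c :: "nat \<Rightarrow> 'a" and \<rho> :: "nat \<Rightarrow> 'a \<Rightarrow> real"
    assume \<rho>: "\<And>i. i < m \<Longrightarrow> c i \<in> M" "\<And>i. i < m \<Longrightarrow> smooth_on UNIV (\<rho> i)"
      "\<And>i x. i < m \<Longrightarrow> \<rho> i x \<ge> 0" "\<And>i. i < m \<Longrightarrow> closure {x. \<rho> i x \<noteq> 0} \<subseteq> T (c i)"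
      "\<And>p. p \<in> M \<Longrightarrow> (\<Sum>i<m. \<rho> i p) = 1"
    have "partition_of_unity M A m (\<lambda>i. chart (c i)) \<rho>"
      unfolding partition_of_unity_def
    proof (intro conjI allI impI ballI)
      fix i assume i: "i < m"
      show "chart (c i) \<in> A" using ch \<rho>(1)[OF i] by blast
      show "smooth_map_on M (\<rho> i)" unfolding smooth_map_on_def using \<rho>(2)[OF i] open_UNIV by blast
      have "closure {p \<in> M. \<rho> i p \<noteq> 0} \<subseteq> M"
        using compact_M by (intro closure_minimal) (auto simp: compact_imp_closed)
      moreover have "closure {p \<in> M. \<rho> i p \<noteq> 0} \<subseteq> T (c i)"
        using closure_mono[of "{p \<in> M. \<rho> i p \<noteq> 0}" "{p. \<rho> i p \<noteq> 0}"] \<rho>(4)[OF i] by blast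
      ultimately show "closure {p \<in> M. \<rho> i p \<noteq> 0} \<subseteq> snd (chart (c i)) ` fst (chart (c i))"
        using ch(3)[OF \<rho>(1)[OF i]] by blast
    qed (use \<rho> in auto)
    then show "\<exists>m c \<rho>. partition_of_unity M A m c \<rho>" by blast
  qed
qed

lemma form_integral_eq:
  assumes pu: "partition_of_unity M A m c \<rho>" and f: "continuous_on M f"
    and \<omega>: "\<And>V \<psi> u. (V, \<psi>) \<in> A \<Longrightarrow> u \<in> V \<Longrightarrow> \<omega> (\<psi> u) (coord_vector \<psi> u) = f (\<psi> u) * volume_density \<psi> u"
  shows "form_integral M A \<omega> = partition_integral m c \<rho> f"
proof -
  have *: "(\<Sum>i<m. integral (fst (c i)) (\<lambda>u. let \<psi> = snd (c i) in \<rho> i (\<psi> u) * \<omega> (\<psi> u) (coord_vector \<psi> u))) =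
      partition_integral m c \<rho> f" if "partition_of_unity M A m c \<rho>" for m c \<rho>
    unfolding partition_integral_def chart_integral_def
    by (intro sum.cong integral_cong refl)
      (simp add: Let_def mult.assoc \<omega>[OF partition_of_unityD(1)[OF that]])
  show ?thesis
    unfolding form_integral_def
  proof (rule the_equality)
    show "\<exists>m' c' \<rho>'. partition_of_unity M A m' c' \<rho>' \<and> partition_integral m c \<rho> f =
        (\<Sum>i<m'. integral (fst (c' i)) (\<lambda>u. let \<psi> = snd (c' i) in \<rho>' i (\<psi> u) * \<omega> (\<psi> u) (coord_vector \<psi> u)))"
      by (intro exI conjI, rule pu, rule *[OF pu, symmetric])
    fix r assume "\<exists>m c \<rho>. partition_of_unity M A m c \<rho> \<and>
        r = (\<Sum>i<m. integral (fst (c i)) (\<lambda>u. let \<psi> = snd (c i) in \<rho> i (\<psi> u) * \<omega> (\<psi> u) (coord_vector \<psi> u)))"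
    then obtain m' c' \<rho>' where pu': "partition_of_unity M A m' c' \<rho>'"
      and "r = (\<Sum>i<m'. integral (fst (c' i)) (\<lambda>u. let \<psi> = snd (c' i) in \<rho>' i (\<psi> u) * \<omega> (\<psi> u) (coord_vector \<psi> u)))"
      by blast
    then show "r = partition_integral m c \<rho> f"
      using *[OF pu'] partition_integral_independent[OF pu pu' f] by simp
  qed
qed

lemma partition_integral_cmult: "partition_integral m c \<rho> (\<lambda>p. k * f p) = k * partition_integral m c \<rho> f"
proof -
  have "chart_integral d (\<lambda>p. g p * (k * f p)) = k * chart_integral d (\<lambda>p. g p * f p)" for d g
    unfolding chart_integral_def by (subst integral_mult_right[symmetric]) (simp add: mult_ac)
  then show ?thesis by (simp add: partition_integral_def sum_distrib_left)
qed

subsection \<open>Differentiation under the integral sign\<close>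

text \<open>The mean value estimate for f s p - s * f' 0 p, whose derivative f' s p - f' 0 p is
  small uniformly in p by uniform continuity of f' on the compact set of (s, p) with \<bar>s\<bar>
  \<le> 1 and p in M.\<close>

lemma uniform_first_order_expansion:
  fixes f f' :: "real \<Rightarrow> 'a \<Rightarrow> real"
  assumes der: "\<And>t p. p \<in> M \<Longrightarrow> ((\<lambda>t. f t p) has_real_derivative f' t p) (at t)"
    and cont: "continuous_on (UNIV \<times> M) (\<lambda>z. f' (fst z) (snd z))" and "\<epsilon> > 0"
  shows "\<exists>\<delta>>0. \<forall>t p. \<bar>t\<bar> < \<delta> \<longrightarrow> p \<in> M \<longrightarrow> \<bar>f t p - f 0 p - t * f' 0 p\<bar> \<le> \<epsilon> * \<bar>t\<bar>"
proof -
  have "uniformly_continuous_on ({- 1..1} \<times> M) (\<lambda>z. f' (fst z) (snd z))"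
    using cont by (intro compact_uniformly_continuous compact_Times compact_M)
      (auto intro: continuous_on_subset)
  then obtain d where "d > 0" and d: "\<And>z z'. z \<in> {- 1..1} \<times> M \<Longrightarrow> z' \<in> {- 1..1} \<times> M \<Longrightarrow> dist z' z < d \<Longrightarrow>
      dist (f' (fst z') (snd z')) (f' (fst z) (snd z)) < \<epsilon>"
    unfolding uniformly_continuous_on_def using \<open>\<epsilon> > 0\<close> by metis
  define \<delta> where "\<delta> = min 1 d"
  have "\<bar>f t p - f 0 p - t * f' 0 p\<bar> \<le> \<epsilon> * \<bar>t\<bar>" if t: "\<bar>t\<bar> < \<delta>" and p: "p \<in> M" for t p
  proof -
    let ?S = "ball (0::real) \<delta>"
    have "norm ((f t p - t * f' 0 p) - (f 0 p - 0 * f' 0 p)) \<le> \<epsilon> * norm (t - 0)"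
    proof (rule field_differentiable_bound[of ?S "\<lambda>s. f s p - s * f' 0 p" "\<lambda>s. f' s p - f' 0 p"])
      show "((\<lambda>s. f s p - s * f' 0 p) has_field_derivative f' s p - f' 0 p) (at s within ?S)" for s
        using DERIV_diff[OF der[OF p] DERIV_cmult_Id[of "f' 0 p"]] by (simp add: mult.commute has_field_derivative_at_within)
      show "norm (f' s p - f' 0 p) \<le> \<epsilon>" if "s \<in> ?S" for s
        using d[of "(0, p)" "(s, p)"] that p by (auto simp: \<delta>_def dist_Pair_Pair dist_real_def abs_less_iff)
    qed (use t in \<open>auto simp: \<delta>_def\<close>)
    then show ?thesis by simp
  qed
  moreover have "\<delta> > 0" using \<open>d > 0\<close> by (simp add: \<delta>_def)
  ultimately show ?thesis by blast
qed

lemma has_real_derivative_partition_integral: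
  fixes f f' :: "real \<Rightarrow> 'a \<Rightarrow> real"
  assumes pu: "partition_of_unity M A m c \<rho>"
    and der: "\<And>t p. p \<in> M \<Longrightarrow> ((\<lambda>t. f t p) has_real_derivative f' t p) (at t)"
    and f: "\<And>t. continuous_on M (f t)"
    and cont: "continuous_on (UNIV \<times> M) (\<lambda>z. f' (fst z) (snd z))"
  shows "((\<lambda>t. partition_integral m c \<rho> (f t)) has_real_derivative partition_integral m c \<rho> (f' 0)) (at 0)"
  unfolding partition_integral_def
proof (rule DERIV_sum)
  fix i assume "i \<in> {..<m}"
  then have i: "i < m" by simp
  obtain V \<psi> where ci: "c i = (V, \<psi>)" by fastforce
  note P = partition_of_unityD[OF pu]
  have c: "(V, \<psi>) \<in> A" using P(1)[OF i] ci by simp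
  let ?C = "closure {p \<in> M. \<rho> i p \<noteq> 0}"
  have C: "?C \<subseteq> \<psi> ` V" using P(3)[OF i] ci by simp
  define K where "K = inv_into V \<psi> ` ?C"
  have sub: "\<psi> ` K \<subseteq> M"
    using compact_chart_preimage(2)[OF c compact_closure_subset_M C]
      parametrization_image_subset[OF chart_parametrization[OF c]] by (auto simp: K_def)
  define I where "I g = integral K (\<lambda>u. \<rho> i (\<psi> u) * g (\<psi> u) * volume_density \<psi> u)" for g
  have "continuous_on M (\<lambda>p. \<rho> i p * g p)" if "continuous_on M g" for g
    by (intro continuous_on_mult P(2)[OF i] that)
  note integrand = chart_integrand[OF c this compact_closure_subset_M C, folded K_def]
  have int: "(\<lambda>u. \<rho> i (\<psi> u) * g (\<psi> u) * volume_density \<psi> u) integrable_on K"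
    and cI: "chart_integral (c i) (\<lambda>p. \<rho> i p * g p) = I g" if "continuous_on M g" for g
    using integrand(2,4)[OF that] P(5) ci by (auto simp: I_def)
  have f'0: "continuous_on M (f' 0)"
  proof -
    have "continuous_on M (\<lambda>p. f' (fst (0::real, p)) (snd (0::real, p)))"
      by (rule continuous_on_compose2[OF cont, of M "\<lambda>p. (0, p)"]) (auto intro!: continuous_on_Pair continuous_on_const continuous_on_id)
    then show ?thesis by simp
  qed
  have "continuous_on K (\<lambda>u. \<rho> i (\<psi> u) * 1 * volume_density \<psi> u)"
    using integrand(1)[OF continuous_on_const[of _ 1]] P(5) by simp
  then have cont1: "continuous_on K (\<lambda>u. \<bar>\<rho> i (\<psi> u) * volume_density \<psi> u\<bar>)"
    by (intro continuous_on_rabs) simp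
  define J where "J = integral K (\<lambda>u. \<bar>\<rho> i (\<psi> u) * volume_density \<psi> u\<bar>)"
  have intJ: "(\<lambda>u. \<bar>\<rho> i (\<psi> u) * volume_density \<psi> u\<bar>) integrable_on K"
    using absolutely_integrable_continuous_compact[OF compact_chart_preimage(1)[OF c compact_closure_subset_M C, folded K_def] cont1]
      set_lebesgue_integral_eq_integral(1) by blast
  have J0: "J \<ge> 0" unfolding J_def by (rule integral_nonneg[OF intJ]) simp
  have "((\<lambda>t. I (f t)) has_real_derivative I (f' 0)) (at 0)"
    unfolding has_field_derivative_def has_derivative_at_alt
  proof (intro conjI allI impI bounded_linear_mult_right)
    fix e :: real assume "e > 0"
    \<comment> \<open>J is the mass of the weight, so a uniform error \<epsilon> * \<bar>t\<bar>
      integrates to at most e * \<bar>t\<bar>; J may be 0, hence J + 1.\<close>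
    define \<epsilon> where "\<epsilon> = e / (J + 1)"
    have "\<epsilon> > 0" using \<open>e > 0\<close> J0 by (simp add: \<epsilon>_def)
    obtain \<delta> where "\<delta> > 0" and \<delta>: "\<And>t p. \<bar>t\<bar> < \<delta> \<Longrightarrow> p \<in> M \<Longrightarrow> \<bar>f t p - f 0 p - t * f' 0 p\<bar> \<le> \<epsilon> * \<bar>t\<bar>"
      using uniform_first_order_expansion[OF der cont \<open>\<epsilon> > 0\<close>] by blast
    have "norm (I (f t) - I (f 0) - I (f' 0) * (t - 0)) \<le> e * norm (t - 0)" if t: "norm (t - 0) < \<delta>" for t
    proof -
      let ?r = "\<lambda>p. f t p - f 0 p - t * f' 0 p"
      have r: "continuous_on M ?r" by (intro continuous_intros f f'0)
      have "I (f t) - I (f 0) - t * I (f' 0) = I ?r"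
      proof -
        have "I (f t) - I (f 0) = integral K (\<lambda>u. \<rho> i (\<psi> u) * f t (\<psi> u) * volume_density \<psi> u - \<rho> i (\<psi> u) * f 0 (\<psi> u) * volume_density \<psi> u)"
          unfolding I_def by (rule integral_diff[symmetric]) (intro int f)+
        moreover have "t * I (f' 0) = integral K (\<lambda>u. t * (\<rho> i (\<psi> u) * f' 0 (\<psi> u) * volume_density \<psi> u))"
          unfolding I_def by simp
        ultimately have "I (f t) - I (f 0) - t * I (f' 0) = integral K (\<lambda>u.
            (\<rho> i (\<psi> u) * f t (\<psi> u) * volume_density \<psi> u - \<rho> i (\<psi> u) * f 0 (\<psi> u) * volume_density \<psi> u) -
            t * (\<rho> i (\<psi> u) * f' 0 (\<psi> u) * volume_density \<psi> u))"
          by (simp only:) (rule integral_diff[symmetric]; intro integrable_diff integrable_on_mult_right int f f'0)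
        then show ?thesis by (simp add: I_def algebra_simps)
      qed
      then have "I (f t) - I (f 0) - I (f' 0) * (t - 0) = I ?r" by (simp add: mult.commute)
      then have "norm (I (f t) - I (f 0) - I (f' 0) * (t - 0)) = norm (I ?r)" by (rule arg_cong)
      also have "norm (I ?r) \<le> integral K (\<lambda>u. \<epsilon> * \<bar>t\<bar> * \<bar>\<rho> i (\<psi> u) * volume_density \<psi> u\<bar>)"
        unfolding I_def
      proof (rule integral_norm_bound_integral[OF int[OF r] integrable_on_mult_right[OF intJ]])
        fix u assume "u \<in> K"
        then have "\<psi> u \<in> M" using sub by blast
        then show "norm (\<rho> i (\<psi> u) * ?r (\<psi> u) * volume_density \<psi> u) \<le> \<epsilon> * \<bar>t\<bar> * \<bar>\<rho> i (\<psi> u) * volume_density \<psi> u\<bar>"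
          using mult_right_mono[OF \<delta>[of t "\<psi> u"], of "\<bar>\<rho> i (\<psi> u) * volume_density \<psi> u\<bar>"] t
          by (simp add: abs_mult mult_ac)
      qed
      also have "\<dots> = (\<epsilon> * J) * \<bar>t\<bar>" by (simp add: J_def)
      also have "\<dots> \<le> e * \<bar>t\<bar>"
        using \<open>e > 0\<close> J0 by (intro mult_right_mono) (auto simp: \<epsilon>_def divide_le_eq)
      finally show ?thesis by simp
    qed
    then show "\<exists>d>0. \<forall>y. norm (y - 0) < d \<longrightarrow> norm (I (f y) - I (f 0) - I (f' 0) * (y - 0)) \<le> e * norm (y - 0)"
      using \<open>\<delta> > 0\<close> by blast
  qed
  then show "((\<lambda>t. chart_integral (c i) (\<lambda>p. \<rho> i p * f t p)) has_real_derivative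
      chart_integral (c i) (\<lambda>p. \<rho> i p * f' 0 p)) (at 0)"
    using cI[OF f] cI[OF f'0] by simp
qed

end

section \<open>The first variation of the deformation energy\<close>

context compact_oriented_manifold
begin

text \<open>The choice that \<open>differential\<close> makes among the derivatives within M is
  invisible on coordinate vectors.\<close>

lemma differential_coord_vector:
  assumes "(V, \<psi>) \<in> A" "u \<in> V" "(F has_derivative D) (at (\<psi> u) within M)"
  shows "differential M F (\<psi> u) (coord_vector \<psi> u i) = D (coord_vector \<psi> u i)"
proof -
  have "(F has_derivative differential M F (\<psi> u)) (at (\<psi> u) within M)"
    unfolding differential_def using assms(3) differentiableI frechet_derivative_works by blast
  then show ?thesis
    using derivative_within_unique_on_tangent[OF chart_parametrization[OF assms(1)] assms(2)] assms(3) by blast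
qed

lemma tensor_metric_form_integral:
  fixes \<sigma> \<tau> :: "'a \<Rightarrow> 'a \<Rightarrow> 'a \<Rightarrow> real"
  assumes pu: "partition_of_unity M A m c \<rho>"
    and bil: "\<And>p. bilinear (\<sigma> p)" "\<And>p. bilinear (\<tau> p)"
    and S: "\<And>V \<psi> u i j. (V, \<psi>) \<in> A \<Longrightarrow> u \<in> V \<Longrightarrow>
      S (\<psi> u) (coord_vector \<psi> u i) (coord_vector \<psi> u j) = \<sigma> (\<psi> u) (coord_vector \<psi> u i) (coord_vector \<psi> u j)"
    and T: "\<And>V \<psi> u i j. (V, \<psi>) \<in> A \<Longrightarrow> u \<in> V \<Longrightarrow>
      T (\<psi> u) (coord_vector \<psi> u i) (coord_vector \<psi> u j) = \<tau> (\<psi> u) (coord_vector \<psi> u i) (coord_vector \<psi> u j)"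
  defines "g \<equiv> \<lambda>p. \<Sum>a\<in>Basis. \<Sum>b\<in>Basis.
    \<sigma> p (tangent_projection p a) (tangent_projection p b) * \<tau> p (tangent_projection p a) (tangent_projection p b)"
  assumes cont: "continuous_on M g"
  shows "form_integral M A (\<lambda>p vs. tensor_metric A S T p * volume_form A p vs) = partition_integral m c \<rho> g"
proof (rule form_integral_eq[OF pu cont])
  fix V \<psi> u assume c: "(V, \<psi>) \<in> A" "u \<in> V"
  have "\<psi> u \<in> M" using parametrization_image_subset[OF chart_parametrization[OF c(1)]] c(2) by blast
  have "tensor_metric A S T (\<psi> u) = g (\<psi> u)"
    unfolding g_def
  proof (rule tensor_metric_eq[OF \<open>\<psi> u \<in> M\<close> bil])
    fix V' \<psi>' u' i j assume c': "(V', \<psi>') \<in> A" "u' \<in> V'" "\<psi>' u' = \<psi> u"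
    show "S (\<psi> u) (coord_vector \<psi>' u' i) (coord_vector \<psi>' u' j) = \<sigma> (\<psi> u) (coord_vector \<psi>' u' i) (coord_vector \<psi>' u' j)"
      using S[OF c'(1,2)] c'(3) by simp
    show "T (\<psi> u) (coord_vector \<psi>' u' i) (coord_vector \<psi>' u' j) = \<tau> (\<psi> u) (coord_vector \<psi>' u' i) (coord_vector \<psi>' u' j)"
      using T[OF c'(1,2)] c'(3) by simp
  qed
  then show "tensor_metric A S T (\<psi> u) * volume_form A (\<psi> u) (coord_vector \<psi> u) = g (\<psi> u) * volume_density \<psi> u"
    using volume_form_coord_vector[OF c] by simp
qed

theorem first_variation:
  fixes h :: "'a \<Rightarrow> 'a"
  assumes h: "smooth_map_on M h" and Y: "smooth_vector_field M Y"
  shows "((\<lambda>t. deformation_energy M A (h \<circ> flow M Y t)) has_real_derivative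
    2 * form_integral M A (\<lambda>p vs. tensor_metric A (strain M h)
      (lie_derivative M Y (pullback M h induced_metric)) p * volume_form A p vs)) (at 0)"
proof -
  let ?\<phi> = "flow M Y" and ?P = tangent_projection
  obtain H where H: "smooth_on UNIV H" and Hh: "\<And>x. x \<in> M \<Longrightarrow> H x = h x"
    using smooth_extension[OF compact_M h] by metis
  obtain B B' :: "real \<Rightarrow> 'a \<Rightarrow> 'a \<Rightarrow>\<^sub>L 'a"
    where \<phi>0: "\<And>p. p \<in> M \<Longrightarrow> ?\<phi> 0 p = p" and \<phi>M: "\<And>t p. p \<in> M \<Longrightarrow> ?\<phi> t p \<in> M"
      and \<phi>: "\<And>t p. p \<in> M \<Longrightarrow> ?\<phi> t differentiable (at p within M)"
      and B: "\<And>t p. p \<in> M \<Longrightarrow> ((\<lambda>x. H (?\<phi> t x)) has_derivative B t p) (at p within M)"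
      and B': "\<And>t p. ((\<lambda>t. B t p) has_vector_derivative B' t p) (at t)"
      and contB: "continuous_on UNIV (\<lambda>(t, p). B t p)" and contB': "continuous_on UNIV (\<lambda>(t, p). B' t p)"
    by (rule flow_pullback[OF compact_M Y H], rule that)
  have Dh\<phi>: "((h \<circ> ?\<phi> t) has_derivative B t p) (at p within M)" if "p \<in> M" for t p
    by (rule has_derivative_transform[OF that _ B[OF that]]) (simp add: Hh \<phi>M)
  \<comment> \<open>The flow at time 0 is the identity on M, so B 0 serves for h itself.\<close>
  have Dh: "(h has_derivative B 0 p) (at p within M)" if "p \<in> M" for p
    by (rule has_derivative_transform[OF that _ B[OF that]]) (simp add: Hh \<phi>0)
  define \<sigma> where "\<sigma> t p v w = B t p v \<bullet> B t p w - v \<bullet> w" for t p v w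
  define \<kappa> where "\<kappa> t p v w = B' t p v \<bullet> B t p w + B t p v \<bullet> B' t p w" for t p v w
  have bil: "bilinear (\<sigma> t p)" "bilinear (\<kappa> t p)" for t p
    unfolding bilinear_def \<sigma>_def \<kappa>_def
    by (auto intro!: linearI simp: blinfun.bilinear_simps algebra_simps)
  have M: "\<psi> u \<in> M" if "(V, \<psi>) \<in> A" "u \<in> V" for V \<psi> u
    using parametrization_image_subset[OF chart_parametrization[OF that(1)]] that(2) by blast
  have strain_flow: "strain M (h \<circ> ?\<phi> t) (\<psi> u) (coord_vector \<psi> u i) (coord_vector \<psi> u j) =
      \<sigma> t (\<psi> u) (coord_vector \<psi> u i) (coord_vector \<psi> u j)" if "(V, \<psi>) \<in> A" "u \<in> V" for t V \<psi> u i j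
    by (simp add: strain_def pullback_def induced_metric_def \<sigma>_def
        differential_coord_vector[OF that Dh\<phi>[OF M[OF that]]])
  have strain: "strain M h (\<psi> u) (coord_vector \<psi> u i) (coord_vector \<psi> u j) =
      \<sigma> 0 (\<psi> u) (coord_vector \<psi> u i) (coord_vector \<psi> u j)" if "(V, \<psi>) \<in> A" "u \<in> V" for V \<psi> u i j
    by (simp add: strain_def pullback_def induced_metric_def \<sigma>_def
        differential_coord_vector[OF that Dh[OF M[OF that]]])
  have BD: "((\<lambda>t. B t p v) has_vector_derivative B' t p v) (at t)" for t p v
    by (rule bounded_linear.has_vector_derivative[OF blinfun.bounded_linear_left B'])
  have inner: "((\<lambda>t. B t p v \<bullet> B t p w) has_real_derivative \<kappa> t p v w) (at t)" for t p v w
    using bounded_bilinear.has_vector_derivative[OF bounded_bilinear_inner BD[where p = p and t = t and v = v] BD[where p = p and t = t and v = w]]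
    by (simp add: has_real_derivative_iff_has_vector_derivative \<kappa>_def add.commute)
  have lie: "lie_derivative M Y (pullback M h induced_metric) (\<psi> u) (coord_vector \<psi> u i) (coord_vector \<psi> u j) =
      \<kappa> 0 (\<psi> u) (coord_vector \<psi> u i) (coord_vector \<psi> u j)" if c: "(V, \<psi>) \<in> A" "u \<in> V" for V \<psi> u i j
  proof -
    let ?p = "\<psi> u"
    have pM: "?p \<in> M" by (rule M[OF c])
    \<comment> \<open>The two differentials are chosen separately, but their composite is a
      derivative of h o phi_t within M and hence agrees with B t on coordinate vectors.\<close>
    have "differential M h (?\<phi> t ?p) (differential M (?\<phi> t) ?p (coord_vector \<psi> u k)) = B t ?p (coord_vector \<psi> u k)" for t k
    proof -
      have "(?\<phi> t has_derivative differential M (?\<phi> t) ?p) (at ?p within M)"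
        unfolding differential_def using \<phi>[OF pM] frechet_derivative_works by blast
      moreover have "(h has_derivative differential M h (?\<phi> t ?p)) (at (?\<phi> t ?p) within M)"
        unfolding differential_def using Dh[OF \<phi>M[OF pM]] differentiableI frechet_derivative_works by blast
      then have "(h has_derivative differential M h (?\<phi> t ?p)) (at (?\<phi> t ?p) within ?\<phi> t ` M)"
        by (rule has_derivative_subset) (use \<phi>M in blast)
      ultimately have "((h \<circ> ?\<phi> t) has_derivative (differential M h (?\<phi> t ?p) \<circ> differential M (?\<phi> t) ?p)) (at ?p within M)"
        by (rule diff_chain_within)
      from derivative_within_unique_on_tangent[OF chart_parametrization[OF c(1)] c(2) this Dh\<phi>[OF pM]]
      show ?thesis by simp
    qed
    then have "lie_derivative M Y (pullback M h induced_metric) ?p (coord_vector \<psi> u i) (coord_vector \<psi> u j) =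
        deriv (\<lambda>t. B t ?p (coord_vector \<psi> u i) \<bullet> B t ?p (coord_vector \<psi> u j)) 0"
      by (simp add: lie_derivative_def pullback_def induced_metric_def)
    then show ?thesis using DERIV_imp_deriv[OF inner] by simp
  qed
  define f where "f t p = (\<Sum>a\<in>Basis. \<Sum>b\<in>Basis. \<sigma> t p (?P p a) (?P p b) * \<sigma> t p (?P p a) (?P p b))" for t p
  define g where "g t p = (\<Sum>a\<in>Basis. \<Sum>b\<in>Basis. \<sigma> t p (?P p a) (?P p b) * \<kappa> t p (?P p a) (?P p b))" for t p
  \<comment> \<open>The density f is a sum of squares of \<sigma>, and \<kappa> is the derivative of
    \<sigma>: this is the origin of the factor 2.\<close>
  have df: "((\<lambda>t. f t p) has_real_derivative 2 * g t p) (at t)" for t p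
  proof -
    have d\<sigma>: "((\<lambda>t. \<sigma> t p v w) has_real_derivative \<kappa> t p v w) (at t)" for v w
      unfolding \<sigma>_def using DERIV_diff[OF inner DERIV_const] by simp
    have "((\<lambda>t. f t p) has_real_derivative (\<Sum>a\<in>Basis. \<Sum>b\<in>Basis.
        \<kappa> t p (?P p a) (?P p b) * \<sigma> t p (?P p a) (?P p b) + \<kappa> t p (?P p a) (?P p b) * \<sigma> t p (?P p a) (?P p b))) (at t)"
      unfolding f_def by (intro DERIV_sum DERIV_mult d\<sigma>)
    then show ?thesis by (simp add: g_def sum_distrib_left mult_ac)
  qed
  have contP: "continuous_on (UNIV \<times> M) (\<lambda>z. ?P (snd z) a)" for a
    by (rule continuous_on_compose2[OF continuous_on_tangent_projection continuous_on_snd[OF continuous_on_id]]) auto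
  have contBP: "continuous_on (UNIV \<times> M) (\<lambda>z. Q (fst z) (snd z) (?P (snd z) a))"
    if "continuous_on UNIV (\<lambda>(t, p). Q t p)" for Q :: "real \<Rightarrow> 'a \<Rightarrow> 'a \<Rightarrow>\<^sub>L 'a" and a
    by (rule bounded_bilinear.continuous_on[OF bounded_bilinear_blinfun_apply _ contP])
      (use that in \<open>auto simp: case_prod_unfold intro: continuous_on_subset\<close>)
  have cont\<sigma>: "continuous_on (UNIV \<times> M) (\<lambda>z. \<sigma> (fst z) (snd z) (?P (snd z) a) (?P (snd z) b))" for a b
    unfolding \<sigma>_def by (intro continuous_on_diff continuous_on_inner contBP[OF contB] contP)
  have cont\<kappa>: "continuous_on (UNIV \<times> M) (\<lambda>z. \<kappa> (fst z) (snd z) (?P (snd z) a) (?P (snd z) b))" for a b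
    unfolding \<kappa>_def by (intro continuous_on_add continuous_on_inner contBP[OF contB] contBP[OF contB'])
  have contf: "continuous_on (UNIV \<times> M) (\<lambda>z. f (fst z) (snd z))"
    unfolding f_def by (intro continuous_on_sum continuous_on_mult cont\<sigma>)
  have contg: "continuous_on (UNIV \<times> M) (\<lambda>z. g (fst z) (snd z))"
    unfolding g_def by (intro continuous_on_sum continuous_on_mult cont\<sigma> cont\<kappa>)
  have slice: "continuous_on M (q t)" if "continuous_on (UNIV \<times> M) (\<lambda>z. q (fst z) (snd z))"
    for q :: "real \<Rightarrow> 'a \<Rightarrow> real" and t
  proof -
    have "continuous_on M (\<lambda>p. q (fst (t, p)) (snd (t, p)))"
      by (rule continuous_on_compose2[OF that, of M "\<lambda>p. (t, p)"]) (auto intro!: continuous_on_Pair continuous_on_const continuous_on_id)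
    then show ?thesis by simp
  qed
  obtain m c \<rho> where pu: "partition_of_unity M A m c \<rho>" using partition_of_unity_exists by blast
  have energy: "deformation_energy M A (h \<circ> ?\<phi> t) = partition_integral m c \<rho> (f t)" for t
    unfolding deformation_energy_def f_def
    by (rule tensor_metric_form_integral[OF pu bil(1,1) strain_flow strain_flow slice[OF contf, unfolded f_def]])
  have variation: "form_integral M A (\<lambda>p vs. tensor_metric A (strain M h)
      (lie_derivative M Y (pullback M h induced_metric)) p * volume_form A p vs) = partition_integral m c \<rho> (g 0)"
    unfolding g_def
    by (rule tensor_metric_form_integral[OF pu bil strain lie slice[OF contg, unfolded g_def]])
  have "((\<lambda>t. partition_integral m c \<rho> (f t)) has_real_derivative partition_integral m c \<rho> (\<lambda>p. 2 * g 0 p)) (at 0)"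
    by (rule has_real_derivative_partition_integral[OF pu df slice[OF contf]])
      (intro continuous_on_mult continuous_on_const contg)
  then show ?thesis
    unfolding energy variation partition_integral_cmult .
qed

end

theorem mainTheorem2:
  fixes M N :: "(real ^ 'm::finite) set"
    and A B :: "('n::finite, real ^ 'm) chart set"
    and h :: "real ^ 'm \<Rightarrow> real ^ 'm"
  assumes "CARD('m) = CARD('n) + 1"
    and "oriented_manifold M A" and "compact M" and "connected M"
    and "oriented_manifold N B" and "compact N" and "connected N"
    and "h \<in> diffeomorphisms M N"
  shows "(\<forall>Y. smooth_vector_field M Y \<longrightarrow>
            ((\<lambda>t. deformation_energy M A (h \<circ> flow M Y t)) has_real_derivative
               2 * form_integral M A
                     (\<lambda>p vs. tensor_metric A (strain M h)
                               (lie_derivative M Y (pullback M h induced_metric)) p *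
                             volume_form A p vs)) (at 0)) \<and>
         (critical_point M A h \<longleftrightarrow>
            (\<forall>Y. smooth_vector_field M Y \<longrightarrow>
               form_integral M A
                 (\<lambda>p vs. tensor_metric A (strain M h)
                           (lie_derivative M Y (pullback M h induced_metric)) p *
                         volume_form A p vs) = 0))"
proof -
  interpret compact_oriented_manifold M A
    by unfold_locales fact+
  have "smooth_map_on M h"
    using \<open>h \<in> diffeomorphisms M N\<close> by (simp add: diffeomorphisms_def)
  note variation = first_variation[OF this]
  \<comment> \<open>Derivatives are unique, so the derivative of the energy is 0 exactly when twice
    the integral is 0.\<close>
  then show ?thesis
    unfolding critical_point_def by (metis (no_types, lifting) DERIV_unique mult_eq_0_iff mult_zero_right zero_neq_numeral)
qed

end
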